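(* Let $m,n\ge 1$ and let $M$ be a connected space-like $m$-dimensional submanifold of the pseudo-Euclidean space $\mathbb{R}^{m+n}_n$ of index $n$. Assume that (1) $M$ is closed with respect to the Euclidean topology, i.e. $M$ is a closed subset of $\mathbb{R}^{m+n}$; (2) $M$ has parallel mean curvature; (3) the image of the Gauss map $\gamma: M\to \mathbf{G}_{m,n}^n$ is a bounded subset of the pseudo-Grassmannian $\mathbf{G}_{m,n}^n$ (with respect to the distance function of its canonical Riemannian metric). Then $M$ is an (affine) linear subspace of $\mathbb{R}^{m+n}_n$.
   Context: $\mathbb{R}^{m+n}_n$ is $\mathbb{R}^{m+n}$ with coordinates $(x_1,\dots,x_m;y_1,\dots,y_n)$ and the inner product $\langle\cdot,\cdot\rangle$ with quadratic form $\sum_i x_i^2-\sum_s y_s^2$. A smooth $m$-dimensional submanifold $M\subset\mathbb{R}^{m+n}_n$ is space-like if $\langle\cdot,\cdot\rangle$ is positive definite on every tangent space $T_xM$; the restriction is the induced Riemannian metric. The normal space $N_xM=(T_xM)^{\perp}$ is then an $n$-dimensional negative definite complement of $T_xM$. Let $\nabla$ be the flat connection of $\mathbb{R}^{m+n}$. The second fundamental form is $B(V,W)=(\nabla_V W)^{\perp}$ (component in $NM$) for tangent fields $V,W$. The mean curvature vector is $H=\frac1m\sum_{i=1}^m B(e_i,e_i)$ for any local orthonormal tangent frame $e_1,\dots,e_m$. The normal connection is $D_V\nu=(\nabla_V\nu)^{\perp}$ for normal fields $\nu$. $M$ has parallel mean curvature if $DH\equiv0$. The pseudo-Grassmannian $\mathbf{G}_{m,n}^n$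 is the manifold of all $m$-dimensional linear subspaces of $\mathbb{R}^{m+n}_n$ on which $\langle\cdot,\cdot\rangle$ is positive definite. Its canonical Riemannian metric is $ds_G^2=\sum_{s,i}(\omega_{si})^2$; that is, for a smooth curve $P(t)$ of space-like $m$-planes, with smooth frames $e_1(t),\dots,e_m(t)$ of $P(t)$ and $e_{m+1}(t),\dots,e_{m+n}(t)$ of $P(t)^\perp$ satisfying $\langle e_i,e_j\rangle=\delta_{ij}$ and $\langle e_s,e_t\rangle=-\delta_{st}$, the squared speed is $\sum_{i=1}^m\sum_{s=m+1}^{m+n}\langle e_i'(t),e_s(t)\rangle^2$. The Gauss map is $\gamma(x)=T_xM$, regarded as a linear subspace by parallel translation to the origin. *)

theory Defs
  imports "HOL-Analysis.Analysis"
begin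

section \<open>Smooth maps\<close>

text \<open>
  \<open>C\<^sup>k\<close> maps on an open set \<open>S\<close>, via iterated directional derivatives so that the codomain
  type does not change along the recursion.  In finite dimension this is the usual notion.
\<close>

primrec Ck_on :: "nat \<Rightarrow> 'a::real_normed_vector set \<Rightarrow> ('a \<Rightarrow> 'b::real_normed_vector) \<Rightarrow> bool" where
  "Ck_on 0 S f \<longleftrightarrow> continuous_on S f"
| "Ck_on (Suc k) S f \<longleftrightarrow>
     (\<forall>x\<in>S. f differentiable (at x)) \<and>
     (\<forall>v. Ck_on k S (\<lambda>x. frechet_derivative f (at x) v))"

definition smooth_on :: "'a::real_normed_vector set \<Rightarrow> ('a \<Rightarrow> 'b::real_normed_vector) \<Rightarrow> bool" where
  "smooth_on S f \<longleftrightarrow> (\<forall>k. Ck_on k S f)"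

text \<open>Smoothness of a map on a subset that need not be open: local smooth extendability.\<close>

definition smooth_along :: "'a::real_normed_vector set \<Rightarrow> ('a \<Rightarrow> 'b::real_normed_vector) \<Rightarrow> bool" where
  "smooth_along S F \<longleftrightarrow>
     (\<forall>p\<in>S. \<exists>U G. open U \<and> p \<in> U \<and> smooth_on U G \<and> (\<forall>x\<in>S \<inter> U. F x = G x))"


section \<open>Pseudo-Euclidean space of index \<open>n\<close>\<close>

text \<open>
  The dimensions are \<open>m = CARD('m)\<close> and \<open>n = CARD('n)\<close>, both automatically at least 1.
  Topology and differentiation on the product type are the usual Euclidean ones.
\<close>

type_synonym ('m, 'n) pseudo = "(real ^ 'm) \<times> (real ^ 'n)"

definition pinner :: "('m::finite, 'n::finite) pseudo \<Rightarrow> ('m, 'n) pseudo \<Rightarrow> real" where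
  "pinner v w = fst v \<bullet> fst w - snd v \<bullet> snd w"

definition pperp :: "('m::finite, 'n::finite) pseudo set \<Rightarrow> ('m, 'n) pseudo set" where
  "pperp T = {w. \<forall>v\<in>T. pinner v w = 0}"

definition pos_def_on :: "('m::finite, 'n::finite) pseudo set \<Rightarrow> bool" where
  "pos_def_on T \<longleftrightarrow> (\<forall>v\<in>T. v \<noteq> 0 \<longrightarrow> pinner v v > 0)"

text \<open>
  The component of \<open>v\<close> in \<open>pperp T\<close> along the splitting \<open>T \<oplus> pperp T\<close>; well defined
  when \<open>T\<close> is a subspace with \<open>pos_def_on T\<close>.
\<close>

definition normal_part :: "('m::finite, 'n::finite) pseudo set \<Rightarrow> ('m, 'n) pseudo \<Rightarrow> ('m, 'n) pseudo" where
  "normal_part T v = (THE w. w \<in> pperp T \<and> v - w \<in> T)"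


section \<open>Space-like submanifolds\<close>

text \<open>Embedded \<open>m\<close>-dimensional smooth submanifolds, by local parametrizations.\<close>

definition submanifold :: "('m::finite, 'n::finite) pseudo set \<Rightarrow> bool" where
  "submanifold M \<longleftrightarrow>
     (\<forall>p\<in>M. \<exists>U (V :: (real ^ 'm) set) \<phi> \<psi>.
        open U \<and> p \<in> U \<and> open V \<and> smooth_on V \<phi> \<and>
        (\<forall>u\<in>V. inj (frechet_derivative \<phi> (at u))) \<and>
        homeomorphism V (M \<inter> U) \<phi> \<psi>)"

definition tangent_space :: "('m::finite, 'n::finite) pseudo set \<Rightarrow> ('m, 'n) pseudo \<Rightarrow> ('m, 'n) pseudo set" where
  "tangent_space M p =
     {v. \<exists>\<epsilon>>0. \<exists>c :: real \<Rightarrow> ('m, 'n) pseudo.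
        smooth_on {-\<epsilon><..<\<epsilon>} c \<and> c ` {-\<epsilon><..<\<epsilon>} \<subseteq> M \<and>
        c 0 = p \<and> (c has_vector_derivative v) (at 0)}"

definition spacelike_submanifold :: "('m::finite, 'n::finite) pseudo set \<Rightarrow> bool" where
  "spacelike_submanifold M \<longleftrightarrow>
     submanifold M \<and> (\<forall>p\<in>M. pos_def_on (tangent_space M p))"

text \<open>
  The flat derivative at \<open>p\<close>, in the direction of a tangent vector \<open>v\<close>, of a field \<open>F\<close> given
  along \<open>M\<close>.  The derivative within \<open>M\<close> uses only the values of \<open>F\<close> on \<open>M\<close>; as a linear map it is
  not unique, but all choices agree on \<open>tangent_space M p\<close>.
\<close>

definition flat_nabla ::
  "('m::finite, 'n::finite) pseudo set \<Rightarrow> ('m, 'n) pseudo \<Rightarrow> (('m, 'n) pseudo \<Rightarrow> ('m, 'n) pseudo) \<Rightarrow>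
   ('m, 'n) pseudo \<Rightarrow> ('m, 'n) pseudo" where
  "flat_nabla M v F p = frechet_derivative F (at p within M) v"

definition second_fundamental_form ::
  "('m::finite, 'n::finite) pseudo set \<Rightarrow> (('m, 'n) pseudo \<Rightarrow> ('m, 'n) pseudo) \<Rightarrow>
   (('m, 'n) pseudo \<Rightarrow> ('m, 'n) pseudo) \<Rightarrow> ('m, 'n) pseudo \<Rightarrow> ('m, 'n) pseudo" where
  "second_fundamental_form M V W p = normal_part (tangent_space M p) (flat_nabla M (V p) W p)"

definition orthonormal_tangent_frame ::
  "('m::finite, 'n::finite) pseudo set \<Rightarrow> ('m, 'n) pseudo set \<Rightarrow>
   ('m \<Rightarrow> ('m, 'n) pseudo \<Rightarrow> ('m, 'n) pseudo) \<Rightarrow> bool" where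
  "orthonormal_tangent_frame M U e \<longleftrightarrow>
     open U \<and> (\<forall>i. smooth_along (M \<inter> U) (e i)) \<and>
     (\<forall>x\<in>M \<inter> U. (\<forall>i. e i x \<in> tangent_space M x) \<and>
        (\<forall>i j. pinner (e i x) (e j x) = (if i = j then 1 else 0)))"

text \<open>The value does not depend on the local frame, which is what makes \<open>THE\<close> meaningful.\<close>

definition mean_curvature ::
  "('m::finite, 'n::finite) pseudo set \<Rightarrow> ('m, 'n) pseudo \<Rightarrow> ('m, 'n) pseudo" where
  "mean_curvature M p =
     (THE h. \<exists>U e. p \<in> U \<and> orthonormal_tangent_frame M U e \<and>
        h = (1 / real CARD('m)) *\<^sub>R (\<Sum>i\<in>UNIV. second_fundamental_form M (e i) (e i) p))"

text \<open>\<open>D\<^sub>V \<nu>\<close> at \<open>p\<close> depends on \<open>V\<close> only through \<open>v = V p\<close>.\<close>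

definition normal_connection ::
  "('m::finite, 'n::finite) pseudo set \<Rightarrow> ('m, 'n) pseudo \<Rightarrow> (('m, 'n) pseudo \<Rightarrow> ('m, 'n) pseudo) \<Rightarrow>
   ('m, 'n) pseudo \<Rightarrow> ('m, 'n) pseudo" where
  "normal_connection M v \<nu> p = normal_part (tangent_space M p) (flat_nabla M v \<nu> p)"

definition parallel_mean_curvature :: "('m::finite, 'n::finite) pseudo set \<Rightarrow> bool" where
  "parallel_mean_curvature M \<longleftrightarrow>
     (\<forall>p\<in>M. \<forall>v\<in>tangent_space M p. normal_connection M v (mean_curvature M) p = 0)"


section \<open>The pseudo-Grassmannian and the Gauss map\<close>

definition pseudo_grassmannian :: "('m::finite, 'n::finite) pseudo set set" where
  "pseudo_grassmannian = {P. subspace P \<and> dim P = CARD('m) \<and> pos_def_on P}"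

definition adapted_frames ::
  "real set \<Rightarrow> (real \<Rightarrow> ('m::finite, 'n::finite) pseudo set) \<Rightarrow>
   ('m \<Rightarrow> real \<Rightarrow> ('m, 'n) pseudo) \<Rightarrow> ('n \<Rightarrow> real \<Rightarrow> ('m, 'n) pseudo) \<Rightarrow> bool" where
  "adapted_frames I P e f \<longleftrightarrow>
     (\<forall>i. smooth_on I (e i)) \<and> (\<forall>s. smooth_on I (f s)) \<and>
     (\<forall>t\<in>I. (\<forall>i. e i t \<in> P t) \<and> (\<forall>s. f s t \<in> pperp (P t)) \<and>
        (\<forall>i j. pinner (e i t) (e j t) = (if i = j then 1 else 0)) \<and>
        (\<forall>r s. pinner (f r t) (f s t) = (if r = s then - 1 else 0)))"

definition grassmann_speed ::
  "('m::finite \<Rightarrow> real \<Rightarrow> ('m, 'n::finite) pseudo) \<Rightarrow> ('n \<Rightarrow> real \<Rightarrow> ('m, 'n) pseudo) \<Rightarrow> real \<Rightarrow> real" where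
  "grassmann_speed e f t =
     sqrt (\<Sum>i\<in>UNIV. \<Sum>s\<in>UNIV. (pinner (vector_derivative (e i) (at t)) (f s t))\<^sup>2)"

text \<open>
  The Riemannian distance: infimum of the lengths of smooth curves in the Grassmannian.
  A curve of planes over an interval is smooth iff it has smooth adapted frames there.
  Curves may have zero speed at some times, so piecewise smooth curves, which can be
  reparametrized to stop at their corners, give the same infimum.
  Extended real values make the infimum over the empty set infinite instead of junk.
\<close>

definition grassmann_dist :: "('m::finite, 'n::finite) pseudo set \<Rightarrow> ('m, 'n) pseudo set \<Rightarrow> ereal" where
  "grassmann_dist P Q =
     Inf {ereal (integral {0..1} (grassmann_speed e f)) | c I e f.
            open I \<and> {0..1} \<subseteq> I \<and> (\<forall>t\<in>I. c t \<in> pseudo_grassmannian) \<and>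
            adapted_frames I c e f \<and> c 0 = P \<and> c 1 = Q}"

definition grassmann_bounded :: "('m::finite, 'n::finite) pseudo set set \<Rightarrow> bool" where
  "grassmann_bounded S \<longleftrightarrow>
     S \<subseteq> pseudo_grassmannian \<and> (\<exists>C::real. \<forall>P\<in>S. \<forall>Q\<in>S. grassmann_dist P Q \<le> ereal C)"

definition gauss_map :: "('m::finite, 'n::finite) pseudo set \<Rightarrow> ('m, 'n) pseudo \<Rightarrow> ('m, 'n) pseudo set" where
  "gauss_map M x = tangent_space M x"

end

theory Submission
  imports Defs
begin

text \<open>
  A closed connected space-like submanifold with parallel mean curvature and bounded Gauss image is an
  affine subspace.  The proof applies the maximum principle twice, to two functions on \<open>M\<close>.

  A bounded set of space-like planes is uniformly space-like: the Euclidean norm is controlled by the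
  pseudo inner product on all tangent spaces, and by its negative on all normal spaces
  (\<open>grassmann_bounded_uniform\<close>).  The definite form attached to a plane changes at a rate bounded by
  the speed of the curve of planes, so Gronwall's inequality turns bounded distance into bounded
  distortion.

  The first function is the frame energy, the sum of the squared Euclidean lengths of an orthonormal
  tangent frame.  It is bounded.  For parallel mean curvature \<open>H\<close> its Laplacian is at least twice the
  squared norm \<open>S\<close> of the second fundamental form (\<open>laplacian_energy_lower\<close>), because the Gauss map is
  harmonic and the function is convex on the space of planes.  Moreover \<open>S\<close> is at least \<open>m |H|\<^sup>2\<close>, and
  \<open>|H|\<close> is constant.  A bounded function on \<open>M\<close> cannot have a Laplacian bounded below by a positive
  constant: at a maximum of the function minus a small multiple of the squared Euclidean norm, the
  Laplacian is arbitrarily small.  Hence \<open>H = 0\<close> (\<open>mean_curvature_zero\<close>).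

  The second function is \<open>S\<close>.  When \<open>H = 0\<close>, the Simons identity gives that its Laplacian is at least
  a positive constant times \<open>S\<^sup>2\<close> (\<open>simons_inequality\<close>); the sign of the quartic terms is favourable
  because the normal spaces are negative definite.  Multiplying \<open>S\<close> by the square of a quadratic cutoff
  on a Euclidean ball of radius \<open>\<rho>\<close> and evaluating at the maximum yields \<open>S = O(\<rho>\<^sup>-\<^sup>2)\<close> at the centre
  (\<open>curvature_decay\<close>), so \<open>S = 0\<close>.  A submanifold with \<open>S = 0\<close> is locally an open piece of its tangent
  plane, and a closed connected one is the whole plane (\<open>locally_flat_imp_affine\<close>).

  All computations are made at the centre of a chart that presents \<open>M\<close> as a graph over its tangent space
  there (\<open>gauge_chart\<close>).  At other points of the chart the two functions are compared, not computed:
  for every metric \<open>1 - A\<close> with \<open>A \<ge> 0\<close> one has \<open>(1 - A)\<^sup>-\<^sup>1 \<ge> 1 + A\<close>, which gives lower barriers that are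
  polynomial in the derivatives of the graph and touch the functions at the centre.  A local maximum of
  a function is a local maximum of its barrier, so derivatives of the barrier at the centre are all
  that the maximum principle needs.
\<close>

section \<open>Calculus of smooth maps\<close>

text \<open>
  The direction is the first argument so that iterated derivatives are plain nestings,
  \<open>dird w (dird v f)\<close>, without a bound base point.
\<close>

definition dird :: "'a::real_normed_vector \<Rightarrow> ('a \<Rightarrow> 'b::real_normed_vector) \<Rightarrow> 'a \<Rightarrow> 'b" where
  "dird v f x = frechet_derivative f (at x) v"

lemma Ck_on_Suc_dird:
  "Ck_on (Suc k) S f \<longleftrightarrow> (\<forall>x\<in>S. f differentiable (at x)) \<and> (\<forall>v. Ck_on k S (dird v f))"
  by (simp add: dird_def[abs_def])

declare Ck_on.simps(2) [simp del]

lemma dird_eqI: "(f has_derivative f') (at x) \<Longrightarrow> dird v f x = f' v"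
  unfolding dird_def by (metis frechet_derivative_at)

lemma has_derivative_dird: "f differentiable (at x) \<Longrightarrow> (f has_derivative (\<lambda>v. dird v f x)) (at x)"
  by (simp add: dird_def[abs_def] frechet_derivative_works[symmetric])

lemma dird_cong_open:
  assumes "open S" "x \<in> S" "\<And>y. y \<in> S \<Longrightarrow> f y = g y"
  shows "dird v f x = dird v g x"
proof -
  have "f differentiable (at x) \<longleftrightarrow> g differentiable (at x)"
    using assms unfolding differentiable_def
    by (metis has_derivative_transform_within_open)
  moreover have "(f has_derivative f') (at x) \<longleftrightarrow> (g has_derivative f') (at x)" for f'
    using assms by (metis has_derivative_transform_within_open)
  ultimately show ?thesis
    unfolding dird_def frechet_derivative_def by simp
qed

lemma Ck_on_cong:
  assumes "open S" "\<And>y. y \<in> S \<Longrightarrow> f y = g y"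
  shows "Ck_on k S f \<longleftrightarrow> Ck_on k S g"
  using assms(2)
proof (induction k arbitrary: f g)
  case 0 then show ?case by (simp cong: continuous_on_cong)
next
  case (Suc k)
  have "f differentiable (at x) \<longleftrightarrow> g differentiable (at x)" if "x \<in> S" for x
    using Suc.prems that assms(1) unfolding differentiable_def
    by (metis has_derivative_transform_within_open)
  moreover have "Ck_on k S (dird v f) \<longleftrightarrow> Ck_on k S (dird v g)" for v
    by (rule Suc.IH) (use dird_cong_open[OF assms(1)] Suc.prems in blast)
  ultimately show ?case by (simp add: Ck_on_Suc_dird)
qed

lemma Ck_on_subset: "Ck_on k S f \<Longrightarrow> T \<subseteq> S \<Longrightarrow> Ck_on k T f"
  by (induction k arbitrary: f) (auto simp: Ck_on_Suc_dird intro: continuous_on_subset)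

lemma Ck_on_Suc_imp: "Ck_on (Suc k) S f \<Longrightarrow> Ck_on k S f"
proof (induction k arbitrary: f)
  case 0
  then show ?case
    by (simp add: Ck_on_Suc_dird continuous_at_imp_continuous_on differentiable_imp_continuous_within)
next
  case (Suc k)
  then show ?case by (simp add: Ck_on_Suc_dird[of "Suc k"] Ck_on_Suc_dird[of k])
qed

lemma Ck_on_const: "Ck_on k S (\<lambda>x. c)"
proof (induction k arbitrary: c)
  case (Suc k)
  have "dird v (\<lambda>x. c) = (\<lambda>x. 0)" for v :: 'a by (simp add: dird_def fun_eq_iff)
  then show ?case using Suc by (simp add: Ck_on_Suc_dird)
qed simp

lemma Ck_on_bounded_linear:
  assumes "bounded_linear h"
  shows "Ck_on k S h"
proof (cases k)
  case 0 then show ?thesis using assms by (simp add: linear_continuous_on)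
next
  case (Suc j)
  have "dird v h = (\<lambda>x. h v)" for v
    using bounded_linear_imp_has_derivative[OF assms] dird_eqI by blast
  then show ?thesis using assms Suc
    by (simp add: Ck_on_Suc_dird Ck_on_const bounded_linear_imp_differentiable)
qed

lemma Ck_on_add:
  assumes "open S" "Ck_on k S f" "Ck_on k S g"
  shows "Ck_on k S (\<lambda>x. f x + g x)"
  using assms(2,3)
proof (induction k arbitrary: f g)
  case 0 then show ?case by (simp add: continuous_on_add)
next
  case (Suc k)
  have d: "dird v (\<lambda>x. f x + g x) x = dird v f x + dird v g x" if "x \<in> S" for v x
    using Suc.prems that
    by (intro dird_eqI has_derivative_add has_derivative_dird) (auto simp: Ck_on_Suc_dird)
  have "Ck_on k S (dird v (\<lambda>x. f x + g x))" for v
    using Ck_on_cong[OF assms(1) d] Suc by (simp add: Ck_on_Suc_dird)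
  then show ?case using Suc.prems by (auto simp: Ck_on_Suc_dird intro: differentiable_add)
qed

lemma Ck_on_bilinear:
  assumes "bounded_bilinear h" "open S" "Ck_on k S f" "Ck_on k S g"
  shows "Ck_on k S (\<lambda>x. h (f x) (g x))"
  using assms(3,4)
proof (induction k arbitrary: f g)
  case 0 then show ?case by (simp add: bounded_bilinear.continuous_on[OF assms(1)])
next
  case (Suc k)
  have H: "((\<lambda>x. h (f x) (g x)) has_derivative (\<lambda>v. h (f x) (dird v g x) + h (dird v f x) (g x))) (at x)"
    if "x \<in> S" for x
    using Suc.prems that
    by (intro bounded_bilinear.FDERIV[OF assms(1)] has_derivative_dird) (auto simp: Ck_on_Suc_dird)
  have d: "dird v (\<lambda>x. h (f x) (g x)) x = h (f x) (dird v g x) + h (dird v f x) (g x)" if "x \<in> S" for v x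
    using dird_eqI[OF H[OF that]] .
  have "Ck_on k S (\<lambda>x. h (f x) (dird v g x) + h (dird v f x) (g x))" for v
  proof (rule Ck_on_add[OF assms(2)])
    show "Ck_on k S (\<lambda>x. h (f x) (dird v g x))"
      by (rule Suc.IH) (use Suc.prems Ck_on_Suc_imp Ck_on_Suc_dird in blast)+
    show "Ck_on k S (\<lambda>x. h (dird v f x) (g x))"
      by (rule Suc.IH) (use Suc.prems Ck_on_Suc_imp Ck_on_Suc_dird in blast)+
  qed
  then have "Ck_on k S (dird v (\<lambda>x. h (f x) (g x)))" for v
    using Ck_on_cong[OF assms(2) d] by simp
  then show ?case using H by (auto simp: Ck_on_Suc_dird differentiable_def)
qed

lemma Ck_on_sum:
  assumes "open S" "\<And>i. i \<in> I \<Longrightarrow> Ck_on k S (f i)"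
  shows "Ck_on k S (\<lambda>x. \<Sum>i\<in>I. f i x)"
  using assms(2) by (induction I rule: infinite_finite_induct) (auto intro: Ck_on_const Ck_on_add[OF assms(1)])

text \<open>
  The derivative of \<open>g \<circ> f\<close> along \<open>v\<close> is a derivative of \<open>g\<close> in a direction that moves with \<open>x\<close>.
  Expanding that direction in the standard basis leaves sums of products of \<open>C\<^sup>k\<close> functions, to
  which the induction hypothesis and the bilinear rule apply.
\<close>

lemma Ck_on_compose:
  fixes f :: "'a::real_normed_vector \<Rightarrow> 'b::euclidean_space" and g :: "'b \<Rightarrow> 'c::real_normed_vector"
  assumes "open S" "open T" "f ` S \<subseteq> T" "Ck_on k S f" "Ck_on k T g"
  shows "Ck_on k S (\<lambda>x. g (f x))"
  using assms(4,5)
proof (induction k arbitrary: g)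
  case 0
  then show ?case using continuous_on_compose2[of T g S f] assms(3) by simp
next
  case (Suc k)
  have H: "((\<lambda>x. g (f x)) has_derivative (\<lambda>v. dird (dird v f x) g (f x))) (at x)" if "x \<in> S" for x
    using diff_chain_at[OF has_derivative_dird[of f x] has_derivative_dird[of g "f x"]]
      Suc.prems that assms(3) by (auto simp: Ck_on_Suc_dird o_def)
  have d: "dird v (\<lambda>x. g (f x)) x = (\<Sum>b\<in>Basis. (dird v f x \<bullet> b) *\<^sub>R dird b g (f x))" if "x \<in> S" for v x
  proof -
    have "g differentiable (at (f x))" using Suc.prems that assms(3) by (auto simp: Ck_on_Suc_dird)
    then have "linear (\<lambda>v. dird v g (f x))"
      unfolding dird_def by (rule linear_frechet_derivative)
    then have "dird (\<Sum>b\<in>Basis. (dird v f x \<bullet> b) *\<^sub>R b) g (f x) = (\<Sum>b\<in>Basis. (dird v f x \<bullet> b) *\<^sub>R dird b g (f x))"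
      by (simp add: linear_sum[of "\<lambda>v. dird v g (f x)"] linear_cmul[of "\<lambda>v. dird v g (f x)"])
    then show ?thesis using dird_eqI[OF H[OF that]] by (simp add: euclidean_representation)
  qed
  have "Ck_on k S (\<lambda>x. \<Sum>b\<in>Basis. (dird v f x \<bullet> b) *\<^sub>R dird b g (f x))" for v
  proof (rule Ck_on_sum[OF assms(1)])
    fix b :: 'b
    have 1: "Ck_on k S (\<lambda>x. dird v f x \<bullet> b)"
      using Ck_on_bilinear[OF bounded_bilinear_inner assms(1), of k "dird v f" "\<lambda>_. b"] Suc.prems
      by (simp add: Ck_on_Suc_dird Ck_on_const)
    have 2: "Ck_on k S (\<lambda>x. dird b g (f x))"
      by (rule Suc.IH) (use Suc.prems Ck_on_Suc_imp Ck_on_Suc_dird in blast)+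
    show "Ck_on k S (\<lambda>x. (dird v f x \<bullet> b) *\<^sub>R dird b g (f x))"
      by (rule Ck_on_bilinear[OF bounded_bilinear_scaleR assms(1) 1 2])
  qed
  then have "Ck_on k S (dird v (\<lambda>x. g (f x)))" for v
    using Ck_on_cong[OF assms(1) d] by simp
  then show ?case using H by (auto simp: Ck_on_Suc_dird differentiable_def)
qed

lemma smooth_on_dird: "smooth_on S f \<Longrightarrow> smooth_on S (dird v f)"
  unfolding smooth_on_def using Ck_on_Suc_dird by blast

lemma smooth_on_differentiable: "smooth_on S f \<Longrightarrow> x \<in> S \<Longrightarrow> f differentiable (at x)"
  unfolding smooth_on_def using Ck_on_Suc_dird by blast

lemma smooth_on_has_derivative: "smooth_on S f \<Longrightarrow> x \<in> S \<Longrightarrow> (f has_derivative (\<lambda>v. dird v f x)) (at x)"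
  by (simp add: has_derivative_dird smooth_on_differentiable)

lemma smooth_on_continuous_on: "smooth_on S f \<Longrightarrow> continuous_on S f"
  unfolding smooth_on_def using Ck_on.simps(1) by blast

lemma smooth_on_linear_dird: "smooth_on S f \<Longrightarrow> x \<in> S \<Longrightarrow> linear (\<lambda>v. dird v f x)"
  using smooth_on_has_derivative has_derivative_linear by blast

lemma smooth_on_subset: "smooth_on S f \<Longrightarrow> T \<subseteq> S \<Longrightarrow> smooth_on T f"
  by (auto simp: smooth_on_def intro: Ck_on_subset)

lemma smooth_on_const: "smooth_on S (\<lambda>x. c)"
  by (simp add: smooth_on_def Ck_on_const)

lemma smooth_on_bounded_linear: "bounded_linear h \<Longrightarrow> smooth_on S h"
  by (simp add: smooth_on_def Ck_on_bounded_linear)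

lemma smooth_on_id: "smooth_on S (\<lambda>x. x)"
  by (rule smooth_on_bounded_linear) (rule bounded_linear_ident)

lemma smooth_on_add: "open S \<Longrightarrow> smooth_on S f \<Longrightarrow> smooth_on S g \<Longrightarrow> smooth_on S (\<lambda>x. f x + g x)"
  by (simp add: smooth_on_def Ck_on_add)

lemma smooth_on_sum: "open S \<Longrightarrow> (\<And>i. i \<in> I \<Longrightarrow> smooth_on S (f i)) \<Longrightarrow> smooth_on S (\<lambda>x. \<Sum>i\<in>I. f i x)"
  by (simp add: smooth_on_def Ck_on_sum)

lemma smooth_on_bilinear:
  "bounded_bilinear h \<Longrightarrow> open S \<Longrightarrow> smooth_on S f \<Longrightarrow> smooth_on S g \<Longrightarrow> smooth_on S (\<lambda>x. h (f x) (g x))"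
  by (simp add: smooth_on_def Ck_on_bilinear)

lemmas smooth_on_mult = smooth_on_bilinear[OF bounded_bilinear_mult]
lemmas smooth_on_scaleR = smooth_on_bilinear[OF bounded_bilinear_scaleR]

lemma smooth_on_compose:
  fixes f :: "'a::real_normed_vector \<Rightarrow> 'b::euclidean_space" and g :: "'b \<Rightarrow> 'c::real_normed_vector"
  shows "open S \<Longrightarrow> open T \<Longrightarrow> f ` S \<subseteq> T \<Longrightarrow> smooth_on S f \<Longrightarrow> smooth_on T g \<Longrightarrow> smooth_on S (\<lambda>x. g (f x))"
  unfolding smooth_on_def using Ck_on_compose by blast

lemma smooth_on_linear_compose:
  fixes f :: "'a::real_normed_vector \<Rightarrow> 'b::euclidean_space"
  shows "open S \<Longrightarrow> bounded_linear h \<Longrightarrow> smooth_on S f \<Longrightarrow> smooth_on S (\<lambda>x. h (f x))"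
  by (rule smooth_on_compose[where T=UNIV]) (auto intro: smooth_on_bounded_linear)

lemma smooth_on_minus: "open S \<Longrightarrow> smooth_on S f \<Longrightarrow> smooth_on S (\<lambda>x. - f x)"
  using smooth_on_scaleR[of S "\<lambda>_. -1" f] by (simp add: smooth_on_const)

lemma smooth_on_diff: "open S \<Longrightarrow> smooth_on S f \<Longrightarrow> smooth_on S g \<Longrightarrow> smooth_on S (\<lambda>x. f x - g x)"
  using smooth_on_add[of S f "\<lambda>x. - g x"] smooth_on_minus[of S g] by simp

lemma smooth_on_prod:
  fixes f :: "'i \<Rightarrow> 'a::real_normed_vector \<Rightarrow> real"
  assumes "open S" "\<And>i. i \<in> I \<Longrightarrow> smooth_on S (f i)"
  shows "smooth_on S (\<lambda>x. \<Prod>i\<in>I. f i x)"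
  using assms(2) by (induction I rule: infinite_finite_induct) (auto intro: smooth_on_const smooth_on_mult[OF assms(1)])

text \<open>
  If \<open>h\<close> is \<open>C\<^sup>k\<close>, then so is its derivative, being a multiple of a power of \<open>h\<close>, and hence \<open>h\<close> is
  \<open>C\<^sup>k\<^sup>+\<^sup>1\<close>.  Serves \<open>1/t\<close> and \<open>1/sqrt t\<close>.
\<close>

lemma smooth_on_real_bootstrap:
  fixes h :: "real \<Rightarrow> real"
  assumes "open S" "\<And>x. x \<in> S \<Longrightarrow> (h has_real_derivative c * h x ^ j) (at x)"
  shows "smooth_on S h"
proof -
  have H: "(h has_derivative (\<lambda>v. c * h x ^ j * v)) (at x)" if "x \<in> S" for x
    using assms(2)[OF that] by (simp add: has_field_derivative_def)
  have "Ck_on k S h" for k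
  proof (induction k)
    case 0
    then show ?case using H has_derivative_continuous continuous_at_imp_continuous_on by (metis Ck_on.simps(1))
  next
    case (Suc k)
    have d: "dird v h x = c * h x ^ j * v" if "x \<in> S" for x v
      using dird_eqI[OF H[OF that]] .
    have "Ck_on k S (\<lambda>x. h x ^ i)" for i
      by (induction i) (auto intro: Ck_on_const Ck_on_bilinear[OF bounded_bilinear_mult assms(1) Suc])
    then have "Ck_on k S (\<lambda>x. c * h x ^ j * v)" for v
      by (intro Ck_on_bilinear[OF bounded_bilinear_mult assms(1)] Ck_on_const) auto
    then have "Ck_on k S (dird v h)" for v
      using Ck_on_cong[OF assms(1) d] by simp
    then show ?case using H by (auto simp: Ck_on_Suc_dird differentiable_def)
  qed
  then show ?thesis by (simp add: smooth_on_def)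
qed

lemma smooth_on_inverse:
  fixes f :: "'a::real_normed_vector \<Rightarrow> real"
  assumes "open S" "smooth_on S f" "\<And>x. x \<in> S \<Longrightarrow> f x \<noteq> 0"
  shows "smooth_on S (\<lambda>x. inverse (f x))"
proof (rule smooth_on_compose[OF assms(1) _ _ assms(2)])
  show "open (- {0::real})" by (simp add: open_Compl)
  show "f ` S \<subseteq> - {0}" using assms(3) by auto
  show "smooth_on (- {0}) (inverse :: real \<Rightarrow> real)"
    by (rule smooth_on_real_bootstrap[where c="-1" and j=2])
      (auto intro!: derivative_eq_intros simp: power2_eq_square)
qed

lemma smooth_on_inverse_sqrt:
  fixes f :: "'a::real_normed_vector \<Rightarrow> real"
  assumes "open S" "smooth_on S f" "\<And>x. x \<in> S \<Longrightarrow> f x > 0"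
  shows "smooth_on S (\<lambda>x. inverse (sqrt (f x)))"
proof (rule smooth_on_compose[OF assms(1) _ _ assms(2)])
  show "open {0::real<..}" by simp
  show "f ` S \<subseteq> {0<..}" using assms(3) by auto
  show "smooth_on {0<..} (\<lambda>t. inverse (sqrt t))"
    by (rule smooth_on_real_bootstrap[where c="-1/2" and j=3])
      (auto intro!: derivative_eq_intros simp: power3_eq_cube field_simps)
qed

subsection \<open>Rules for directional derivatives\<close>

lemma dird_add: "f differentiable at x \<Longrightarrow> g differentiable at x \<Longrightarrow> dird v (\<lambda>x. f x + g x) x = dird v f x + dird v g x"
  by (intro dird_eqI has_derivative_add has_derivative_dird)

lemma dird_sum:
  "(\<And>i. i \<in> I \<Longrightarrow> f i differentiable at x) \<Longrightarrow> dird v (\<lambda>x. \<Sum>i\<in>I. f i x) x = (\<Sum>i\<in>I. dird v (f i) x)"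
  by (intro dird_eqI has_derivative_sum has_derivative_dird)

lemma dird_const: "dird v (\<lambda>x. c) x = 0"
  by (simp add: dird_def)

lemma dird_bilinear:
  assumes "bounded_bilinear h" "f differentiable at x" "g differentiable at x"
  shows "dird v (\<lambda>x. h (f x) (g x)) x = h (f x) (dird v g x) + h (dird v f x) (g x)"
  by (rule dird_eqI[OF bounded_bilinear.FDERIV[OF assms(1) has_derivative_dird[OF assms(2)] has_derivative_dird[OF assms(3)]]])

lemmas dird_mult = dird_bilinear[OF bounded_bilinear_mult]

lemma dird_linear_compose:
  assumes "bounded_linear h" "f differentiable at x"
  shows "dird v (\<lambda>x. h (f x)) x = h (dird v f x)"
  by (rule dird_eqI[OF bounded_linear.has_derivative[OF assms(1) has_derivative_dird[OF assms(2)]]])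

lemma dird_dird_bilinear:
  assumes h: "bounded_bilinear h" and S: "open S" "x \<in> S" "smooth_on S f" "smooth_on S g"
  shows "dird w (dird v (\<lambda>x. h (f x) (g x))) x =
    h (dird w (dird v f) x) (g x) + h (dird v f x) (dird w g x) + h (dird w f x) (dird v g x) + h (f x) (dird w (dird v g) x)"
proof -
  note sm = smooth_on_differentiable[OF _ S(2)]
  have "dird w (dird v (\<lambda>x. h (f x) (g x))) x = dird w (\<lambda>x. h (f x) (dird v g x) + h (dird v f x) (g x)) x"
    by (rule dird_cong_open[OF S(1,2)]) (rule dird_bilinear[OF h smooth_on_differentiable[OF S(3)] smooth_on_differentiable[OF S(4)]])
  also have "\<dots> = dird w (\<lambda>x. h (f x) (dird v g x)) x + dird w (\<lambda>x. h (dird v f x) (g x)) x"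
    by (rule dird_add) (rule sm, rule smooth_on_bilinear[OF h S(1)], (rule S smooth_on_dird[OF S(3)] smooth_on_dird[OF S(4)])+)+
  also have "dird w (\<lambda>x. h (f x) (dird v g x)) x = h (f x) (dird w (dird v g) x) + h (dird w f x) (dird v g x)"
    by (rule dird_bilinear[OF h sm[OF S(3)] sm[OF smooth_on_dird[OF S(4)]]])
  also have "dird w (\<lambda>x. h (dird v f x) (g x)) x = h (dird v f x) (dird w g x) + h (dird w (dird v f) x) (g x)"
    by (rule dird_bilinear[OF h sm[OF smooth_on_dird[OF S(3)]] sm[OF S(4)]])
  finally show ?thesis by (simp add: algebra_simps)
qed

lemmas dird_dird_mult = dird_dird_bilinear[OF bounded_bilinear_mult]

lemma dird_dird_sum:
  assumes S: "open S" "x \<in> S" "\<And>i. i \<in> I \<Longrightarrow> smooth_on S (f i)"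
  shows "dird w (dird v (\<lambda>x. \<Sum>i\<in>I. f i x)) x = (\<Sum>i\<in>I. dird w (dird v (f i)) x)"
proof -
  have "dird w (dird v (\<lambda>x. \<Sum>i\<in>I. f i x)) x = dird w (\<lambda>x. \<Sum>i\<in>I. dird v (f i) x) x"
    by (rule dird_cong_open[OF S(1,2)]) (use S in \<open>auto intro!: dird_sum smooth_on_differentiable\<close>)
  also have "\<dots> = (\<Sum>i\<in>I. dird w (dird v (f i)) x)"
    by (rule dird_sum) (use S in \<open>auto intro!: smooth_on_differentiable smooth_on_dird\<close>)
  finally show ?thesis .
qed

lemma dird_dird_add:
  assumes S: "open S" "x \<in> S" "smooth_on S f" "smooth_on S g"
  shows "dird w (dird v (\<lambda>x. f x + g x)) x = dird w (dird v f) x + dird w (dird v g) x"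
proof -
  have "dird w (dird v (\<lambda>x. f x + g x)) x = dird w (\<lambda>x. dird v f x + dird v g x) x"
    by (rule dird_cong_open[OF S(1,2)]) (use S in \<open>auto intro!: dird_add smooth_on_differentiable\<close>)
  also have "\<dots> = dird w (dird v f) x + dird w (dird v g) x"
    by (rule dird_add) (use S in \<open>auto intro!: smooth_on_differentiable smooth_on_dird\<close>)
  finally show ?thesis .
qed

lemma line_has_derivative:
  assumes "smooth_on S f" "x + t *\<^sub>R v \<in> S"
  shows "((\<lambda>t. f (x + t *\<^sub>R v)) has_vector_derivative dird v f (x + t *\<^sub>R v)) (at t)"
proof -
  have "((\<lambda>t. x + t *\<^sub>R v) has_derivative (\<lambda>h. h *\<^sub>R v)) (at t)"
    by (auto intro!: derivative_eq_intros)
  from diff_chain_at[OF this smooth_on_has_derivative[OF assms]]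
  have "((\<lambda>t. f (x + t *\<^sub>R v)) has_derivative (\<lambda>h. dird (h *\<^sub>R v) f (x + t *\<^sub>R v))) (at t)"
    by (simp add: o_def)
  moreover have "dird (h *\<^sub>R v) f (x + t *\<^sub>R v) = h *\<^sub>R dird v f (x + t *\<^sub>R v)" for h
    using smooth_on_linear_dird[OF assms] linear_cmul by blast
  ultimately show ?thesis by (simp add: has_vector_derivative_def)
qed

text \<open>
  Symmetry of second derivatives: the second difference quotient is symmetric in the two
  directions, and two applications of the mean value theorem, one direction after the other,
  identify its limit with either mixed derivative.
\<close>

lemma second_difference_mean_value:
  fixes f :: "'a::real_normed_vector \<Rightarrow> real"
  assumes S: "smooth_on S f" and h: "h > 0"
    and box: "\<And>s t. 0 \<le> s \<Longrightarrow> s \<le> h \<Longrightarrow> 0 \<le> t \<Longrightarrow> t \<le> h \<Longrightarrow> x + s *\<^sub>R v + t *\<^sub>R w \<in> S"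
  shows "\<exists>s t. 0 \<le> s \<and> s \<le> h \<and> 0 \<le> t \<and> t \<le> h \<and>
    f (x + h *\<^sub>R v + h *\<^sub>R w) - f (x + h *\<^sub>R v) - f (x + h *\<^sub>R w) + f x
      = h * h * dird w (dird v f) (x + s *\<^sub>R v + t *\<^sub>R w)"
proof -
  define \<phi> where "\<phi> s = f ((x + h *\<^sub>R w) + s *\<^sub>R v) - f (x + s *\<^sub>R v)" for s
  have in1: "(x + h *\<^sub>R w) + s *\<^sub>R v \<in> S" if "0 \<le> s" "s \<le> h" for s
    using box[of s h] that h by (simp add: algebra_simps)
  have in2: "x + s *\<^sub>R v \<in> S" if "0 \<le> s" "s \<le> h" for s
    using box[of s 0] that h by simp
  have "\<exists>s>0. s < h \<and> \<phi> h - \<phi> 0 = (h - 0) * (dird v f ((x + h *\<^sub>R w) + s *\<^sub>R v) - dird v f (x + s *\<^sub>R v))"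
    unfolding \<phi>_def
    by (rule MVT2[OF h])
      (intro DERIV_diff line_has_derivative[OF S, unfolded has_real_derivative_iff_has_vector_derivative[symmetric]] in1 in2; simp)
  then obtain s where s: "0 < s" "s < h"
    "\<phi> h - \<phi> 0 = h * (dird v f ((x + h *\<^sub>R w) + s *\<^sub>R v) - dird v f (x + s *\<^sub>R v))" by auto
  have in3: "(x + s *\<^sub>R v) + t *\<^sub>R w \<in> S" if "0 \<le> t" "t \<le> h" for t
    using box[of s t] that s by simp
  have "\<exists>t>0. t < h \<and> dird v f ((x + s *\<^sub>R v) + h *\<^sub>R w) - dird v f ((x + s *\<^sub>R v) + 0 *\<^sub>R w)
      = (h - 0) * dird w (dird v f) ((x + s *\<^sub>R v) + t *\<^sub>R w)"
    by (rule MVT2[OF h])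
      (intro line_has_derivative[OF smooth_on_dird[OF S], unfolded has_real_derivative_iff_has_vector_derivative[symmetric]] in3; simp)
  then obtain t where t: "0 < t" "t < h"
    "dird v f ((x + s *\<^sub>R v) + h *\<^sub>R w) - dird v f (x + s *\<^sub>R v) = h * dird w (dird v f) ((x + s *\<^sub>R v) + t *\<^sub>R w)" by auto
  have "(x + h *\<^sub>R w) + s *\<^sub>R v = (x + s *\<^sub>R v) + h *\<^sub>R w" by simp
  with s(3) t(3) have "\<phi> h - \<phi> 0 = h * h * dird w (dird v f) (x + s *\<^sub>R v + t *\<^sub>R w)"
    by (metis mult.assoc)
  moreover have "\<phi> h - \<phi> 0 = f (x + h *\<^sub>R v + h *\<^sub>R w) - f (x + h *\<^sub>R v) - f (x + h *\<^sub>R w) + f x"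
    by (simp add: \<phi>_def algebra_simps)
  ultimately show ?thesis using s t by (metis less_eq_real_def)
qed

lemma second_difference_limit:
  fixes f :: "'a::real_normed_vector \<Rightarrow> real"
  assumes S: "open S" "x \<in> S" "smooth_on S f" and e: "e > 0"
  shows "\<exists>d>0. \<forall>h. 0 < h \<and> h < d \<longrightarrow>
    \<bar>(f (x + h *\<^sub>R v + h *\<^sub>R w) - f (x + h *\<^sub>R v) - f (x + h *\<^sub>R w) + f x) / (h * h) - dird w (dird v f) x\<bar> < e"
proof -
  have "isCont (dird w (dird v f)) x"
    using smooth_on_continuous_on[OF smooth_on_dird[OF smooth_on_dird[OF S(3)]]] S continuous_on_eq_continuous_at by blast
  then obtain d1 where d1: "d1 > 0" "\<And>y. dist y x < d1 \<Longrightarrow> \<bar>dird w (dird v f) y - dird w (dird v f) x\<bar> < e"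
    using e unfolding continuous_at_eps_delta dist_real_def by metis
  obtain d2 where d2: "d2 > 0" "ball x d2 \<subseteq> S" using S open_contains_ball by blast
  define C where "C = norm v + norm w + 1"
  have C: "C > 0" unfolding C_def by (meson add_nonneg_pos add_nonneg_nonneg norm_ge_zero zero_less_one)
  define d where "d = min d1 d2 / C"
  have near: "dist (x + s *\<^sub>R v + t *\<^sub>R w) x < min d1 d2" if "h < d" "0 \<le> s" "s \<le> h" "0 \<le> t" "t \<le> h" "0 < h" for s t h
  proof -
    have "dist (x + s *\<^sub>R v + t *\<^sub>R w) x = norm (s *\<^sub>R v + t *\<^sub>R w)" by (simp add: dist_norm)
    also have "\<dots> \<le> s * norm v + t * norm w" using norm_triangle_ineq[of "s *\<^sub>R v" "t *\<^sub>R w"] that by simp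
    also have "\<dots> \<le> h * norm v + h * norm w" using that by (intro add_mono mult_right_mono) auto
    also have "\<dots> \<le> h * C" using that by (simp add: C_def algebra_simps)
    also have "\<dots> < min d1 d2" using that C by (simp add: d_def pos_less_divide_eq)
    finally show ?thesis .
  qed
  show ?thesis
  proof (intro exI[of _ d] conjI allI impI)
    show "d > 0" using d1 d2 C by (simp add: d_def)
    fix h assume h: "0 < h \<and> h < d"
    have "\<exists>s t. 0 \<le> s \<and> s \<le> h \<and> 0 \<le> t \<and> t \<le> h \<and>
      f (x + h *\<^sub>R v + h *\<^sub>R w) - f (x + h *\<^sub>R v) - f (x + h *\<^sub>R w) + f x
        = h * h * dird w (dird v f) (x + s *\<^sub>R v + t *\<^sub>R w)"
      using near h d2 by (intro second_difference_mean_value[OF S(3)]) (auto simp: subset_iff dist_commute)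
    then obtain s t where st: "0 \<le> s" "s \<le> h" "0 \<le> t" "t \<le> h" 
      "f (x + h *\<^sub>R v + h *\<^sub>R w) - f (x + h *\<^sub>R v) - f (x + h *\<^sub>R w) + f x
        = h * h * dird w (dird v f) (x + s *\<^sub>R v + t *\<^sub>R w)" by blast
    then show "\<bar>(f (x + h *\<^sub>R v + h *\<^sub>R w) - f (x + h *\<^sub>R v) - f (x + h *\<^sub>R w) + f x) / (h * h) - dird w (dird v f) x\<bar> < e"
      using d1(2)[of "x + s *\<^sub>R v + t *\<^sub>R w"] near[of h s t] h by simp
  qed
qed

lemma dird_commute:
  fixes f :: "'a::real_normed_vector \<Rightarrow> real"
  assumes S: "open S" "x \<in> S" "smooth_on S f"
  shows "dird w (dird v f) x = dird v (dird w f) x"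
proof (rule ccontr)
  define e where "e = \<bar>dird w (dird v f) x - dird v (dird w f) x\<bar> / 2"
  assume "\<not> ?thesis"
  then have e: "e > 0" by (simp add: e_def)
  let ?q = "\<lambda>h. (f (x + h *\<^sub>R v + h *\<^sub>R w) - f (x + h *\<^sub>R v) - f (x + h *\<^sub>R w) + f x) / (h * h)"
  obtain d1 where d1: "d1 > 0" "\<And>h. 0 < h \<Longrightarrow> h < d1 \<Longrightarrow> \<bar>?q h - dird w (dird v f) x\<bar> < e"
    using second_difference_limit[OF S e, of v w] by blast
  obtain d2 where d2: "d2 > 0" "\<And>h. 0 < h \<Longrightarrow> h < d2 \<Longrightarrow> \<bar>?q h - dird v (dird w f) x\<bar> < e"
    using second_difference_limit[OF S e, of w v] by (auto simp: algebra_simps)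
  define h where "h = min d1 d2 / 2"
  have "0 < h" "h < d1" "h < d2" using d1 d2 by (auto simp: h_def)
  then have "\<bar>dird w (dird v f) x - dird v (dird w f) x\<bar> < e + e"
    using d1(2)[of h] d2(2)[of h] by linarith
  then show False by (simp add: e_def)
qed

text \<open>
  A positive second derivative at a critical point makes the first derivative positive just after
  it, so the function increases there.
\<close>

lemma local_max_second_derivative:
  fixes f :: "'a::real_normed_vector \<Rightarrow> real"
  assumes S: "open S" "x \<in> S" "smooth_on S f" and mx: "\<And>y. y \<in> S \<Longrightarrow> f y \<le> f x"
  shows "dird v f x = 0" "dird v (dird v f) x \<le> 0"
proof -
  obtain d where d: "d > 0" "ball x d \<subseteq> S" using S open_contains_ball by blast
  define r where "r = d / (norm v + 1)"
  have nv: "norm v + 1 > 0" by (simp add: add_nonneg_pos)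
  have r: "r > 0" using d nv by (simp add: r_def)
  have inS: "x + t *\<^sub>R v \<in> S" if "\<bar>t\<bar> < r" for t
  proof -
    have "\<bar>t\<bar> * norm v \<le> \<bar>t\<bar> * (norm v + 1)" by (simp add: mult_left_mono)
    also have "\<dots> < d" using that nv by (simp add: r_def pos_less_divide_eq)
    finally show ?thesis using d(2) by (auto simp: dist_norm)
  qed
  have D: "((\<lambda>t. f (x + t *\<^sub>R v)) has_real_derivative dird v f (x + t *\<^sub>R v)) (at t)" if "\<bar>t\<bar> < r" for t
    using line_has_derivative[OF S(3) inS[OF that]] by (simp add: has_real_derivative_iff_has_vector_derivative)
  have D2: "((\<lambda>t. dird v f (x + t *\<^sub>R v)) has_real_derivative dird v (dird v f) (x + t *\<^sub>R v)) (at t)" if "\<bar>t\<bar> < r" for t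
    using line_has_derivative[OF smooth_on_dird[OF S(3)] inS[OF that]] by (simp add: has_real_derivative_iff_has_vector_derivative)
  show z: "dird v f x = 0"
    using DERIV_local_max[OF D[of 0] r] r mx inS by simp
  show "dird v (dird v f) x \<le> 0"
  proof (rule ccontr)
    assume "\<not> ?thesis"
    then have "dird v (dird v f) (x + 0 *\<^sub>R v) > 0" by simp
    from DERIV_pos_inc_right[OF D2[of 0] this] r z
    obtain e where e: "e > 0" "\<And>h. 0 < h \<Longrightarrow> h < e \<Longrightarrow> 0 < dird v f (x + h *\<^sub>R v)" by auto
    define h where "h = min r e / 2"
    have h: "0 < h" "h < r" "h < e" using r e by (auto simp: h_def)
    have "\<exists>z>0. z < h \<and> f (x + h *\<^sub>R v) - f (x + 0 *\<^sub>R v) = (h - 0) * dird v f (x + z *\<^sub>R v)"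
      by (rule MVT2[OF h(1)]) (use D h in auto)
    then obtain z where "0 < z" "z < h" "f (x + h *\<^sub>R v) - f x = h * dird v f (x + z *\<^sub>R v)" by auto
    then have "f (x + h *\<^sub>R v) > f x" using e(2)[of z] h by (smt (verit) mult_pos_pos)
    then show False using mx[OF inS[of h]] h by simp
  qed
qed

section \<open>Linear algebra of the pseudo-Euclidean space\<close>

text \<open>
  The reflection that exchanges the pseudo-Euclidean and the Euclidean inner product.
\<close>

definition conj_snd :: "('m::finite, 'n::finite) pseudo \<Rightarrow> ('m, 'n) pseudo" where
  "conj_snd v = (fst v, - snd v)"

lemma pinner_eq_inner: "pinner v w = v \<bullet> conj_snd w"
  by (simp add: pinner_def conj_snd_def inner_prod_def)

lemma norm_conj_snd: "norm (conj_snd v) = norm v"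
  by (simp add: conj_snd_def norm_prod_def)

lemma conj_snd_conj_snd: "conj_snd (conj_snd v) = v"
  by (simp add: conj_snd_def)

lemma linear_conj_snd: "linear conj_snd"
  by (rule linearI) (auto simp: conj_snd_def)

lemma abs_pinner_le: "\<bar>pinner v w\<bar> \<le> norm v * norm w"
  using Cauchy_Schwarz_ineq2[of v "conj_snd w"] by (simp add: pinner_eq_inner norm_conj_snd)

lemma pinner_commute: "pinner v w = pinner w v"
  by (simp add: pinner_def inner_commute)

lemma bounded_bilinear_pinner: "bounded_bilinear pinner"
proof
  show "\<exists>K. \<forall>a b. norm (pinner a b) \<le> norm a * norm b * K"
    by (rule exI[of _ 1]) (simp add: abs_pinner_le)
qed (auto simp: pinner_def algebra_simps)

lemmas pinner_simps =
  bounded_bilinear.add_left[OF bounded_bilinear_pinner]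
  bounded_bilinear.add_right[OF bounded_bilinear_pinner]
  bounded_bilinear.diff_left[OF bounded_bilinear_pinner]
  bounded_bilinear.diff_right[OF bounded_bilinear_pinner]
  bounded_bilinear.minus_left[OF bounded_bilinear_pinner]
  bounded_bilinear.minus_right[OF bounded_bilinear_pinner]
  bounded_bilinear.scaleR_left[OF bounded_bilinear_pinner]
  bounded_bilinear.scaleR_right[OF bounded_bilinear_pinner]
  bounded_bilinear.zero_left[OF bounded_bilinear_pinner]
  bounded_bilinear.zero_right[OF bounded_bilinear_pinner]
  bounded_bilinear.sum_left[OF bounded_bilinear_pinner]
  bounded_bilinear.sum_right[OF bounded_bilinear_pinner]

lemmas smooth_on_pinner = smooth_on_bilinear[OF bounded_bilinear_pinner]

lemma subspace_pperp: "subspace (pperp T)"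
  by (auto simp: subspace_def pperp_def pinner_simps)

subsection \<open>Adapted bases\<close>

text \<open>
  Pseudo-orthonormal bases: \<open>e\<close> is space-like and \<open>\<nu>\<close> is time-like.
\<close>

definition adapted :: "('m::finite \<Rightarrow> ('m, 'n::finite) pseudo) \<Rightarrow> ('n \<Rightarrow> ('m, 'n) pseudo) \<Rightarrow> bool" where
  "adapted e \<nu> \<longleftrightarrow> (\<forall>i j. pinner (e i) (e j) = (if i = j then 1 else 0)) \<and>
     (\<forall>r s. pinner (\<nu> r) (\<nu> s) = (if r = s then - 1 else 0)) \<and> (\<forall>i s. pinner (e i) (\<nu> s) = 0)"

definition adapted_to ::
  "('m::finite, 'n::finite) pseudo set \<Rightarrow> ('m \<Rightarrow> ('m, 'n) pseudo) \<Rightarrow> ('n \<Rightarrow> ('m, 'n) pseudo) \<Rightarrow> bool" where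
  "adapted_to T e \<nu> \<longleftrightarrow> subspace T \<and> adapted e \<nu> \<and> (\<forall>i. e i \<in> T) \<and> (\<forall>s. \<nu> s \<in> pperp T)"

lemma if_times_delta:
  "(if P then (1::real) else 0) * x = (if P then x else 0)" "x * (if P then (1::real) else 0) = (if P then x else 0)"
  "(if P then (-1::real) else 0) * x = (if P then -x else 0)" "x * (if P then (-1::real) else 0) = (if P then -x else 0)"
  by auto

lemma adapted_pinner_combination:
  assumes "adapted e \<nu>"
  shows "pinner ((\<Sum>i\<in>UNIV. x i *\<^sub>R e i) + (\<Sum>s\<in>UNIV. y s *\<^sub>R \<nu> s)) (e j) = x j"
    and "pinner ((\<Sum>i\<in>UNIV. x i *\<^sub>R e i) + (\<Sum>s\<in>UNIV. y s *\<^sub>R \<nu> s)) (\<nu> r) = - y r"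
proof -
  have 0: "pinner (\<nu> s) (e j) = 0" for s j using assms by (metis adapted_def pinner_commute)
  have 1: "\<And>i j. pinner (e i) (e j) = (if i = j then 1 else 0)" "\<And>i s. pinner (e i) (\<nu> s) = 0"
    "\<And>r s. pinner (\<nu> r) (\<nu> s) = (if r = s then - 1 else 0)"
    using assms by (auto simp: adapted_def)
  show "pinner ((\<Sum>i\<in>UNIV. x i *\<^sub>R e i) + (\<Sum>s\<in>UNIV. y s *\<^sub>R \<nu> s)) (e j) = x j"
    unfolding pinner_simps 0 1 by (simp add: if_times_delta)
  show "pinner ((\<Sum>i\<in>UNIV. x i *\<^sub>R e i) + (\<Sum>s\<in>UNIV. y s *\<^sub>R \<nu> s)) (\<nu> r) = - y r"
    unfolding pinner_simps 0 1 by (simp add: if_times_delta)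
qed

text \<open>
  Pairing with the basis recovers the coefficients of a combination, up to sign, so the
  coefficient map is injective; source and target have the same dimension, so it is onto.
\<close>

lemma adapted_expand:
  fixes e :: "'m::finite \<Rightarrow> ('m, 'n::finite) pseudo"
  assumes "adapted e \<nu>"
  shows "v = (\<Sum>i\<in>UNIV. pinner v (e i) *\<^sub>R e i) - (\<Sum>s\<in>UNIV. pinner v (\<nu> s) *\<^sub>R \<nu> s)"
proof -
  define L :: "('m, 'n) pseudo \<Rightarrow> ('m, 'n) pseudo" where
    "L z = (\<Sum>i\<in>UNIV. (fst z $ i) *\<^sub>R e i) + (\<Sum>s\<in>UNIV. (snd z $ s) *\<^sub>R \<nu> s)" for z
  have lin: "linear L"
    by (rule linearI) (auto simp: L_def algebra_simps sum.distrib scaleR_sum_right)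
  have L1: "pinner (L z) (e j) = fst z $ j" "pinner (L z) (\<nu> r) = - snd z $ r" for z j r
    unfolding L_def using adapted_pinner_combination[OF assms] by simp_all
  have "inj L"
  proof (rule injI)
    fix z z' assume "L z = L z'"
    then have "fst z = fst z'" "snd z = snd z'" using L1 by (metis vec_eq_iff, metis vec_eq_iff neg_equal_iff_equal)
    then show "z = z'" by (simp add: prod_eq_iff)
  qed
  then have "surj L" using lin linear_injective_imp_surjective by blast
  then obtain z where z: "v = L z" by (metis surjD)
  then show ?thesis using L1[of z] unfolding z by (simp add: L_def sum_negf)
qed

lemma adapted_pinner:
  assumes "adapted e \<nu>"
  shows "pinner v w = (\<Sum>i\<in>UNIV. pinner v (e i) * pinner w (e i)) - (\<Sum>s\<in>UNIV. pinner v (\<nu> s) * pinner w (\<nu> s))"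
proof -
  have "pinner v w = pinner ((\<Sum>i\<in>UNIV. pinner v (e i) *\<^sub>R e i) - (\<Sum>s\<in>UNIV. pinner v (\<nu> s) *\<^sub>R \<nu> s)) w"
    using adapted_expand[OF assms, of v] by simp
  then show ?thesis by (simp add: pinner_simps pinner_commute)
qed

lemma adapted_to_mem:
  assumes "adapted_to T e \<nu>"
  shows "v \<in> T \<longleftrightarrow> (\<forall>s. pinner v (\<nu> s) = 0)"
proof
  assume "v \<in> T" then show "\<forall>s. pinner v (\<nu> s) = 0" using assms by (auto simp: adapted_to_def pperp_def)
next
  assume "\<forall>s. pinner v (\<nu> s) = 0"
  then have "v = (\<Sum>i\<in>UNIV. pinner v (e i) *\<^sub>R e i)"
    using adapted_expand[of e \<nu> v] assms by (simp add: adapted_to_def)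
  moreover have "(\<Sum>i\<in>UNIV. pinner v (e i) *\<^sub>R e i) \<in> T"
    using assms by (auto simp: adapted_to_def intro!: subspace_sum subspace_scale)
  ultimately show "v \<in> T" by simp
qed

lemma adapted_to_mem_pperp:
  assumes "adapted_to T e \<nu>"
  shows "v \<in> pperp T \<longleftrightarrow> (\<forall>i. pinner v (e i) = 0)"
proof
  assume "v \<in> pperp T" then show "\<forall>s. pinner v (e s) = 0"
    using assms by (auto simp: adapted_to_def pperp_def pinner_commute)
next
  assume "\<forall>i. pinner v (e i) = 0"
  then have "v = - (\<Sum>s\<in>UNIV. pinner v (\<nu> s) *\<^sub>R \<nu> s)"
    using adapted_expand[of e \<nu> v] assms by (simp add: adapted_to_def)
  moreover have "- (\<Sum>s\<in>UNIV. pinner v (\<nu> s) *\<^sub>R \<nu> s) \<in> pperp T"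
    using assms by (auto simp: adapted_to_def intro!: subspace_neg subspace_sum subspace_scale subspace_pperp)
  ultimately show "v \<in> pperp T" by simp
qed

lemma normal_part_eq:
  assumes "subspace T" "pos_def_on T" "w \<in> pperp T" "v - w \<in> T"
  shows "normal_part T v = w"
  unfolding normal_part_def
proof (rule the_equality)
  show "w \<in> pperp T \<and> v - w \<in> T" using assms by simp
  fix w' assume w': "w' \<in> pperp T \<and> v - w' \<in> T"
  have "(v - w) - (v - w') \<in> T" using assms w' by (meson subspace_diff)
  then have 1: "w' - w \<in> T" by simp
  moreover have "w' - w \<in> pperp T" using assms w' subspace_pperp by (meson subspace_diff)
  ultimately have "pinner (w' - w) (w' - w) = 0" by (auto simp: pperp_def)
  with 1 assms(2) have "w' - w = 0" unfolding pos_def_on_def by (metis less_irrefl)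
  then show "w' = w" by simp
qed

subsection \<open>Existence of adapted bases\<close>

text \<open>
  Gram--Schmidt for a form that is definite on \<open>W x\<close>, positive or negative according to the sign of
  \<open>\<sigma>\<close>.  The inverse square root of a positive smooth function is smooth, so normalizing keeps smooth
  dependence on \<open>x\<close>; constant families give bases of single subspaces.
\<close>

lemma smooth_gram_schmidt:
  fixes a :: "'i \<Rightarrow> 'x::real_normed_vector \<Rightarrow> ('m::finite, 'n::finite) pseudo"
  assumes V: "open V" and I: "finite I" and W: "\<And>x. x \<in> V \<Longrightarrow> subspace (W x)"
    and pos: "\<And>x w. x \<in> V \<Longrightarrow> w \<in> W x \<Longrightarrow> w \<noteq> 0 \<Longrightarrow> \<sigma> * pinner w w > 0"
    and sm: "\<And>i. i \<in> I \<Longrightarrow> smooth_on V (a i)"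
    and mem: "\<And>i x. i \<in> I \<Longrightarrow> x \<in> V \<Longrightarrow> a i x \<in> W x"
    and ind: "\<And>i x. i \<in> I \<Longrightarrow> x \<in> V \<Longrightarrow> a i x \<notin> span ((\<lambda>j. a j x) ` (I - {i}))"
  shows "\<exists>b. (\<forall>i\<in>I. smooth_on V (b i)) \<and> (\<forall>x\<in>V. (\<forall>i\<in>I. b i x \<in> span ((\<lambda>j. a j x) ` I)) \<and>
    (\<forall>i\<in>I. \<forall>j\<in>I. \<sigma> * pinner (b i x) (b j x) = (if i = j then 1 else 0)))"
  using I sm mem ind
proof (induction I rule: finite_induct)
  case empty then show ?case by auto
next
  case (insert k I)
  have 1: "a i x \<notin> span ((\<lambda>j. a j x) ` (I - {i}))" if "i \<in> I" "x \<in> V" for i x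
  proof -
    have "span ((\<lambda>j. a j x) ` (I - {i})) \<subseteq> span ((\<lambda>j. a j x) ` (insert k I - {i}))"
      by (rule span_mono) auto
    then show ?thesis using insert.prems(3)[of i x] that by auto
  qed
  from insert.IH[OF insert.prems(1) insert.prems(2) 1] obtain b where
    b: "\<And>i. i\<in>I \<Longrightarrow> smooth_on V (b i)"
    "\<And>x i. x \<in> V \<Longrightarrow> i \<in> I \<Longrightarrow> b i x \<in> span ((\<lambda>j. a j x) ` I)"
    "\<And>x i j. x \<in> V \<Longrightarrow> i \<in> I \<Longrightarrow> j \<in> I \<Longrightarrow> \<sigma> * pinner (b i x) (b j x) = (if i = j then 1 else 0)" by blast
  define u where "u x = a k x - (\<Sum>i\<in>I. (\<sigma> * pinner (a k x) (b i x)) *\<^sub>R b i x)" for x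
  define q where "q x = inverse (sqrt (\<sigma> * pinner (u x) (u x)))" for x
  define b' where "b' i = (if i = k then (\<lambda>x. q x *\<^sub>R u x) else b i)" for i
  have usm: "smooth_on V u"
    unfolding u_def
    by (intro smooth_on_diff[OF V] smooth_on_sum[OF V] smooth_on_scaleR[OF V] smooth_on_mult[OF V]
        smooth_on_pinner[OF V] smooth_on_const b insert.prems(1)) auto
  have kn: "a k x \<notin> span ((\<lambda>j. a j x) ` I)" if "x \<in> V" for x
    using insert.prems(3)[of k x] that insert.hyps by simp
  have spanW: "span ((\<lambda>j. a j x) ` insert k I) \<subseteq> W x" if "x \<in> V" for x
    using insert.prems(2) that W[OF that] by (intro span_minimal) auto
  have sub: "b i x \<in> span ((\<lambda>j. a j x) ` insert k I)" if "x \<in> V" "i \<in> I" for i x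
    using b(2)[OF that] span_mono[of "(\<lambda>j. a j x) ` I" "(\<lambda>j. a j x) ` insert k I"] by auto
  have uspan: "u x \<in> span ((\<lambda>j. a j x) ` insert k I)" if "x \<in> V" for x
    unfolding u_def by (intro span_diff span_sum span_scale sub that) (auto intro: span_base)
  have u0: "u x \<noteq> 0" if "x \<in> V" for x
  proof
    assume "u x = 0"
    then have "a k x = (\<Sum>i\<in>I. (\<sigma> * pinner (a k x) (b i x)) *\<^sub>R b i x)" by (simp add: u_def)
    moreover have "\<dots> \<in> span ((\<lambda>j. a j x) ` I)" using b(2)[OF that] by (intro span_sum span_scale) auto
    ultimately show False using kn[OF that] by simp
  qed
  have up: "\<sigma> * pinner (u x) (u x) > 0" if "x \<in> V" for x
    using pos[OF that] u0[OF that] uspan[OF that] spanW[OF that] by blast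
  have qsm: "smooth_on V q"
    unfolding q_def
    by (intro smooth_on_inverse_sqrt[OF V] smooth_on_mult[OF V] smooth_on_pinner[OF V] usm smooth_on_const up)
  have ortho: "\<sigma> * pinner (u x) (b j x) = 0" if "x \<in> V" "j \<in> I" for x j
  proof -
    have "\<sigma> * pinner (u x) (b j x) = \<sigma> * pinner (a k x) (b j x)
      - (\<Sum>i\<in>I. (\<sigma> * pinner (a k x) (b i x)) * (\<sigma> * pinner (b i x) (b j x)))"
      by (simp add: u_def pinner_simps algebra_simps sum_distrib_left)
    also have "(\<Sum>i\<in>I. (\<sigma> * pinner (a k x) (b i x)) * (\<sigma> * pinner (b i x) (b j x))) =
      (\<Sum>i\<in>I. if i = j then \<sigma> * pinner (a k x) (b i x) else 0)"
      by (rule sum.cong) (auto simp: b(3)[OF that(1) _ that(2)])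
    finally show ?thesis using that insert.hyps by simp
  qed
  show ?case
  proof (intro exI[of _ b'] conjI ballI)
    fix i assume i: "i \<in> insert k I"
    show "smooth_on V (b' i)"
      using i b(1) by (auto simp: b'_def intro!: smooth_on_scaleR[OF V] usm qsm)
  next
    fix x i assume x: "x \<in> V" and i: "i \<in> insert k I"
    show "b' i x \<in> span ((\<lambda>j. a j x) ` insert k I)"
      using i sub[OF x] uspan[OF x] by (auto simp: b'_def simp del: image_insert intro: span_scale)
  next
    fix x i j assume x: "x \<in> V" and i: "i \<in> insert k I" and j: "j \<in> insert k I"
    have qq: "\<sigma> * (q x * (q x * pinner (u x) (u x))) = 1"
    proof -
      have "q x * q x = inverse (\<sigma> * pinner (u x) (u x))"
        using up[OF x] unfolding q_def inverse_mult_distrib[symmetric] by simp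
      then have "q x * q x * (\<sigma> * pinner (u x) (u x)) = 1" using up[OF x] by (metis left_inverse less_irrefl)
      then show ?thesis by (simp add: mult_ac)
    qed
    have o1: "\<sigma> * (q x * pinner (u x) (b j x)) = 0" "\<sigma> * (q x * pinner (b j x) (u x)) = 0" if "j \<in> I" for j
      using ortho[OF x that] by (auto simp: pinner_commute)
    consider "i = k" "j = k" | "i = k" "j \<in> I" "j \<noteq> k" | "i \<in> I" "i \<noteq> k" "j = k" | "i \<in> I" "j \<in> I" "i \<noteq> k" "j \<noteq> k"
      using i j insert.hyps by blast
    then show "\<sigma> * pinner (b' i x) (b' j x) = (if i = j then 1 else 0)"
      by cases (use qq o1 b(3)[OF x] in \<open>simp_all add: b'_def pinner_simps\<close>)
  qed
qed

lemma orthonormal_family_exists: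
  fixes W :: "('m::finite, 'n::finite) pseudo set"
  assumes W: "subspace W" and pos: "\<And>w. w \<in> W \<Longrightarrow> w \<noteq> 0 \<Longrightarrow> \<sigma> * pinner w w > 0"
    and dim: "dim W = CARD('k::finite)"
  shows "\<exists>b::'k \<Rightarrow> ('m, 'n) pseudo. (\<forall>i. b i \<in> W) \<and> (\<forall>i j. \<sigma> * pinner (b i) (b j) = (if i = j then 1 else 0))"
proof -
  obtain B where B: "B \<subseteq> W" "independent B" "W \<subseteq> span B" "card B = dim W"
    using basis_exists by blast
  have "finite B" using B(2) independent_imp_finite by blast
  then obtain g where g: "bij_betw g (UNIV::'k set) B"
    using finite_same_card_bij[of "UNIV::'k set" B] B(4) dim by auto
  have "\<exists>b::'k \<Rightarrow> real \<Rightarrow> ('m, 'n) pseudo. (\<forall>i\<in>UNIV. smooth_on UNIV (b i)) \<and> (\<forall>x\<in>UNIV. (\<forall>i\<in>UNIV. b i x \<in> span ((\<lambda>j. g j) ` UNIV)) \<and>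
    (\<forall>i\<in>UNIV. \<forall>j\<in>UNIV. \<sigma> * pinner (b i x) (b j x) = (if i = j then 1 else 0)))"
  proof (rule smooth_gram_schmidt[where W = "\<lambda>_. W" and a = "\<lambda>i x. g i"])
    fix i and x :: real
    have "inj g" "range g = B" using g by (auto simp: bij_betw_def)
    then have "range g - {g i} = g ` (UNIV - {i})" by (auto simp: inj_def)
    moreover have "g i \<notin> span (B - {g i})" using B(2) \<open>range g = B\<close> unfolding dependent_def by auto
    ultimately show "g i \<notin> span (g ` (UNIV - {i}))" using \<open>range g = B\<close> by simp
    show "g i \<in> W" using \<open>range g = B\<close> B(1) by auto
  qed (use W pos in \<open>auto intro: smooth_on_const\<close>)
  then obtain b :: "'k \<Rightarrow> real \<Rightarrow> ('m, 'n) pseudo" where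
    b: "\<And>i x. b i x \<in> span (range g)" "\<And>i j x. \<sigma> * pinner (b i x) (b j x) = (if i = j then 1 else 0)" by blast
  have "span (range g) \<subseteq> W" using g B(1) W by (intro span_minimal) (auto simp: bij_betw_def)
  then show ?thesis using b by (intro exI[of _ "\<lambda>i. b i 0"]) auto
qed

text \<open>
  A positive definite \<open>m\<close>-plane projects isomorphically onto the first factor.  Hence a vector \<open>w\<close>
  orthogonal to it differs from some \<open>t\<close> in the plane by a vector of the negative definite second
  factor, and \<open>pinner w w + pinner t t \<le> 0\<close> forces \<open>pinner w w < 0\<close>.
\<close>

lemma pperp_dim_neg:
  fixes T :: "('m::finite, 'n::finite) pseudo set"
  assumes T: "subspace T" "pos_def_on T" "dim T = CARD('m)"
  shows "dim (pperp T) = CARD('n)" "\<And>w. w \<in> pperp T \<Longrightarrow> w \<noteq> 0 \<Longrightarrow> pinner w w < 0"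
proof -
  have "pperp T = {y \<in> UNIV. \<forall>x\<in>conj_snd ` T. orthogonal x y}"
    by (auto simp: pperp_def orthogonal_def pinner_eq_inner pinner_commute inner_commute)
       (metis inner_commute pinner_commute pinner_eq_inner)+
  moreover have "subspace (conj_snd ` T)" using linear_subspace_image[OF linear_conj_snd T(1)] .
  moreover have "dim (conj_snd ` T) = dim T"
    by (rule dim_image_eq[OF linear_conj_snd]) (metis conj_snd_conj_snd inj_on_inverseI)
  ultimately have "dim (pperp T) + CARD('m) = CARD('m) + CARD('n)"
    using dim_subspace_orthogonal_to_vectors[of "conj_snd ` T" UNIV] T(3) by simp
  then show "dim (pperp T) = CARD('n)" by simp
  have inj: "inj_on fst T"
  proof (rule inj_onI)
    fix v w assume vw: "v \<in> T" "w \<in> T" "fst v = fst w"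
    have "v - w \<in> T" using T(1) vw by (meson subspace_diff)
    moreover have "pinner (v - w) (v - w) \<le> 0" using vw by (simp add: pinner_def)
    ultimately have "v - w = 0" using T(2) unfolding pos_def_on_def by (metis not_less)
    then show "v = w" by simp
  qed
  have "dim (fst ` T) = dim T"
    using dim_image_eq[of fst T] inj T(1) linear_fst by (simp add: span_eq_iff[THEN iffD2])
  moreover have "subspace (fst ` T)" using linear_subspace_image[OF linear_fst T(1)] .
  ultimately have full: "fst ` T = UNIV"
    using T(3) dim_eq_full[of "fst ` T"] span_eq_iff[of "fst ` T"] by simp
  fix w assume w: "w \<in> pperp T" "w \<noteq> 0"
  obtain t where t: "t \<in> T" "fst t = fst w" using full by (metis UNIV_I imageE)
  have tw: "pinner t w = 0" using w t by (auto simp: pperp_def)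
  have "pinner (w - t) (w - t) = pinner w w + pinner t t"
    using tw by (simp add: pinner_simps pinner_commute[of w t])
  moreover have a: "pinner (w - t) (w - t) = - (snd (w - t) \<bullet> snd (w - t))" using t by (simp add: pinner_def)
  moreover have "pinner t t \<ge> 0" using T(2) t unfolding pos_def_on_def by (metis less_eq_real_def pinner_simps(9))
  moreover have "t \<noteq> 0 \<Longrightarrow> pinner t t > 0" using T(2) t by (simp add: pos_def_on_def)
  moreover have "t = 0 \<Longrightarrow> snd (w - t) \<bullet> snd (w - t) > 0"
    using t w by (simp add: prod_eq_iff)
  moreover have "snd (w - t) \<bullet> snd (w - t) \<ge> 0" by simp
  ultimately show "pinner w w < 0" by linarith
qed

lemma adapted_to_exists:
  fixes T :: "('m::finite, 'n::finite) pseudo set"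
  assumes T: "subspace T" "pos_def_on T" "dim T = CARD('m)"
  shows "\<exists>e \<nu>. adapted_to T e \<nu>"
proof -
  have "\<exists>e::'m \<Rightarrow> ('m,'n) pseudo. (\<forall>i. e i \<in> T) \<and> (\<forall>i j. 1 * pinner (e i) (e j) = (if i = j then 1 else 0))"
    using T by (intro orthonormal_family_exists) (auto simp: pos_def_on_def)
  then obtain e :: "'m \<Rightarrow> ('m,'n) pseudo" where e: "\<And>i. e i \<in> T" "\<And>i j. pinner (e i) (e j) = (if i = j then 1 else 0)" by auto
  have "\<exists>\<nu>::'n \<Rightarrow> ('m,'n) pseudo. (\<forall>i. \<nu> i \<in> pperp T) \<and> (\<forall>i j. -1 * pinner (\<nu> i) (\<nu> j) = (if i = j then 1 else 0))"
    using pperp_dim_neg[OF T] by (intro orthonormal_family_exists subspace_pperp) auto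
  then obtain \<nu> :: "'n \<Rightarrow> ('m,'n) pseudo" where n: "\<And>i. \<nu> i \<in> pperp T" "\<And>i j. -1 * pinner (\<nu> i) (\<nu> j) = (if i = j then 1 else 0)" by auto
  have "pinner (\<nu> i) (\<nu> j) = (if i = j then -1 else 0)" for i j
    using n(2)[of i j] by (auto split: if_splits)
  moreover have "pinner (e i) (\<nu> s) = 0" for i s using e(1) n(1) by (auto simp: pperp_def)
  ultimately show ?thesis using e n T(1) unfolding adapted_to_def adapted_def by blast
qed

section \<open>Bounded sets of space-like planes\<close>

text \<open>
  The positive definite form obtained from the pseudo inner product by reversing its sign on the
  complement of the plane spanned by \<open>e\<close>.
\<close>

definition plane_form ::
  "('m::finite \<Rightarrow> ('m, 'n::finite) pseudo) \<Rightarrow> ('n \<Rightarrow> ('m, 'n) pseudo) \<Rightarrow> ('m, 'n) pseudo \<Rightarrow> real" where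
  "plane_form e \<nu> v = (\<Sum>i\<in>UNIV. (pinner v (e i))\<^sup>2) + (\<Sum>s\<in>UNIV. (pinner v (\<nu> s))\<^sup>2)"

text \<open>
  The form is \<open>pinner v v - 2 pinner n n\<close> with \<open>n\<close> the normal part of \<open>v\<close>, which involves only the plane.
\<close>

lemma plane_form_unique:
  assumes "adapted_to T e \<nu>" "adapted_to T e' \<nu>'" "pos_def_on T"
  shows "plane_form e \<nu> v = plane_form e' \<nu>' v"
proof -
  have *: "plane_form e \<nu> v = pinner v v - 2 * pinner (normal_part T v) (normal_part T v)"
    if A: "adapted_to T e \<nu>" for e \<nu>
  proof -
    have ad: "adapted e \<nu>" using A by (simp add: adapted_to_def)
    let ?N = "\<Sum>s\<in>UNIV. (- pinner v (\<nu> s)) *\<^sub>R \<nu> s"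
    have "normal_part T v = ?N"
    proof (rule normal_part_eq)
      show "subspace T" using A by (simp add: adapted_to_def)
      show "?N \<in> pperp T" using A by (auto simp: adapted_to_def intro!: subspace_sum[OF subspace_pperp] subspace_scale[OF subspace_pperp] simp del: scaleR_minus_left)
      have "v - ?N = (\<Sum>i\<in>UNIV. pinner v (e i) *\<^sub>R e i)"
        using adapted_expand[OF ad, of v] by (simp add: sum_negf algebra_simps)
      then show "v - ?N \<in> T" using A by (auto simp: adapted_to_def intro!: subspace_sum subspace_scale)
    qed (rule assms)
    moreover have "pinner ?N (e i) = 0" "pinner ?N (\<nu> s) = pinner v (\<nu> s)" for i s
      using adapted_pinner_combination[OF ad, of "\<lambda>_. 0" "\<lambda>s. - pinner v (\<nu> s)"] by simp_all
    ultimately have "pinner (normal_part T v) (normal_part T v) = - (\<Sum>s\<in>UNIV. (pinner v (\<nu> s))\<^sup>2)"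
      using adapted_pinner[OF ad, of ?N ?N] by (simp add: power2_eq_square)
    then show ?thesis using adapted_pinner[OF ad, of v v] by (simp add: plane_form_def power2_eq_square)
  qed
  show ?thesis using *[OF assms(1)] *[OF assms(2)] by simp
qed

lemma plane_form_le:
  "plane_form e \<nu> v \<le> ((\<Sum>i\<in>UNIV. (norm (e i))\<^sup>2) + (\<Sum>s\<in>UNIV. (norm (\<nu> s))\<^sup>2)) * (norm v)\<^sup>2"
proof -
  have "(pinner v w)\<^sup>2 \<le> (norm w)\<^sup>2 * (norm v)\<^sup>2" for w
    using power_mono[OF abs_pinner_le[of v w], of 2] by (simp add: power_mult_distrib mult.commute)
  then show ?thesis unfolding plane_form_def distrib_right sum_distrib_right by (intro add_mono sum_mono) auto
qed

lemma pinner_sq_le_plane_form: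
  assumes "adapted e \<nu>"
  shows "(pinner v w)\<^sup>2 \<le> plane_form e \<nu> v * plane_form e \<nu> w"
proof -
  define X where "X v = ((\<chi> i. pinner v (e i)), (\<chi> s. pinner v (\<nu> s)))" for v
  have 1: "plane_form e \<nu> v = (norm (X v))\<^sup>2" for v
    unfolding power2_norm_eq_inner by (simp add: plane_form_def X_def inner_prod_def inner_vec_def power2_eq_square)
  have "pinner v w = pinner (X v) (X w)"
    using adapted_pinner[OF assms, of v w] by (simp add: X_def pinner_def inner_vec_def)
  then show ?thesis unfolding 1
    using power_mono[OF abs_pinner_le[of "X v" "X w"], of 2] by (simp add: power_mult_distrib)
qed

text \<open>
  An upper bound for the form gives a lower bound, because \<open>(norm v)\<^sup>2\<close> is the pseudo inner product of
  \<open>v\<close> with its reflection and the pseudo inner product obeys Cauchy--Schwarz for the form.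
\<close>

lemma norm_sq_le_plane_form:
  assumes "adapted e \<nu>" and K: "\<And>w. plane_form e \<nu> w \<le> K * (norm w)\<^sup>2"
  shows "(norm v)\<^sup>2 \<le> K * plane_form e \<nu> v"
proof (cases "v = 0")
  case True
  then show ?thesis by (simp add: plane_form_def pinner_simps)
next
  case False
  have "((norm v)\<^sup>2)\<^sup>2 = (pinner v (conj_snd v))\<^sup>2"
    by (simp add: pinner_eq_inner conj_snd_conj_snd power2_norm_eq_inner)
  also have "\<dots> \<le> plane_form e \<nu> v * plane_form e \<nu> (conj_snd v)" by (rule pinner_sq_le_plane_form[OF assms(1)])
  also have "\<dots> \<le> plane_form e \<nu> v * (K * (norm v)\<^sup>2)"
    using K[of "conj_snd v"] by (intro mult_left_mono) (auto simp: norm_conj_snd plane_form_def intro!: add_nonneg_nonneg sum_nonneg)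
  finally have "(norm v)\<^sup>2 * (norm v)\<^sup>2 \<le> (K * plane_form e \<nu> v) * (norm v)\<^sup>2" by (simp add: power2_eq_square mult_ac)
  then show ?thesis using False by (meson mult_right_le_imp_le zero_less_norm_iff zero_less_power)
qed

text \<open>
  The rotations of the frames inside the plane and inside its complement are skew and drop out of the
  derivative of the form.  Only the mixing of the two remains, and its coefficients are exactly those
  whose squares sum to the squared speed.
\<close>

lemma plane_form_derivative:
  fixes e :: "'m::finite \<Rightarrow> real \<Rightarrow> ('m, 'n::finite) pseudo"
  assumes I: "open I" "t \<in> I" and fr: "adapted_frames I c e f"
  shows "\<exists>D. ((\<lambda>t. plane_form (\<lambda>i. e i t) (\<lambda>s. f s t) v) has_real_derivative D) (at t) \<and>
    \<bar>D\<bar> \<le> 2 * grassmann_speed e f t * plane_form (\<lambda>i. e i t) (\<lambda>s. f s t) v"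
proof -
  define e' where "e' i = vector_derivative (e i) (at t)" for i
  define f' where "f' s = vector_derivative (f s) (at t)" for s
  have sm: "smooth_on I (e i)" "smooth_on I (f s)" for i s using fr by (auto simp: adapted_frames_def)
  have De: "(e i has_vector_derivative e' i) (at t)" for i
    unfolding e'_def using smooth_on_differentiable[OF sm(1) I(2)] vector_derivative_works
    by (metis differentiable_def has_vector_derivative_def vector_derivative_works differentiableI_vector
        frechet_derivative_eq_vector_derivative frechet_derivative_works)
  have Df: "(f i has_vector_derivative f' i) (at t)" for i
    unfolding f'_def using smooth_on_differentiable[OF sm(2) I(2)] vector_derivative_works
    by (metis differentiable_def has_vector_derivative_def vector_derivative_works differentiableI_vector
        frechet_derivative_eq_vector_derivative frechet_derivative_works)
  have P: "((\<lambda>t. pinner (g t) (h t)) has_real_derivative pinner (g t) h' + pinner g' (h t)) (at t)"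
    if "(g has_vector_derivative g') (at t)" "(h has_vector_derivative h') (at t)" for g h g' h'
    using bounded_bilinear.has_vector_derivative[OF bounded_bilinear_pinner that]
    by (simp add: has_real_derivative_iff_has_vector_derivative)
  have on: "pinner (e i u) (e j u) = (if i = j then 1 else 0)"
    "pinner (f r u) (f s u) = (if r = s then -1 else 0)" "pinner (e i u) (f s u) = 0" if "u \<in> I" for i j r s u
    using fr that by (auto simp: adapted_frames_def pperp_def)
  have const: "D = 0" if "((\<lambda>t. pinner (g t) (h t)) has_real_derivative D) (at t)" "\<And>u. u \<in> I \<Longrightarrow> pinner (g u) (h u) = k" for g h k D
  proof -
    have "((\<lambda>t. k) has_real_derivative D) (at t)"
      by (rule has_field_derivative_transform_within_open[OF that(1) I]) (rule that(2))
    then show ?thesis using DERIV_const DERIV_unique by blast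
  qed
  have sk1: "pinner (e' i) (e j t) = - pinner (e' j) (e i t)" for i j
    using const[OF P[OF De De] on(1), of i j] by (simp add: pinner_commute)
  have sk2: "pinner (f' i) (f j t) = - pinner (f' j) (f i t)" for i j
    using const[OF P[OF Df Df] on(2), of i j] by (simp add: pinner_commute)
  have sk3: "pinner (f' s) (e i t) = - pinner (e' i) (f s t)" for i s
    using const[OF P[OF De Df] on(3), of i s] by (simp add: pinner_commute)
  define x where "x i = pinner v (e i t)" for i
  define y where "y s = pinner v (f s t)" for s
  define a where "a i s = pinner (e' i) (f s t)" for i s
  have ad: "adapted (\<lambda>i. e i t) (\<lambda>s. f s t)" using on[OF I(2)] by (simp add: adapted_def)
  have xe: "pinner v (e' i) = (\<Sum>j\<in>UNIV. x j * pinner (e' i) (e j t)) - (\<Sum>s\<in>UNIV. y s * a i s)" for i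
    unfolding adapted_pinner[OF ad, of v "e' i"] x_def y_def a_def ..
  have yf: "pinner v (f' s) = - (\<Sum>j\<in>UNIV. x j * a j s) - (\<Sum>r\<in>UNIV. y r * pinner (f' s) (f r t))" for s
    unfolding adapted_pinner[OF ad, of v "f' s"] x_def y_def a_def sk3 by (simp add: sum_negf)
  define D where "D = (\<Sum>i\<in>UNIV. 2 * x i * pinner v (e' i)) + (\<Sum>s\<in>UNIV. 2 * y s * pinner v (f' s))"
  have skew: "(\<Sum>i\<in>UNIV. \<Sum>j\<in>UNIV. z i * z j * w i j) = 0"
    if "\<And>i j. w i j = - w j i" for z :: "'k::finite \<Rightarrow> real" and w
  proof -
    have "(\<Sum>i\<in>UNIV. \<Sum>j\<in>UNIV. z i * z j * w i j) = (\<Sum>j\<in>UNIV. \<Sum>i\<in>UNIV. z i * z j * w i j)" by (rule sum.swap)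
    also have "\<dots> = (\<Sum>j\<in>UNIV. \<Sum>i\<in>UNIV. - (z j * z i * w j i))"
      by (intro sum.cong refl) (subst that, simp)
    finally show ?thesis by (simp add: sum_negf)
  qed
  have "(\<Sum>i\<in>UNIV. x i * pinner v (e' i)) = (\<Sum>i\<in>UNIV. \<Sum>j\<in>UNIV. x i * x j * pinner (e' i) (e j t))
     - (\<Sum>i\<in>UNIV. \<Sum>s\<in>UNIV. a i s * (x i * y s))"
    unfolding xe by (simp add: right_diff_distrib sum_subtractf sum_distrib_left mult_ac)
  then have s1: "(\<Sum>i\<in>UNIV. x i * pinner v (e' i)) = - (\<Sum>i\<in>UNIV. \<Sum>s\<in>UNIV. a i s * (x i * y s))"
    using skew[OF sk1, of x] by simp
  have "(\<Sum>s\<in>UNIV. y s * pinner v (f' s)) = - (\<Sum>s\<in>UNIV. \<Sum>i\<in>UNIV. a i s * (x i * y s))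
     - (\<Sum>s\<in>UNIV. \<Sum>r\<in>UNIV. y s * y r * pinner (f' s) (f r t))"
    unfolding yf by (simp add: right_diff_distrib sum_subtractf sum_distrib_left sum_negf mult_ac)
  then have s2: "(\<Sum>s\<in>UNIV. y s * pinner v (f' s)) = - (\<Sum>i\<in>UNIV. \<Sum>s\<in>UNIV. a i s * (x i * y s))"
    using skew[OF sk2, of y] sum.swap[of "\<lambda>s i. a i s * (x i * y s)" UNIV UNIV] by simp
  \<comment> \<open>The mixed terms, which both frames contribute equally.\<close>
  define Z where "Z = (\<Sum>i\<in>UNIV. \<Sum>s\<in>UNIV. a i s * (x i * y s))"
  have D4: "D = - 4 * Z"
    using s1 s2 by (simp add: D_def Z_def sum_distrib_left[symmetric] mult.assoc)
  have der: "((\<lambda>t. plane_form (\<lambda>i. e i t) (\<lambda>s. f s t) v) has_real_derivative D) (at t)"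
  proof -
    have c: "((\<lambda>t. v) has_vector_derivative 0) (at t)" by simp
    have "((\<lambda>t. pinner v (e i t)) has_real_derivative pinner v (e' i)) (at t)"
      "((\<lambda>t. pinner v (f s t)) has_real_derivative pinner v (f' s)) (at t)" for i s
      using P[OF c De, of i] P[OF c Df, of s] by (simp_all add: pinner_simps)
    then show ?thesis unfolding plane_form_def D_def x_def y_def
      by (auto intro!: derivative_eq_intros simp: mult_ac)
  qed
  define X where "X = (\<Sum>i\<in>UNIV. (x i)\<^sup>2)"
  define Y where "Y = (\<Sum>s\<in>UNIV. (y s)\<^sup>2)"
  define A where "A = (\<Sum>i\<in>UNIV. \<Sum>s\<in>UNIV. (a i s)\<^sup>2)"
  have nn: "X \<ge> 0" "Y \<ge> 0" "A \<ge> 0" by (auto simp: X_def Y_def A_def intro!: sum_nonneg)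
  have sp: "grassmann_speed e f t = sqrt A"
    by (simp add: grassmann_speed_def A_def a_def e'_def)
  have pf: "plane_form (\<lambda>i. e i t) (\<lambda>s. f s t) v = X + Y"
    by (simp add: plane_form_def X_def Y_def x_def y_def)
  have Zp: "Z = (\<Sum>p\<in>UNIV. (case p of (i,s) \<Rightarrow> a i s) * (case p of (i,s) \<Rightarrow> x i * y s))"
    by (simp add: Z_def sum.cartesian_product case_prod_unfold)
  have Ap: "A = (\<Sum>p\<in>UNIV. (case p of (i,s) \<Rightarrow> a i s)\<^sup>2)"
    by (simp add: A_def sum.cartesian_product case_prod_unfold)
  have XYp: "X * Y = (\<Sum>p\<in>UNIV. (case p of (i,s) \<Rightarrow> x i * y s)\<^sup>2)"
    by (simp add: X_def Y_def sum_product sum.cartesian_product case_prod_unfold power_mult_distrib)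
  have "Z\<^sup>2 \<le> A * (X * Y)"
    unfolding Zp Ap XYp by (rule Cauchy_Schwarz_ineq_sum)
  also have "\<dots> \<le> A * ((X + Y) / 2)\<^sup>2"
  proof (rule mult_left_mono)
    have "0 \<le> (X - Y)\<^sup>2" by simp
    then show "X * Y \<le> ((X + Y) / 2)\<^sup>2" by (simp add: power2_eq_square field_simps)
  qed (rule nn)
  also have "\<dots> = (sqrt A * ((X + Y) / 2))\<^sup>2"
    unfolding power_mult_distrib real_sqrt_pow2[OF nn(3)] ..
  finally have "\<bar>Z\<bar> \<le> sqrt A * ((X + Y) / 2)"
    using nn by (simp add: abs_le_square_iff[symmetric])
  then have "\<bar>D\<bar> \<le> 2 * grassmann_speed e f t * plane_form (\<lambda>i. e i t) (\<lambda>s. f s t) v"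
    unfolding D4 sp pf by simp
  with der show ?thesis by blast
qed

lemma continuous_on_grassmann_speed:
  assumes I: "open I" and fr: "adapted_frames I c e f"
  shows "continuous_on I (grassmann_speed e f)"
proof -
  have "vector_derivative g (at t) = dird 1 g t" if "smooth_on I g" "t \<in> I" for g :: "real \<Rightarrow> ('a, 'b) pseudo" and t
    unfolding dird_def
    using frechet_derivative_eq_vector_derivative[OF smooth_on_differentiable[OF that]] by simp
  then have "grassmann_speed e f t = sqrt (\<Sum>i\<in>UNIV. \<Sum>s\<in>UNIV. (pinner (dird 1 (e i) t) (f s t))\<^sup>2)" if "t \<in> I" for t
    using fr that by (simp add: grassmann_speed_def adapted_frames_def)
  moreover have "continuous_on I (\<lambda>t. sqrt (\<Sum>i\<in>UNIV. \<Sum>s\<in>UNIV. (pinner (dird 1 (e i) t) (f s t))\<^sup>2))"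
    using fr by (intro continuous_intros bounded_bilinear.continuous_on[OF bounded_bilinear_pinner]
        smooth_on_continuous_on smooth_on_dird) (auto simp: adapted_frames_def)
  ultimately show ?thesis by (simp cong: continuous_on_cong)
qed

text \<open>
  Gronwall: multiplied by the exponential of minus twice the length covered so far, the form is
  nonincreasing.
\<close>

lemma plane_form_gronwall:
  assumes I: "open I" "{0..1} \<subseteq> I" and fr: "adapted_frames I c e f"
  shows "plane_form (\<lambda>i. e i 1) (\<lambda>s. f s 1) v
    \<le> exp (2 * integral {0..1} (grassmann_speed e f)) * plane_form (\<lambda>i. e i 0) (\<lambda>s. f s 0) v"
proof -
  let ?q = "\<lambda>t. plane_form (\<lambda>i. e i t) (\<lambda>s. f s t) v"
  let ?u = "\<lambda>t. integral {0..t} (grassmann_speed e f)"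
  let ?G = "\<lambda>t. ?q t * exp (- 2 * ?u t)"
  have sp: "continuous_on {0..1} (grassmann_speed e f)"
    using continuous_on_grassmann_speed[OF I(1) fr] I(2) continuous_on_subset by blast
  have du: "(?u has_real_derivative grassmann_speed e f t) (at t within {0..1})" if "t \<in> {0..1}" for t
    using integral_has_vector_derivative[OF sp that] by (simp add: has_real_derivative_iff_has_vector_derivative)
  have dq: "\<exists>D. (?q has_real_derivative D) (at t) \<and> \<bar>D\<bar> \<le> 2 * grassmann_speed e f t * ?q t" if "t \<in> {0..1}" for t
    using plane_form_derivative[OF I(1) _ fr] that I(2) by blast
  have cq: "continuous_on {0..1} ?q"
    using dq by (metis (no_types, lifting) DERIV_continuous continuous_at_imp_continuous_on)
  have cu: "continuous_on {0..1} ?u"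
    using du by (metis (no_types, lifting) DERIV_continuous continuous_on_eq_continuous_within)
  have cG: "continuous_on {0..1} ?G" by (intro continuous_intros cq cu)
  have dG: "\<exists>y. (?G has_real_derivative y) (at t) \<and> y \<le> 0" if t: "0 < t" "t < 1" for t
  proof -
    obtain D where D: "(?q has_real_derivative D) (at t)" "\<bar>D\<bar> \<le> 2 * grassmann_speed e f t * ?q t"
      using dq[of t] t by auto
    have "at t within {0..1} = at t" using t by (intro at_within_interior) (simp add: interior_atLeastAtMost_real)
    then have "(?u has_real_derivative grassmann_speed e f t) (at t)" using du[of t] t by simp
    then have "(?G has_real_derivative D * exp (- 2 * ?u t) + ?q t * (exp (- 2 * ?u t) * (- 2 * grassmann_speed e f t))) (at t)"
      by (auto intro!: derivative_eq_intros D(1))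
    moreover have "D * exp (- 2 * ?u t) + ?q t * (exp (- 2 * ?u t) * (- 2 * grassmann_speed e f t))
      = (D - 2 * grassmann_speed e f t * ?q t) * exp (- 2 * ?u t)" by (simp add: algebra_simps)
    moreover have "\<dots> \<le> 0" using D(2) by (intro mult_nonpos_nonneg) auto
    ultimately show "\<exists>y. (?G has_real_derivative y) (at t) \<and> y \<le> 0" by auto
  qed
  obtain l z where "0 < z" "z < 1" "(?G has_real_derivative l) (at z)" "?G 1 - ?G 0 = (1 - 0) * l"
    using MVT[OF zero_less_one cG] dG unfolding real_differentiable_def by blast
  then have "?G 1 \<le> ?G 0" using dG[of z] DERIV_unique by fastforce
  then have "?q 1 * exp (- (2 * ?u 1)) \<le> ?q 0" by simp
  then show ?thesis by (simp add: exp_minus field_simps)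
qed

text \<open>
  All planes of a bounded set are joined to one of them by curves of bounded length, so their forms
  are bounded by one multiple of the Euclidean norm.  On the plane and on its complement the form is
  plus or minus the pseudo inner product.
\<close>

theorem grassmann_bounded_uniform:
  fixes S :: "('m::finite, 'n::finite) pseudo set set"
  assumes "grassmann_bounded S"
  shows "\<exists>K>0. \<forall>P\<in>S. (\<forall>v\<in>P. (norm v)\<^sup>2 \<le> K * pinner v v) \<and> (\<forall>w\<in>pperp P. (norm w)\<^sup>2 \<le> - (K * pinner w w))"
proof (cases "S = {}")
  case True then show ?thesis by (intro exI[of _ 1]) auto
next
  case False
  then obtain P0 where P0: "P0 \<in> S" by blast
  obtain C where C: "\<And>P. P \<in> S \<Longrightarrow> grassmann_dist P0 P \<le> ereal C"
    using assms P0 unfolding grassmann_bounded_def by blast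
  have sub: "\<And>P. P \<in> S \<Longrightarrow> subspace P \<and> dim P = CARD('m) \<and> pos_def_on P"
    using assms unfolding grassmann_bounded_def pseudo_grassmannian_def by blast
  obtain e0 \<nu>0 where 0: "adapted_to P0 e0 \<nu>0" using adapted_to_exists sub[OF P0] by blast
  define K0 where "K0 = (\<Sum>i\<in>UNIV. (norm (e0 i))\<^sup>2) + (\<Sum>s\<in>UNIV. (norm (\<nu>0 s))\<^sup>2)"
  have K00: "K0 \<ge> 0" unfolding K0_def by (intro add_nonneg_nonneg sum_nonneg) auto
  define K where "K = exp (2 * (C + 1)) * K0 + 1"
  have "(\<forall>v\<in>P. (norm v)\<^sup>2 \<le> K * pinner v v) \<and> (\<forall>w\<in>pperp P. (norm w)\<^sup>2 \<le> - (K * pinner w w))" if P: "P \<in> S" for P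
  proof -
    have "grassmann_dist P0 P < ereal (C + 1)" using C[OF P] by (simp add: le_less_trans)
    then obtain c I e f where cI: "open I" "{0..1} \<subseteq> I" "\<forall>t\<in>I. c t \<in> pseudo_grassmannian"
      "adapted_frames I c e f" "c 0 = P0" "c 1 = P" "integral {0..1} (grassmann_speed e f) < C + 1"
      unfolding grassmann_dist_def Inf_less_iff by auto
    have adt: "adapted_to (c t) (\<lambda>i. e i t) (\<lambda>s. f s t)" if "t \<in> {0..1}" for t
      using cI that by (fastforce simp: adapted_to_def adapted_def adapted_frames_def pseudo_grassmannian_def pperp_def)
    have ad0: "adapted_to P0 (\<lambda>i. e i 0) (\<lambda>s. f s 0)" using adt[of 0] cI by simp
    have ad1: "adapted_to P (\<lambda>i. e i 1) (\<lambda>s. f s 1)" using adt[of 1] cI by simp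
    let ?Q = "plane_form (\<lambda>i. e i 1) (\<lambda>s. f s 1)"
    have Qn: "?Q v \<ge> 0" for v unfolding plane_form_def by (intro add_nonneg_nonneg sum_nonneg) auto
    have "?Q v \<le> K * (norm v)\<^sup>2" for v
    proof -
      have "?Q v \<le> exp (2 * integral {0..1} (grassmann_speed e f)) * plane_form (\<lambda>i. e i 0) (\<lambda>s. f s 0) v"
        by (rule plane_form_gronwall[OF cI(1,2,4)])
      also have "plane_form (\<lambda>i. e i 0) (\<lambda>s. f s 0) v = plane_form e0 \<nu>0 v"
        using plane_form_unique[OF ad0 0] sub[OF P0] by blast
      also have "exp (2 * integral {0..1} (grassmann_speed e f)) * plane_form e0 \<nu>0 v \<le> exp (2 * (C + 1)) * (K0 * (norm v)\<^sup>2)"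
        using cI(7) plane_form_le[of e0 \<nu>0 v]
        by (intro mult_mono) (auto simp: K0_def plane_form_def intro!: add_nonneg_nonneg sum_nonneg)
      also have "\<dots> \<le> K * (norm v)\<^sup>2" by (simp add: K_def algebra_simps)
      finally show ?thesis .
    qed
    then have n: "(norm v)\<^sup>2 \<le> K * ?Q v" for v
      using ad1 by (intro norm_sq_le_plane_form) (auto simp: adapted_to_def)
    have ad: "adapted (\<lambda>i. e i 1) (\<lambda>s. f s 1)" using ad1 by (simp add: adapted_to_def)
    have "?Q v = pinner v v" if "v \<in> P" for v
      using adapted_pinner[OF ad, of v v] that ad1 by (simp add: plane_form_def adapted_to_mem power2_eq_square)
    moreover have "?Q w = - pinner w w" if "w \<in> pperp P" for w
      using adapted_pinner[OF ad, of w w] that ad1 by (simp add: plane_form_def adapted_to_mem_pperp power2_eq_square)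
    ultimately show ?thesis using n by (metis mult_minus_right)
  qed
  moreover have "K > 0" unfolding K_def using K00 by (intro add_nonneg_pos mult_nonneg_nonneg) auto
  ultimately show ?thesis by blast
qed

section \<open>Graph charts of space-like submanifolds\<close>

subsection \<open>The smooth inverse function theorem\<close>

lemma vec_eq_sum_axis: "(x :: real ^ 'm::finite) = (\<Sum>i\<in>UNIV. (x $ i) *\<^sub>R axis i 1)"
  using basis_expansion[of x] by (simp add: scalar_mult_eq_scaleR)

abbreviation pd :: "'m::finite \<Rightarrow> (real ^ 'm \<Rightarrow> 'b::real_normed_vector) \<Rightarrow> real ^ 'm \<Rightarrow> 'b" where
  "pd a \<equiv> dird (axis a 1)"

lemma smooth_on_vec_nth:
  assumes "open S" "smooth_on S f"
  shows "smooth_on S (\<lambda>x. (f x :: 'b::euclidean_space ^ 'm::finite) $ i)"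
  by (rule smooth_on_linear_compose[OF assms(1) bounded_linear_vec_nth assms(2)])

lemma smooth_on_vec:
  fixes f :: "'a::real_normed_vector \<Rightarrow> 'b::euclidean_space ^ 'm::finite"
  assumes "open S" "\<And>i. smooth_on S (\<lambda>x. f x $ i)"
  shows "smooth_on S f"
proof -
  have "f x = (\<Sum>i\<in>UNIV. axis i (f x $ i))" for x
    by (simp add: vec_eq_iff axis_def if_distrib cong: if_cong)
  then have "f = (\<lambda>x. \<Sum>i\<in>UNIV. axis i (f x $ i))" by auto
  moreover have "bounded_linear (\<lambda>y::'b. axis i y :: 'b ^ 'm)" for i
    unfolding linear_conv_bounded_linear[symmetric]
    by (rule linearI) (auto simp: axis_def vec_eq_iff)
  then have "smooth_on S (\<lambda>x. \<Sum>i\<in>UNIV. (axis i (f x $ i) :: 'b ^ 'm))"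
    by (intro smooth_on_sum[OF assms(1)] smooth_on_linear_compose[OF assms(1) _ assms(2)])
  ultimately show ?thesis by simp
qed

lemma smooth_on_det:
  fixes A :: "'a::real_normed_vector \<Rightarrow> real ^ 'm::finite ^ 'm"
  assumes "open S" "\<And>i j. smooth_on S (\<lambda>x. A x $ i $ j)"
  shows "smooth_on S (\<lambda>x. det (A x))"
  unfolding det_def
  by (intro smooth_on_sum[OF assms(1)] smooth_on_mult[OF assms(1)] smooth_on_prod[OF assms(1)] smooth_on_const assms(2))

text \<open>
  Cramer's formula for \<open>A\<^sup>-\<^sup>1 v\<close> is rational in the entries of \<open>A\<close>.
\<close>

lemma smooth_on_cramer:
  fixes v :: "real ^ 'm::finite"
  shows "smooth_on {A :: real ^ 'm ^ 'm. det A \<noteq> 0}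
    (\<lambda>A. \<chi> k. det (\<chi> i j. if j = k then v $ i else A $ i $ j) / det A)"
    "open {A :: real ^ 'm ^ 'm. det A \<noteq> 0}"
proof -
  have ent: "smooth_on S (\<lambda>A :: real ^ 'm ^ 'm. A $ i $ j)" if "open S" for i j S
    using smooth_on_vec_nth[OF that smooth_on_vec_nth[OF that smooth_on_id]] .
  have "smooth_on UNIV (\<lambda>A :: real ^ 'm ^ 'm. det A)"
    by (intro smooth_on_det ent open_UNIV)
  then show op: "open {A :: real ^ 'm ^ 'm. det A \<noteq> 0}"
    using smooth_on_continuous_on by (intro open_Collect_neq continuous_on_const)
  have e: "smooth_on {A. det A \<noteq> 0} (\<lambda>A. (\<chi> i j. if j = k then v $ i else A $ i $ j) $ i $ j)" for k i j :: 'm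
    by (cases "j = k") (simp_all add: smooth_on_const ent[OF op])
  show "smooth_on {A :: real ^ 'm ^ 'm. det A \<noteq> 0}
    (\<lambda>A. \<chi> k. det (\<chi> i j. if j = k then v $ i else A $ i $ j) / det A)"
    by (rule smooth_on_vec[OF op]) (auto simp: divide_inverse intro!: smooth_on_mult[OF op] smooth_on_inverse[OF op] smooth_on_det[OF op] ent[OF op] e)
qed

lemma linear_matrix_entries:
  fixes h :: "real ^ 'm::finite \<Rightarrow> real ^ 'm"
  assumes "linear h"
  shows "h v = (\<chi> i j. h (axis j 1) $ i) *v v"
proof -
  have "h v = h (\<Sum>j\<in>UNIV. (v $ j) *\<^sub>R axis j 1)" using vec_eq_sum_axis[of v] by simp
  also have "\<dots> = (\<Sum>j\<in>UNIV. (v $ j) *\<^sub>R h (axis j 1))"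
    by (simp add: linear_sum[OF assms] linear_cmul[OF assms])
  finally show ?thesis by (simp add: vec_eq_iff matrix_vector_mult_def mult.commute)
qed

text \<open>
  The derivative of the inverse \<open>b\<close> at \<open>y\<close> is the inverse of the derivative of \<open>a\<close> at \<open>b y\<close>.  By
  Cramer's formula it is a smooth function of \<open>b y\<close>, so each order of differentiability of \<open>b\<close>
  yields the next.
\<close>

theorem smooth_inverse_function:
  fixes a :: "real ^ 'm::finite \<Rightarrow> real ^ 'm"
  assumes V: "open V" and a: "smooth_on V a" and u0: "u0 \<in> V" and inj: "inj (\<lambda>v. dird v a u0)"
  shows "\<exists>V0 W b. open V0 \<and> V0 \<subseteq> V \<and> u0 \<in> V0 \<and> open W \<and> homeomorphism V0 W a b \<and> smooth_on W b"
proof -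
  define a' where "a' x = Blinfun (\<lambda>v. dird v a x)" for x
  have bl: "bounded_linear (\<lambda>v. dird v a x)" if "x \<in> V" for x
    using smooth_on_has_derivative[OF a that] has_derivative_bounded_linear by blast
  have a': "blinfun_apply (a' x) = (\<lambda>v. dird v a x)" if "x \<in> V" for x
    unfolding a'_def using bounded_linear_Blinfun_apply[OF bl[OF that]] .
  have der: "(a has_derivative blinfun_apply (a' x)) (at x)" if "x \<in> V" for x
    using smooth_on_has_derivative[OF a that] a'[OF that] by simp
  have "continuous_on V a'"
  proof (rule continuous_on_blinfun_componentwise)
    fix i :: "real ^ 'm" assume "i \<in> Basis"
    have "continuous_on V (dird i a)" using smooth_on_continuous_on smooth_on_dird[OF a] by blast
    then show "continuous_on V (\<lambda>x. blinfun_apply (a' x) i)"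
      using a' by (simp cong: continuous_on_cong)
  qed
  obtain g where g: "linear g" "g \<circ> (\<lambda>v. dird v a u0) = id"
    using linear_injective_left_inverse[OF bounded_linear.linear[OF bl[OF u0]] inj] by blast
  have inv: "Blinfun g o\<^sub>L a' u0 = id_blinfun"
  proof (rule blinfun_eqI)
    fix v :: "real ^ 'm"
    have "bounded_linear g" using g(1) linear_conv_bounded_linear by blast
    then have "blinfun_apply (Blinfun g o\<^sub>L a' u0) v = g (dird v a u0)"
      by (simp add: bounded_linear_Blinfun_apply a'[OF u0])
    also have "\<dots> = v" using fun_cong[OF g(2), of v] by simp
    finally show "blinfun_apply (Blinfun g o\<^sub>L a' u0) v = blinfun_apply id_blinfun v" by simp
  qed
  obtain V0 W b b' where W: "open V0" "V0 \<subseteq> V" "u0 \<in> V0" "open W" "a u0 \<in> W" "homeomorphism V0 W a b"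
    "\<And>y. y \<in> W \<Longrightarrow> (b has_derivative (b' y)) (at y)"
    "\<And>y. y \<in> W \<Longrightarrow> b' y = Hilbert_Choice.inv (blinfun_apply (a' (b y)))"
    "\<And>y. y \<in> W \<Longrightarrow> bij (blinfun_apply (a' (b y)))"
  proof (rule inverse_function_theorem[of V a a' u0 "Blinfun g"])
    show "open V" "continuous_on V a'" "u0 \<in> V" "Blinfun g o\<^sub>L a' u0 = id_blinfun" by fact+
    show "(a has_derivative blinfun_apply (a' x)) (at x)" if "x \<in> V" for x by (rule der[OF that])
  qed (rule that)
  have bV: "b y \<in> V" if "y \<in> W" for y
    using W(2,6) that by (metis homeomorphism_def image_eqI subsetD)
  define A where "A x = (\<chi> i j. pd j a x $ i)" for x
  define \<Phi> where "\<Phi> v B = (\<chi> k. det (\<chi> i j. if j = k then v $ i else B $ i $ j) / det B)" for v :: "real ^ 'm" and B :: "real ^ 'm ^ 'm"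
  let ?G = "{B :: real ^ 'm ^ 'm. det B \<noteq> 0}"
  have Asm: "smooth_on V A"
    unfolding A_def by (intro smooth_on_vec[OF V]) (simp add: smooth_on_vec_nth[OF V] smooth_on_dird[OF a])
  have Av: "dird v a x = A x *v v" if "x \<in> V" for x v
    unfolding A_def using linear_matrix_entries[OF bounded_linear.linear[OF bl[OF that]]] .
  have detA: "det (A (b y)) \<noteq> 0" if "y \<in> W" for y
  proof -
    have "inj (\<lambda>v. A (b y) *v v)"
      using W(9)[OF that] a'[OF bV[OF that]] Av[OF bV[OF that]] by (simp add: bij_def)
    then show ?thesis
      by (simp add: invertible_det_nz[symmetric] invertible_left_inverse matrix_left_invertible_injective)
  qed
  have db: "dird v b y = \<Phi> v (A (b y))" if y: "y \<in> W" for v y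
  proof -
    have "dird v b y = b' y v" using dird_eqI[OF W(7)[OF y]] .
    then have "A (b y) *v dird v b y = v"
      using W(8,9)[OF y] a'[OF bV[OF y]] Av[OF bV[OF y]] by (metis bij_inv_eq_iff)
    then show ?thesis using cramer[OF detA[OF y]] unfolding \<Phi>_def by blast
  qed
  have "Ck_on k W b" for k
  proof (induction k)
    case 0
    show ?case using W(6) by (simp add: homeomorphism_def)
  next
    case (Suc k)
    have "Ck_on k V A" using Asm by (simp add: smooth_on_def)
    then have CA: "Ck_on k W (\<lambda>y. A (b y))"
      using Ck_on_compose[OF W(4) V _ Suc] bV by blast
    have "Ck_on k W (\<lambda>y. \<Phi> v (A (b y)))" for v
    proof (rule Ck_on_compose[OF W(4) smooth_on_cramer(2) _ CA])
      show "(\<lambda>y. A (b y)) ` W \<subseteq> {B. det B \<noteq> 0}" using detA by auto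
      show "Ck_on k {B. det B \<noteq> 0} (\<Phi> v)"
        using smooth_on_cramer(1)[of v] unfolding smooth_on_def \<Phi>_def[abs_def] by blast
    qed
    then have "Ck_on k W (dird v b)" for v
      using Ck_on_cong[OF W(4) db] by simp
    then show ?case using W(7) by (auto simp: Ck_on_Suc_dird differentiable_def)
  qed
  then have "smooth_on W b" by (simp add: smooth_on_def)
  with W show ?thesis by blast
qed

subsection \<open>Tangent spaces and local sections\<close>

lemma smooth_on_affine_line: "smooth_on S (\<lambda>t::real. x + t *\<^sub>R v)"
proof -
  have "smooth_on UNIV (\<lambda>t::real. x + t *\<^sub>R v)"
    by (intro smooth_on_add smooth_on_const smooth_on_bounded_linear bounded_linear_scaleR_left) simp
  then show ?thesis using smooth_on_subset by blast
qed

lemma dird_in_tangent_space: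
  fixes \<sigma> :: "'a::euclidean_space \<Rightarrow> ('m::finite, 'n::finite) pseudo"
  assumes V: "open V" "smooth_on V \<sigma>" "\<sigma> ` V \<subseteq> M" "z \<in> V"
  shows "dird v \<sigma> z \<in> tangent_space M (\<sigma> z)"
proof -
  obtain d where d: "d > 0" "ball z d \<subseteq> V" using V(1,4) open_contains_ball by blast
  define \<epsilon> where "\<epsilon> = d / (norm v + 1)"
  have nv: "norm v + 1 > 0" by (simp add: add_nonneg_pos)
  have e: "\<epsilon> > 0" using d nv by (simp add: \<epsilon>_def)
  have inV: "z + t *\<^sub>R v \<in> V" if "t \<in> {-\<epsilon><..<\<epsilon>}" for t
  proof -
    have "\<bar>t\<bar> * norm v \<le> \<bar>t\<bar> * (norm v + 1)" by (simp add: mult_left_mono)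
    also have "\<bar>t\<bar> < \<epsilon>" using that by auto
    then have "\<bar>t\<bar> * (norm v + 1) < d" using nv by (simp add: \<epsilon>_def pos_less_divide_eq)
    finally show ?thesis using d(2) by (auto simp: dist_norm)
  qed
  have "smooth_on {-\<epsilon><..<\<epsilon>} (\<lambda>t. \<sigma> (z + t *\<^sub>R v))"
    by (rule smooth_on_compose[OF _ V(1) _ smooth_on_affine_line V(2)]) (use inV in auto)
  moreover have "((\<lambda>t. \<sigma> (z + t *\<^sub>R v)) has_vector_derivative dird v \<sigma> z) (at 0)"
    using line_has_derivative[OF V(2), of z 0 v] V(4) by simp
  moreover have "(\<lambda>t. \<sigma> (z + t *\<^sub>R v)) ` {-\<epsilon><..<\<epsilon>} \<subseteq> M" using inV V(3) by auto
  ultimately show ?thesis unfolding tangent_space_def using e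
    by (intro CollectI exI[of _ \<epsilon>] conjI exI[of _ "\<lambda>t. \<sigma> (z + t *\<^sub>R v)"]) auto
qed

text \<open>
  A linear map \<open>L\<close> that is injective on the image of the derivative of \<open>\<phi>\<close> turns \<open>\<phi>\<close> into a local
  diffeomorphism \<open>L \<circ> \<phi>\<close>.  Composing \<open>\<phi>\<close> with its inverse gives a parametrization whose coordinate
  is \<open>L\<close> itself.
\<close>

lemma section_of_parametrization:
  fixes \<phi> :: "real ^ 'm \<Rightarrow> ('m::finite, 'n::finite) pseudo" and L :: "('m, 'n) pseudo \<Rightarrow> real ^ 'm"
  assumes V: "open V" "smooth_on V \<phi>" "u0 \<in> V" and U: "open U" and hom: "homeomorphism V (M \<inter> U) \<phi> \<psi>"
    and L: "linear L" "inj (\<lambda>v. L (dird v \<phi> u0))"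
  shows "\<exists>Z U' \<sigma>. open Z \<and> open U' \<and> \<phi> u0 \<in> U' \<and> L (\<phi> u0) \<in> Z \<and> smooth_on Z \<sigma> \<and>
    (\<forall>z\<in>Z. \<sigma> z \<in> M \<and> L (\<sigma> z) = z) \<and> (\<forall>q\<in>M \<inter> U'. L q \<in> Z \<and> \<sigma> (L q) = q) \<and>
    (\<forall>v. dird v \<sigma> (L (\<phi> u0)) \<in> range (\<lambda>v. dird v \<phi> u0))"
proof -
  let ?a = "\<lambda>u. L (\<phi> u)"
  have bL: "bounded_linear L" using L(1) linear_conv_bounded_linear by blast
  have asm: "smooth_on V ?a" by (rule smooth_on_linear_compose[OF V(1) bL V(2)])
  have "dird v ?a u0 = L (dird v \<phi> u0)" for v
    by (rule dird_linear_compose[OF bL smooth_on_differentiable[OF V(2,3)]])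
  then have "inj (\<lambda>v. dird v ?a u0)" using L(2) by simp
  from smooth_inverse_function[OF V(1) asm V(3) this]
  obtain V0 Z b where W: "open V0" "V0 \<subseteq> V" "u0 \<in> V0" "open Z" "homeomorphism V0 Z ?a b" "smooth_on Z b" by blast
  have b: "b z \<in> V0" "L (\<phi> (b z)) = z" if "z \<in> Z" for z
    using W(5) that unfolding homeomorphism_def by auto
  have ba: "L (\<phi> u) \<in> Z" "b (L (\<phi> u)) = u" if "u \<in> V0" for u
    using W(5) that unfolding homeomorphism_def by auto
  have "openin (top_of_set (M \<inter> U)) (\<phi> ` V0)"
    using homeomorphism_imp_open_map[OF hom] W(1,2) by (simp add: openin_open_eq V(1))
  then obtain U1 where U1: "open U1" "\<phi> ` V0 = M \<inter> U \<inter> U1" by (auto simp: openin_open)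
  define \<sigma> where "\<sigma> z = \<phi> (b z)" for z
  have sm: "smooth_on Z \<sigma>" unfolding \<sigma>_def
    by (rule smooth_on_compose[OF W(4) V(1) _ W(6) V(2)]) (use b W(2) in auto)
  have z0: "L (\<phi> u0) \<in> Z" "b (L (\<phi> u0)) = u0" using ba W(3) by auto
  have "dird v \<sigma> (L (\<phi> u0)) \<in> range (\<lambda>v. dird v \<phi> u0)" for v
  proof -
    have "(\<phi> \<circ> b has_derivative (\<lambda>v. dird v \<phi> u0) \<circ> (\<lambda>v. dird v b (L (\<phi> u0)))) (at (L (\<phi> u0)))"
      by (rule diff_chain_at[OF smooth_on_has_derivative[OF W(6) z0(1)]])
        (simp add: z0 smooth_on_has_derivative[OF V(2,3)])
    then have "dird v \<sigma> (L (\<phi> u0)) = dird (dird v b (L (\<phi> u0))) \<phi> u0"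
      unfolding \<sigma>_def by (intro dird_eqI[of _ "\<lambda>v. dird (dird v b (L (\<phi> u0))) \<phi> u0", simplified]) (simp add: o_def)
    then show ?thesis by simp
  qed
  moreover have "\<sigma> z \<in> M \<and> L (\<sigma> z) = z" if "z \<in> Z" for z
    using b[OF that] U1(2) by (auto simp: \<sigma>_def)
  moreover have "L q \<in> Z \<and> \<sigma> (L q) = q" if "q \<in> M \<inter> (U \<inter> U1)" for q
  proof -
    have "q \<in> \<phi> ` V0" using that U1(2) by auto
    then show ?thesis using ba by (auto simp: \<sigma>_def)
  qed
  moreover have "\<phi> u0 \<in> U \<inter> U1" using U1(2) W(3) by auto
  moreover have "open (U \<inter> U1)" using U U1 by auto
  ultimately show ?thesis using W(4) sm z0(1)
    by (intro exI[of _ Z] exI[of _ "U \<inter> U1"] exI[of _ \<sigma>] conjI ballI allI) simp_all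
qed

text \<open>
  Take for \<open>L\<close> a left inverse of the derivative of a parametrization.  Every curve in \<open>M\<close> is then the
  image of a differentiable curve of coordinates, so velocities of curves are values of the
  derivative.  Once the tangent space is known, any \<open>L\<close> injective on it can serve as a coordinate.
\<close>

lemma tangent_space_section:
  fixes M :: "('m::finite, 'n::finite) pseudo set"
  assumes M: "submanifold M" "p \<in> M"
  shows "subspace (tangent_space M p)" "dim (tangent_space M p) = CARD('m)"
    and "\<And>L :: ('m, 'n) pseudo \<Rightarrow> real ^ 'm. linear L \<Longrightarrow> inj_on L (tangent_space M p) \<Longrightarrow>
      \<exists>Z U' \<sigma>. open Z \<and> open U' \<and> p \<in> U' \<and> L p \<in> Z \<and> smooth_on Z \<sigma> \<and>
        (\<forall>z\<in>Z. \<sigma> z \<in> M \<and> L (\<sigma> z) = z) \<and> (\<forall>q\<in>M \<inter> U'. L q \<in> Z \<and> \<sigma> (L q) = q)"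
proof -
  obtain U and V :: "(real ^ 'm) set" and \<phi> \<psi> where
    ch0: "open U \<and> p \<in> U \<and> open V \<and> smooth_on V \<phi> \<and> (\<forall>u\<in>V. inj (frechet_derivative \<phi> (at u))) \<and>
      homeomorphism V (M \<inter> U) \<phi> \<psi>"
    using M(1)[unfolded submanifold_def, rule_format, OF M(2)] by (elim exE) (rule that)
  then have ch: "open U" "p \<in> U" "open V" "smooth_on V \<phi>" "\<And>u. u \<in> V \<Longrightarrow> inj (frechet_derivative \<phi> (at u))"
    "homeomorphism V (M \<inter> U) \<phi> \<psi>" by blast+
  define u0 where "u0 = \<psi> p"
  have u0: "u0 \<in> V" "\<phi> u0 = p" using ch(6) M(2) ch(2) unfolding homeomorphism_def u0_def by auto
  let ?D = "\<lambda>v. dird v \<phi> u0"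
  have linD: "linear ?D" by (rule smooth_on_linear_dird[OF ch(4) u0(1)])
  have injD: "inj ?D" using ch(5)[OF u0(1)] by (simp add: dird_def)
  have \<phi>M: "\<phi> ` V \<subseteq> M" using ch(6) unfolding homeomorphism_def by auto
  have T: "tangent_space M p = range ?D"
  proof
    show "range ?D \<subseteq> tangent_space M p"
      using dird_in_tangent_space[OF ch(3,4) \<phi>M u0(1)] u0(2) by auto
  next
    \<comment> \<open>With this coordinate, a curve \<open>c\<close> in \<open>M\<close> equals \<open>\<sigma> \<circ> L \<circ> c\<close> near \<open>0\<close>.\<close>
    obtain L where L: "linear L" "L \<circ> ?D = id" using linear_injective_left_inverse[OF linD injD] by blast
    then have "inj (\<lambda>v. L (?D v))" by (simp add: fun_eq_iff inj_def)
    from section_of_parametrization[OF ch(3,4) u0(1) ch(1,6) L(1) this, unfolded u0(2)]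
    obtain Z U' \<sigma> where s0: "open Z \<and> open U' \<and> p \<in> U' \<and> L p \<in> Z \<and> smooth_on Z \<sigma> \<and>
      (\<forall>z\<in>Z. \<sigma> z \<in> M \<and> L (\<sigma> z) = z) \<and> (\<forall>q\<in>M \<inter> U'. L q \<in> Z \<and> \<sigma> (L q) = q) \<and> (\<forall>v. dird v \<sigma> (L p) \<in> range ?D)"
      by (elim exE) (rule that)
    then have s: "open Z" "open U'" "p \<in> U'" "L p \<in> Z" "smooth_on Z \<sigma>"
      "\<forall>q\<in>M \<inter> U'. L q \<in> Z \<and> \<sigma> (L q) = q" "\<forall>v. dird v \<sigma> (L p) \<in> range ?D"
      by simp_all
    show "tangent_space M p \<subseteq> range ?D"
    proof
      fix v assume "v \<in> tangent_space M p"
      then obtain \<epsilon> and c :: "real \<Rightarrow> ('m, 'n) pseudo" where c: "\<epsilon> > 0" "smooth_on {-\<epsilon><..<\<epsilon>} c" "c ` {-\<epsilon><..<\<epsilon>} \<subseteq> M"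
        "c 0 = p" "(c has_vector_derivative v) (at 0)" unfolding tangent_space_def by blast
      have "continuous_on {-\<epsilon><..<\<epsilon>} c" by (rule smooth_on_continuous_on[OF c(2)])
      then have op: "open ({-\<epsilon><..<\<epsilon>} \<inter> c -` U')"
        using s(2) continuous_open_preimage open_greaterThanLessThan by blast
      have "(c has_derivative (\<lambda>h. h *\<^sub>R v)) (at 0)" using c(5) by (simp add: has_vector_derivative_def)
      then have "((\<lambda>t. L (c t)) has_derivative (\<lambda>h. L (h *\<^sub>R v))) (at 0)"
        using bounded_linear.has_derivative[OF L(1)[unfolded linear_conv_bounded_linear]] by blast
      from diff_chain_at[OF this, of \<sigma> "\<lambda>w. dird w \<sigma> (L p)"]
      have "((\<lambda>t. \<sigma> (L (c t))) has_derivative (\<lambda>h. dird (L (h *\<^sub>R v)) \<sigma> (L p))) (at 0)"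
        using smooth_on_has_derivative[OF s(5,4)] c(4) by (simp add: o_def)
      moreover have "\<sigma> (L (c t)) = c t" if "t \<in> {-\<epsilon><..<\<epsilon>} \<inter> c -` U'" for t
      proof -
        have "c t \<in> M \<inter> U'" using that c(3) by blast
        then show ?thesis using s(6) by blast
      qed
      ultimately have "(c has_derivative (\<lambda>h. dird (L (h *\<^sub>R v)) \<sigma> (L p))) (at 0)"
        using has_derivative_transform_within_open[OF _ op] c(1,4) s(3) by fastforce
      then have "(\<lambda>h. dird (L (h *\<^sub>R v)) \<sigma> (L p)) = (\<lambda>h. h *\<^sub>R v)"
        using \<open>(c has_derivative (\<lambda>h. h *\<^sub>R v)) (at 0)\<close> has_derivative_unique by blast
      then have "dird (L (1 *\<^sub>R v)) \<sigma> (L p) = 1 *\<^sub>R v" by meson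
      then show "v \<in> range ?D" using s(7) by (metis scaleR_one)
    qed
  qed
  show "subspace (tangent_space M p)" unfolding T using linear_subspace_image[OF linD subspace_UNIV] .
  show "dim (tangent_space M p) = CARD('m)" unfolding T using dim_image_eq[OF linD, of UNIV] injD by simp
  fix L :: "('m, 'n) pseudo \<Rightarrow> real ^ 'm"
  assume L: "linear L" "inj_on L (tangent_space M p)"
  have "inj (\<lambda>v. L (?D v))" using L(2) injD unfolding T by (auto simp: inj_on_def inj_def)
  from section_of_parametrization[OF ch(3,4) u0(1) ch(1,6) L(1) this, unfolded u0(2)]
  show "\<exists>Z U' \<sigma>. open Z \<and> open U' \<and> p \<in> U' \<and> L p \<in> Z \<and> smooth_on Z \<sigma> \<and>
        (\<forall>z\<in>Z. \<sigma> z \<in> M \<and> L (\<sigma> z) = z) \<and> (\<forall>q\<in>M \<inter> U'. L q \<in> Z \<and> \<sigma> (L q) = q)"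
    by (elim exE conjE) (intro exI conjI, assumption+)
qed

subsection \<open>Charts adapted to a tangent space\<close>

text \<open>
  \<open>M\<close> near \<open>p\<close> as the graph of \<open>f\<close> over its tangent space at \<open>p\<close>, in an adapted basis.  As \<open>f\<close>
  vanishes to second order at the centre, the induced metric is standard there up to second order,
  the Christoffel symbols vanish at \<open>p\<close>, and the second derivatives of \<open>f\<close> at \<open>0\<close> are the components
  of the second fundamental form.  Every local computation takes place at the centre of such a chart.
\<close>

locale gauge_chart =
  fixes M :: "('m::finite, 'n::finite) pseudo set" and p :: "('m, 'n) pseudo"
    and e :: "'m \<Rightarrow> ('m, 'n) pseudo" and \<nu> :: "'n \<Rightarrow> ('m, 'n) pseudo"
    and r :: real and f :: "'n \<Rightarrow> real ^ 'm \<Rightarrow> real" and U :: "('m, 'n) pseudo set"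
  assumes spacelike: "spacelike_submanifold M"
    and ad_to: "adapted_to (tangent_space M p) e \<nu>"
    and r: "r > 0"
    and f_smooth: "smooth_on (ball 0 r) (f s)"
    and f_0: "f s 0 = 0"
    and df_0: "dird v (f s) 0 = 0"
    and U: "open U"
    and image: "M \<inter> U = (\<lambda>x. p + (\<Sum>i\<in>UNIV. (x $ i) *\<^sub>R e i) + (\<Sum>s\<in>UNIV. f s x *\<^sub>R \<nu> s)) ` ball 0 r"
begin

definition Y :: "real ^ 'm \<Rightarrow> ('m, 'n) pseudo" where
  "Y x = p + (\<Sum>i\<in>UNIV. (x $ i) *\<^sub>R e i) + (\<Sum>s\<in>UNIV. f s x *\<^sub>R \<nu> s)"

definition coord :: "('m, 'n) pseudo \<Rightarrow> real ^ 'm" where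
  "coord q = (\<chi> i. pinner (q - p) (e i))"

lemma ad: "adapted e \<nu>"
  using ad_to by (simp add: adapted_to_def)

lemma ad_simps:
  "pinner (e i) (e j) = (if i = j then 1 else 0)" "pinner (\<nu> s) (\<nu> t) = (if s = t then -1 else 0)"
  "pinner (e i) (\<nu> s) = 0" "pinner (\<nu> s) (e i) = 0"
  using ad by (auto simp: adapted_def pinner_commute)

lemma open_ball_0: "open (ball (0 :: real ^ 'm) r)" "0 \<in> ball (0 :: real ^ 'm) r"
  using r by auto

lemma image_Y: "M \<inter> U = Y ` ball 0 r"
  unfolding Y_def[abs_def] by (rule image)

lemma Y_in: "x \<in> ball 0 r \<Longrightarrow> Y x \<in> M" "x \<in> ball 0 r \<Longrightarrow> Y x \<in> U"
  using image_Y by blast+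

lemma Y_0: "Y 0 = p"
  by (simp add: Y_def f_0)

lemma p_in: "p \<in> M" "p \<in> U"
  using Y_in[OF open_ball_0(2)] by (simp_all add: Y_0)

lemma coord_Y: "coord (Y x) = x"
proof -
  have "Y x - p = (\<Sum>i\<in>UNIV. (x $ i) *\<^sub>R e i) + (\<Sum>s\<in>UNIV. f s x *\<^sub>R \<nu> s)" by (simp add: Y_def)
  then show ?thesis unfolding coord_def using adapted_pinner_combination(1)[OF ad, of "\<lambda>i. x $ i"] by simp
qed

lemma Y_coord: "q \<in> M \<Longrightarrow> q \<in> U \<Longrightarrow> Y (coord q) = q" "q \<in> M \<Longrightarrow> q \<in> U \<Longrightarrow> coord q \<in> ball 0 r"
proof -
  assume "q \<in> M" "q \<in> U"
  then obtain x where "x \<in> ball 0 r" "q = Y x" using image_Y by blast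
  then show "Y (coord q) = q" "coord q \<in> ball 0 r" by (simp_all add: coord_Y)
qed

lemma Y_smooth: "smooth_on (ball 0 r) Y"
  unfolding Y_def[abs_def]
  by (intro smooth_on_add smooth_on_sum smooth_on_scaleR smooth_on_const f_smooth open_ball
      smooth_on_bounded_linear bounded_linear_vec_nth)

lemma dird_Y:
  assumes "x \<in> ball 0 r"
  shows "dird v Y x = (\<Sum>i\<in>UNIV. (v $ i) *\<^sub>R e i) + (\<Sum>s\<in>UNIV. dird v (f s) x *\<^sub>R \<nu> s)"
proof -
  have "(Y has_derivative (\<lambda>v. (\<Sum>i\<in>UNIV. (v $ i) *\<^sub>R e i) + (\<Sum>s\<in>UNIV. dird v (f s) x *\<^sub>R \<nu> s))) (at x)"
    unfolding Y_def[abs_def]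
    by (auto intro!: derivative_eq_intros smooth_on_has_derivative[OF f_smooth assms]
        bounded_linear_imp_has_derivative[OF bounded_linear_vec_nth])
  then show ?thesis by (rule dird_eqI)
qed

lemma dird_dird_Y:
  assumes "x \<in> ball 0 r"
  shows "dird w (dird v Y) x = (\<Sum>s\<in>UNIV. dird w (dird v (f s)) x *\<^sub>R \<nu> s)"
proof -
  have "dird w (dird v Y) x = dird w (\<lambda>x. (\<Sum>i\<in>UNIV. (v $ i) *\<^sub>R e i) + (\<Sum>s\<in>UNIV. dird v (f s) x *\<^sub>R \<nu> s)) x"
    by (rule dird_cong_open[OF _ assms]) (auto simp: dird_Y)
  also have "\<dots> = (\<Sum>s\<in>UNIV. dird w (dird v (f s)) x *\<^sub>R \<nu> s)"
    by (rule dird_eqI)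
      (auto intro!: derivative_eq_intros smooth_on_has_derivative[OF smooth_on_dird[OF f_smooth] assms])
  finally show ?thesis .
qed

lemma pinner_dird_Y:
  assumes "x \<in> ball 0 r"
  shows "pinner (dird v Y x) (e i) = v $ i" "pinner (dird v Y x) (\<nu> s) = - dird v (f s) x"
  unfolding dird_Y[OF assms]
  using adapted_pinner_combination[OF ad, of "\<lambda>i. v $ i" "\<lambda>s. dird v (f s) x"] by simp_all

lemma pinner_dird_dird_Y:
  assumes "x \<in> ball 0 r"
  shows "pinner (dird w (dird v Y) x) (e i) = 0" "pinner (dird w (dird v Y) x) (\<nu> s) = - dird w (dird v (f s)) x"
  unfolding dird_dird_Y[OF assms]
  using adapted_pinner_combination[OF ad, of "\<lambda>i. 0" "\<lambda>s. dird w (dird v (f s)) x"] by simp_all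

lemma pinner_dird_Y_dird_Y:
  assumes "x \<in> ball 0 r"
  shows "pinner (dird v Y x) (dird w Y x) = v \<bullet> w - (\<Sum>s\<in>UNIV. dird v (f s) x * dird w (f s) x)"
  unfolding adapted_pinner[OF ad, of "dird v Y x" "dird w Y x"] pinner_dird_Y[OF assms] by (simp add: inner_vec_def)

lemma pinner_dird_dird_Y_dird_Y:
  assumes "x \<in> ball 0 r"
  shows "pinner (dird w (dird v Y) x) (dird u Y x) = - (\<Sum>s\<in>UNIV. dird w (dird v (f s)) x * dird u (f s) x)"
  unfolding adapted_pinner[OF ad, of "dird w (dird v Y) x" "dird u Y x"] pinner_dird_Y[OF assms] pinner_dird_dird_Y[OF assms]
  by simp

lemma linear_dird_Y: "x \<in> ball 0 r \<Longrightarrow> linear (\<lambda>v. dird v Y x)"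
  by (rule smooth_on_linear_dird[OF Y_smooth])

lemma dird_Y_tangent: "x \<in> ball 0 r \<Longrightarrow> dird v Y x \<in> tangent_space M (Y x)"
  by (rule dird_in_tangent_space[OF open_ball Y_smooth]) (use Y_in in auto)

lemma tangent_space_props:
  "q \<in> M \<Longrightarrow> subspace (tangent_space M q)" "q \<in> M \<Longrightarrow> dim (tangent_space M q) = CARD('m)"
  "q \<in> M \<Longrightarrow> pos_def_on (tangent_space M q)"
  using spacelike tangent_space_section(1,2)[of M q] by (auto simp: spacelike_submanifold_def)

lemma tangent_space_Y:
  assumes x: "x \<in> ball 0 r"
  shows "tangent_space M (Y x) = range (\<lambda>v. dird v Y x)"
proof -
  have inj: "inj (\<lambda>v. dird v Y x)"
    by (rule injI) (metis pinner_dird_Y(1)[OF x] vec_eq_iff)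
  have "range (\<lambda>v. dird v Y x) \<subseteq> tangent_space M (Y x)" using dird_Y_tangent[OF x] by auto
  moreover have "subspace (range (\<lambda>v. dird v Y x))" using linear_subspace_image[OF linear_dird_Y[OF x] subspace_UNIV] .
  moreover have "dim (range (\<lambda>v. dird v Y x)) = dim (tangent_space M (Y x))"
    using dim_image_eq[OF linear_dird_Y[OF x], of UNIV] inj tangent_space_props(2)[OF Y_in(1)[OF x]] by simp
  ultimately show ?thesis using tangent_space_props(1)[OF Y_in(1)[OF x]]
    by (metis subspace_dim_equal order_refl)
qed

lemma tangent_expand:
  assumes x: "x \<in> ball 0 r" and v: "v \<in> tangent_space M (Y x)"
  shows "v = dird (\<chi> i. pinner v (e i)) Y x"
proof -
  obtain w where w: "v = dird w Y x" using v tangent_space_Y[OF x] by auto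
  have "(\<chi> i. pinner v (e i)) = w" using pinner_dird_Y(1)[OF x] by (simp add: w vec_eq_iff)
  then show ?thesis using w by simp
qed

lemma dird_Y_0: "dird v Y 0 = (\<Sum>i\<in>UNIV. (v $ i) *\<^sub>R e i)"
  using dird_Y[OF open_ball_0(2)] by (simp add: df_0)

lemma dird_axis_Y_0: "pd i Y 0 = e i"
  unfolding dird_Y_0 by (simp add: axis_def if_distrib[of "\<lambda>c. c *\<^sub>R _"] cong: if_cong)

lemma coord_p: "coord p = 0"
  using coord_Y[of 0] by (simp add: Y_0)

lemma bounded_linear_coord: "bounded_linear (\<lambda>q. coord (q + p))"
proof -
  have "linear (\<lambda>q. coord (q + p))"
    by (rule linearI) (auto simp: coord_def vec_eq_iff pinner_simps)
  then show ?thesis by (simp add: linear_conv_bounded_linear)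
qed

lemma coord_smooth: "smooth_on S coord"
proof -
  have "smooth_on UNIV (\<lambda>q. coord ((q - p) + p))"
    by (rule smooth_on_linear_compose[OF open_UNIV bounded_linear_coord])
      (intro smooth_on_diff smooth_on_id smooth_on_const open_UNIV)
  then show ?thesis using smooth_on_subset[of UNIV coord S] by simp
qed

lemma continuous_coord: "continuous_on S coord"
  by (rule smooth_on_continuous_on[OF coord_smooth])

end

text \<open>
  The tangential components along an adapted basis are injective on the tangent space and thus serve
  as a coordinate; the normal components of the resulting section are the functions \<open>f\<close>.
\<close>

theorem gauge_chart_exists:
  fixes M :: "('m::finite, 'n::finite) pseudo set"
  assumes M: "spacelike_submanifold M" "p \<in> M"
  shows "\<exists>e \<nu> r f U. gauge_chart M p e \<nu> r f U"
proof -
  let ?T = "tangent_space M p"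
  have sub: "submanifold M" and pos: "pos_def_on ?T" using M by (auto simp: spacelike_submanifold_def)
  obtain e \<nu> where ad_to: "adapted_to ?T e \<nu>"
    using adapted_to_exists[OF tangent_space_section(1)[OF sub M(2)] pos tangent_space_section(2)[OF sub M(2)]] by blast
  then have ad: "adapted e \<nu>" by (simp add: adapted_to_def)
  define L where "L q = (\<chi> i. pinner q (e i))" for q
  have linL: "linear L" by (rule linearI) (auto simp: L_def vec_eq_iff pinner_simps)
  have injL: "inj_on L ?T"
  proof (rule inj_onI)
    fix v w assume vw: "v \<in> ?T" "w \<in> ?T" "L v = L w"
    have "v - w \<in> ?T" using vw tangent_space_section(1)[OF sub M(2)] by (meson subspace_diff)
    moreover have "pinner (v - w) (e i) = 0" for i
      using vw(3) by (simp add: L_def vec_eq_iff pinner_simps)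
    then have "v - w \<in> pperp ?T" using adapted_to_mem_pperp[OF ad_to] by blast
    ultimately have "pinner (v - w) (v - w) = 0" by (auto simp: pperp_def)
    then show "v = w" using pos \<open>v - w \<in> ?T\<close> unfolding pos_def_on_def by (metis eq_iff_diff_eq_0 less_irrefl)
  qed
  from tangent_space_section(3)[OF sub M(2) linL injL]
  obtain Z U' \<sigma> where s0: "open Z \<and> open U' \<and> p \<in> U' \<and> L p \<in> Z \<and> smooth_on Z \<sigma> \<and>
    (\<forall>z\<in>Z. \<sigma> z \<in> M \<and> L (\<sigma> z) = z) \<and> (\<forall>q\<in>M \<inter> U'. L q \<in> Z \<and> \<sigma> (L q) = q)" by (elim exE) (rule that)
  then have s: "open Z" "open U'" "p \<in> U'" "L p \<in> Z" "smooth_on Z \<sigma>"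
    "\<And>z. z \<in> Z \<Longrightarrow> \<sigma> z \<in> M" "\<And>z. z \<in> Z \<Longrightarrow> L (\<sigma> z) = z"
    "\<And>q. q \<in> M \<Longrightarrow> q \<in> U' \<Longrightarrow> L q \<in> Z" "\<And>q. q \<in> M \<Longrightarrow> q \<in> U' \<Longrightarrow> \<sigma> (L q) = q" by auto
  have sp: "\<sigma> (L p) = p" using s(9) M(2) s(3) by blast
  have "continuous_on Z \<sigma>" by (rule smooth_on_continuous_on[OF s(5)])
  then have "open (Z \<inter> \<sigma> -` U')" using s(1,2) continuous_open_preimage by blast
  then obtain r where r: "r > 0" "ball (L p) r \<subseteq> Z \<inter> \<sigma> -` U'"
    using s(3,4) sp open_contains_ball by (metis IntI vimageI2)
  have inZ: "L p + x \<in> Z" "\<sigma> (L p + x) \<in> U'" if "x \<in> ball 0 r" for x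
  proof -
    have "L p + x \<in> ball (L p) r" using that by (simp add: dist_norm)
    then show "L p + x \<in> Z" "\<sigma> (L p + x) \<in> U'" using r(2) by auto
  qed
  define f where "f s x = - pinner (\<sigma> (L p + x) - p) (\<nu> s)" for s x
  define U where "U = U' \<inter> {q. L q - L p \<in> ball 0 r}"
  have contL: "continuous_on UNIV L"
    using linL linear_continuous_on linear_conv_bounded_linear by blast
  have opU: "open U"
  proof -
    have "continuous_on UNIV (\<lambda>q. L q - L p)" by (intro continuous_intros contL)
    then have "open ((\<lambda>q. L q - L p) -` ball 0 r)" using open_vimage open_ball by blast
    moreover have "U = U' \<inter> (\<lambda>q. L q - L p) -` ball 0 r" by (auto simp: U_def)
    ultimately show ?thesis using s(2) by auto
  qed
  have Yeq: "p + (\<Sum>i\<in>UNIV. (x $ i) *\<^sub>R e i) + (\<Sum>s\<in>UNIV. f s x *\<^sub>R \<nu> s) = \<sigma> (L p + x)" if "x \<in> ball 0 r" for x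
  proof -
    have "pinner (\<sigma> (L p + x) - p) (e i) = x $ i" for i
    proof -
      have "L (\<sigma> (L p + x)) $ i = L p $ i + x $ i" using s(7)[OF inZ(1)[OF that]] by simp
      then show ?thesis by (simp add: L_def pinner_simps)
    qed
    then show ?thesis using adapted_expand[OF ad, of "\<sigma> (L p + x) - p"] by (simp add: f_def sum_negf algebra_simps)
  qed
  have asm: "smooth_on (ball 0 r) (\<lambda>x. \<sigma> (L p + x))"
  proof (rule smooth_on_compose[OF open_ball s(1) _ _ s(5)])
    show "(+) (L p) ` ball 0 r \<subseteq> Z" using inZ(1) by (intro image_subsetI)
    show "smooth_on (ball 0 r) ((+) (L p))"
      using smooth_on_add[OF open_ball smooth_on_const smooth_on_id, of 0 r "L p"] by simp
  qed
  have fsm: "smooth_on (ball 0 r) (f s)" for s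
    unfolding f_def[abs_def]
    by (intro smooth_on_minus smooth_on_pinner smooth_on_diff smooth_on_const asm open_ball)
  have dfs: "dird v (f s) 0 = 0" for v s
  proof -
    have 0: "0 \<in> ball 0 r" using r by simp
    have b: "bounded_linear (\<lambda>w. - pinner w (\<nu> s))"
      using bounded_linear_minus bounded_bilinear.bounded_linear_left[OF bounded_bilinear_pinner] by blast
    have d1: "smooth_on (ball 0 r) (\<lambda>x. - pinner (\<sigma> (L p + x)) (\<nu> s))"
      by (rule smooth_on_linear_compose[OF open_ball b asm])
    have feq: "f s = (\<lambda>x. (- pinner (\<sigma> (L p + x)) (\<nu> s)) + pinner p (\<nu> s))"
      by (simp add: f_def fun_eq_iff pinner_simps)
    have "dird v (f s) 0 = dird v (\<lambda>x. - pinner (\<sigma> (L p + x)) (\<nu> s)) 0 + dird v (\<lambda>x. pinner p (\<nu> s)) (0 :: real ^ 'm)"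
      unfolding feq
      by (rule dird_add[OF smooth_on_differentiable[OF d1 0]]) simp
    also have "\<dots> = - pinner (dird v (\<lambda>x. \<sigma> (L p + x)) 0) (\<nu> s)"
      using dird_linear_compose[OF b smooth_on_differentiable[OF asm 0]] by (simp add: dird_const)
    also have "dird v (\<lambda>x. \<sigma> (L p + x)) 0 \<in> tangent_space M (\<sigma> (L p + 0))"
      by (rule dird_in_tangent_space[OF open_ball asm]) (use inZ s 0 in auto)
    then have "pinner (dird v (\<lambda>x. \<sigma> (L p + x)) 0) (\<nu> s) = 0"
      using adapted_to_mem[OF ad_to] sp by simp
    finally show ?thesis by simp
  qed
  have im: "M \<inter> U = (\<lambda>x. p + (\<Sum>i\<in>UNIV. (x $ i) *\<^sub>R e i) + (\<Sum>s\<in>UNIV. f s x *\<^sub>R \<nu> s)) ` ball 0 r"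
  proof
    show "M \<inter> U \<subseteq> (\<lambda>x. p + (\<Sum>i\<in>UNIV. (x $ i) *\<^sub>R e i) + (\<Sum>s\<in>UNIV. f s x *\<^sub>R \<nu> s)) ` ball 0 r"
    proof
      fix q assume q: "q \<in> M \<inter> U"
      then have "L q - L p \<in> ball 0 r" "\<sigma> (L p + (L q - L p)) = q" using s(9) by (auto simp: U_def)
      then show "q \<in> (\<lambda>x. p + (\<Sum>i\<in>UNIV. (x $ i) *\<^sub>R e i) + (\<Sum>s\<in>UNIV. f s x *\<^sub>R \<nu> s)) ` ball 0 r"
        by (intro image_eqI[of _ _ "L q - L p"]) (simp_all only: Yeq)
    qed
    show "(\<lambda>x. p + (\<Sum>i\<in>UNIV. (x $ i) *\<^sub>R e i) + (\<Sum>s\<in>UNIV. f s x *\<^sub>R \<nu> s)) ` ball 0 r \<subseteq> M \<inter> U"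
    proof (rule image_subsetI)
      fix x :: "real ^ 'm" assume x: "x \<in> ball 0 r"
      show "p + (\<Sum>i\<in>UNIV. (x $ i) *\<^sub>R e i) + (\<Sum>s\<in>UNIV. f s x *\<^sub>R \<nu> s) \<in> M \<inter> U"
        unfolding Yeq[OF x] using s(6,7) inZ[OF x] x by (simp add: U_def)
    qed
  qed
  have f0: "f s 0 = 0" for s by (simp add: f_def sp pinner_simps)
  have "gauge_chart M p e \<nu> r f U"
    by (unfold_locales) (use M(1) ad_to r(1) fsm f0 dfs opU im in auto)
  then show ?thesis by blast
qed

section \<open>Mean curvature in a graph chart\<close>

lemma dird_expand:
  fixes x :: "real ^ 'm::finite"
  assumes "smooth_on S f" "x \<in> S"
  shows "dird v f x = (\<Sum>a\<in>UNIV. (v $ a) *\<^sub>R pd a f x)"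
proof -
  have l: "linear (\<lambda>v. dird v f x)" by (rule smooth_on_linear_dird[OF assms])
  have "dird v f x = dird (\<Sum>a\<in>UNIV. (v $ a) *\<^sub>R axis a 1) f x" using vec_eq_sum_axis[of v] by simp
  also have "\<dots> = (\<Sum>a\<in>UNIV. (v $ a) *\<^sub>R pd a f x)"
    by (simp add: linear_sum[OF l] linear_cmul[OF l])
  finally show ?thesis .
qed

context gauge_chart
begin

text \<open>
  The induced metric in the chart: the identity minus the Gram matrix of the slopes.
\<close>

definition metric :: "real ^ 'm \<Rightarrow> real ^ 'm \<Rightarrow> real ^ 'm \<Rightarrow> real" where
  "metric x v w = v \<bullet> w - (\<Sum>s\<in>UNIV. dird v (f s) x * dird w (f s) x)"

definition metric_orthonormal :: "real ^ 'm \<Rightarrow> ('m \<Rightarrow> real ^ 'm) \<Rightarrow> bool" where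
  "metric_orthonormal x \<theta> \<longleftrightarrow> (\<forall>i j. metric x (\<theta> i) (\<theta> j) = (if i = j then 1 else 0))"

lemma metric_eq: "x \<in> ball 0 r \<Longrightarrow> metric x v w = pinner (dird v Y x) (dird w Y x)"
  by (simp add: metric_def pinner_dird_Y_dird_Y)

lemma linear_metric: "x \<in> ball 0 r \<Longrightarrow> linear (\<lambda>v. metric x v w)"
  by (rule linearI) (auto simp: metric_eq pinner_simps linear_add[OF linear_dird_Y] linear_cmul[OF linear_dird_Y])

lemma metric_expand:
  assumes x: "x \<in> ball 0 r" and on: "metric_orthonormal x \<theta>"
  shows "w = (\<Sum>i\<in>UNIV. metric x w (\<theta> i) *\<^sub>R \<theta> i)"
proof -
  define L where "L c = (\<Sum>i\<in>UNIV. (c $ i) *\<^sub>R \<theta> i)" for c :: "real ^ 'm"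
  have lin: "linear L" by (rule linearI) (auto simp: L_def algebra_simps sum.distrib scaleR_sum_right)
  have LL: "metric x (L c) (\<theta> j) = c $ j" for c j
  proof -
    have "metric x (L c) (\<theta> j) = (\<Sum>i\<in>UNIV. c $ i * metric x (\<theta> i) (\<theta> j))"
      unfolding L_def by (simp add: linear_sum[OF linear_metric[OF x]] linear_cmul[OF linear_metric[OF x]])
    then show ?thesis using on by (simp add: metric_orthonormal_def if_times_delta)
  qed
  have "inj L" by (rule injI) (metis LL vec_eq_iff)
  then have "surj L" using lin linear_injective_imp_surjective by blast
  then obtain c where c: "w = L c" by (metis surjD)
  show ?thesis using LL[of c] unfolding c by (simp add: L_def)
qed

text \<open>
  The deviation \<open>A\<close> of the metric \<open>1 - A\<close> from the standard one.
\<close>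

definition slope_gram :: "'m \<Rightarrow> 'm \<Rightarrow> real ^ 'm \<Rightarrow> real" where
  "slope_gram b c x = (\<Sum>s\<in>UNIV. pd b (f s) x * pd c (f s) x)"

definition inverse_metric :: "('m \<Rightarrow> real ^ 'm) \<Rightarrow> 'm \<Rightarrow> 'm \<Rightarrow> real" where
  "inverse_metric \<theta> a b = (\<Sum>i\<in>UNIV. \<theta> i $ a * \<theta> i $ b)"

text \<open>
  The relation \<open>G = 1 + G A\<close> for the inverse \<open>G\<close> of \<open>1 - A\<close>.  Since \<open>A\<close> vanishes to second order at
  the centre, it determines the derivatives of \<open>G\<close> there up to second order without inverting a matrix.
\<close>

lemma inverse_metric_eq:
  assumes x: "x \<in> ball 0 r" and on: "metric_orthonormal x \<theta>"
  shows "inverse_metric \<theta> a c = (if a = c then 1 else 0) + (\<Sum>b\<in>UNIV. inverse_metric \<theta> a b * slope_gram b c x)"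
proof -
  have g: "metric x (axis c 1) (\<theta> i) = \<theta> i $ c - (\<Sum>b\<in>UNIV. \<theta> i $ b * slope_gram b c x)" for i
  proof -
    have "(\<Sum>s\<in>UNIV. pd c (f s) x * dird (\<theta> i) (f s) x)
      = (\<Sum>s\<in>UNIV. \<Sum>b\<in>UNIV. \<theta> i $ b * (pd b (f s) x * pd c (f s) x))"
      by (rule sum.cong[OF refl], subst dird_expand[OF f_smooth x, of "\<theta> i"]) (simp add: sum_distrib_left mult_ac)
    also have "\<dots> = (\<Sum>b\<in>UNIV. \<theta> i $ b * slope_gram b c x)"
      by (subst sum.swap) (simp add: slope_gram_def sum_distrib_left)
    finally show ?thesis by (simp add: metric_def inner_axis' )
  qed
  have "(axis c 1 :: real ^ 'm) $ a = (\<Sum>i\<in>UNIV. metric x (axis c 1) (\<theta> i) *\<^sub>R \<theta> i) $ a"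
    using metric_expand[OF x on, of "axis c 1"] by simp
  also have "\<dots> = (\<Sum>i\<in>UNIV. \<theta> i $ c * \<theta> i $ a) - (\<Sum>i\<in>UNIV. \<Sum>b\<in>UNIV. \<theta> i $ a * \<theta> i $ b * slope_gram b c x)"
    by (simp add: g left_diff_distrib right_diff_distrib sum_subtractf sum_distrib_left sum_distrib_right mult_ac)
  also have "(\<Sum>i\<in>UNIV. \<Sum>b\<in>UNIV. \<theta> i $ a * \<theta> i $ b * slope_gram b c x) = (\<Sum>b\<in>UNIV. inverse_metric \<theta> a b * slope_gram b c x)"
    by (subst sum.swap) (simp add: inverse_metric_def sum_distrib_right)
  finally show ?thesis by (auto simp: axis_def inverse_metric_def mult.commute)
qed

lemma slope_gram_0: "slope_gram b c 0 = 0"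
  by (simp add: slope_gram_def df_0)

lemma slope_gram_smooth: "smooth_on (ball 0 r) (slope_gram b c)"
  unfolding slope_gram_def[abs_def]
  by (intro smooth_on_sum smooth_on_mult smooth_on_dird f_smooth open_ball)

lemma dird_slope_gram_0: "dird v (slope_gram b c) 0 = 0"
proof -
  have "dird v (slope_gram b c) 0 = (\<Sum>s\<in>UNIV. dird v (\<lambda>x. pd b (f s) x * pd c (f s) x) 0)"
    unfolding slope_gram_def[abs_def]
    by (rule dird_sum) (rule smooth_on_differentiable[OF smooth_on_mult[OF open_ball smooth_on_dird smooth_on_dird] open_ball_0(2)], (rule f_smooth)+)
  also have "\<dots> = 0"
    by (rule sum.neutral) (simp add: dird_mult smooth_on_differentiable[OF smooth_on_dird[OF f_smooth] open_ball_0(2)] df_0)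
  finally show ?thesis .
qed

lemma dird_dird_slope_gram_0:
  "dird w (dird v (slope_gram b c)) 0 =
    (\<Sum>s\<in>UNIV. dird v (pd b (f s)) 0 * dird w (pd c (f s)) 0
      + dird w (pd b (f s)) 0 * dird v (pd c (f s)) 0)"
proof -
  have "dird w (dird v (slope_gram b c)) 0
    = (\<Sum>s\<in>UNIV. dird w (dird v (\<lambda>x. pd b (f s) x * pd c (f s) x)) 0)"
    unfolding slope_gram_def[abs_def]
    by (rule dird_dird_sum[OF open_ball_0]) (rule smooth_on_mult[OF open_ball smooth_on_dird[OF f_smooth] smooth_on_dird[OF f_smooth]])
  also have "\<dots> = (\<Sum>s\<in>UNIV. dird v (pd b (f s)) 0 * dird w (pd c (f s)) 0
      + dird w (pd b (f s)) 0 * dird v (pd c (f s)) 0)"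
    unfolding dird_dird_mult[OF open_ball_0 smooth_on_dird[OF f_smooth] smooth_on_dird[OF f_smooth]] by (simp add: df_0)
  finally show ?thesis .
qed

subsection \<open>Flat derivatives along the submanifold\<close>

text \<open>
  The chart pulls the derivative within \<open>M\<close>, of which only the values on tangent vectors are
  determined, back to an ordinary derivative.
\<close>

lemma flat_nabla_Y:
  assumes F: "F differentiable (at (Y x) within M)" and x: "x \<in> ball 0 r"
  shows "((\<lambda>y. F (Y y)) has_derivative (\<lambda>v. flat_nabla M (dird v Y x) F (Y x))) (at x)"
proof -
  have 1: "(F has_derivative frechet_derivative F (at (Y x) within M)) (at (Y x) within M)"
    using F frechet_derivative_works by blast
  have "Y ` ball 0 r \<subseteq> M" using Y_in by auto
  from has_derivative_subset[OF 1 this]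
  have 2: "(F has_derivative frechet_derivative F (at (Y x) within M)) (at (Y x) within Y ` ball 0 r)" .
  have 3: "(Y has_derivative (\<lambda>v. dird v Y x)) (at x within ball 0 r)"
    using smooth_on_has_derivative[OF Y_smooth x] has_derivative_at_withinI by blast
  have 4: "at x within ball 0 r = at x" by (rule at_within_open[OF x open_ball])
  show ?thesis using diff_chain_within[OF 3 2] unfolding 4 o_def flat_nabla_def .
qed

lemma smooth_along_differentiable:
  assumes "smooth_along (N \<inter> V) F" "q \<in> N" "q \<in> V" "open V"
  shows "F differentiable (at q within N)"
proof -
  have "q \<in> N \<inter> V" using assms by simp
  from assms(1)[unfolded smooth_along_def, rule_format, OF this]
  obtain O' G where "open O' \<and> q \<in> O' \<and> smooth_on O' G \<and> (\<forall>x\<in>N \<inter> V \<inter> O'. F x = G x)"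
    by (elim exE) (rule that)
  then have G: "open O'" "q \<in> O'" "smooth_on O' G" "\<And>x. x \<in> N \<inter> V \<inter> O' \<Longrightarrow> F x = G x" by auto
  have "open (O' \<inter> V)" using G assms by auto
  then obtain d where d: "d > 0" "ball q d \<subseteq> O' \<inter> V" using G(2) assms(3) open_contains_ball by blast
  have "(G has_derivative (\<lambda>v. dird v G q)) (at q within N)"
    using smooth_on_has_derivative[OF G(3,2)] has_derivative_at_withinI by blast
  then have "(F has_derivative (\<lambda>v. dird v G q)) (at q within N)"
    by (rule has_derivative_transform_within[OF _ d(1) assms(2)])
      (use d(2) G(4) in \<open>auto simp: subset_iff dist_commute\<close>)
  then show ?thesis by (auto simp: differentiable_def)
qed

lemma frame_coefficients:
  assumes fr: "orthonormal_tangent_frame M V E" and x: "x \<in> ball 0 r" "Y x \<in> V"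
    and \<theta>: "\<And>i. \<theta> i = (\<chi> a. pinner (E i (Y x)) (e a))"
  shows "E i (Y x) = dird (\<theta> i) Y x" "metric_orthonormal x \<theta>"
proof -
  have T: "E i (Y x) \<in> tangent_space M (Y x)" "pinner (E i (Y x)) (E j (Y x)) = (if i = j then 1 else 0)" for i j
    using fr x Y_in(1)[OF x(1)] unfolding orthonormal_tangent_frame_def by auto
  show *: "E i (Y x) = dird (\<theta> i) Y x" for i
    unfolding \<theta> by (rule tangent_expand[OF x(1) T(1)])
  show "metric_orthonormal x \<theta>"
    unfolding metric_orthonormal_def metric_eq[OF x(1)] *[symmetric] using T(2) by blast
qed

lemma normal_part_frame:
  assumes x: "x \<in> ball 0 r" and on: "metric_orthonormal x \<theta>" and t: "t \<in> tangent_space M (Y x)"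
  shows "normal_part (tangent_space M (Y x)) (t + w) =
    w - (\<Sum>k\<in>UNIV. pinner w (dird (\<theta> k) Y x) *\<^sub>R dird (\<theta> k) Y x)" (is "_ = ?n")
proof (rule normal_part_eq)
  note q = Y_in(1)[OF x]
  let ?S = "\<Sum>k\<in>UNIV. pinner w (dird (\<theta> k) Y x) *\<^sub>R dird (\<theta> k) Y x"
  show "subspace (tangent_space M (Y x))" "pos_def_on (tangent_space M (Y x))"
    using tangent_space_props[OF q] by auto
  have S: "?S \<in> tangent_space M (Y x)"
    by (intro subspace_sum subspace_scale tangent_space_props[OF q] dird_Y_tangent[OF x])
  have "t + w - ?n = t + ?S" by simp
  then show "t + w - ?n \<in> tangent_space M (Y x)"
    using subspace_add[OF tangent_space_props(1)[OF q] t S] by simp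
  have o: "pinner (dird (\<theta> j) Y x) ?n = 0" for j
    unfolding pinner_simps metric_eq[OF x, symmetric]
    using on by (simp add: metric_orthonormal_def if_times_delta pinner_commute)
  show "?n \<in> pperp (tangent_space M (Y x))"
    unfolding pperp_def
  proof (intro CollectI ballI)
    fix v assume "v \<in> tangent_space M (Y x)"
    then obtain u where u: "v = dird u Y x" using tangent_space_Y[OF x] by auto
    have "v = dird (\<Sum>i\<in>UNIV. metric x u (\<theta> i) *\<^sub>R \<theta> i) Y x" using metric_expand[OF x on, of u] u by simp
    also have "\<dots> = (\<Sum>i\<in>UNIV. metric x u (\<theta> i) *\<^sub>R dird (\<theta> i) Y x)"
      by (simp add: linear_sum[OF linear_dird_Y[OF x]] linear_cmul[OF linear_dird_Y[OF x]])
    finally have v: "v = (\<Sum>i\<in>UNIV. metric x u (\<theta> i) *\<^sub>R dird (\<theta> i) Y x)" .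
    have "pinner v ?n = (\<Sum>i\<in>UNIV. metric x u (\<theta> i) * pinner (dird (\<theta> i) Y x) ?n)"
      by (subst v) (simp only: bounded_bilinear.sum_left[OF bounded_bilinear_pinner] bounded_bilinear.scaleR_left[OF bounded_bilinear_pinner] real_scaleR_def)
    then show "pinner v ?n = 0" by (simp only: o) simp
  qed
qed

text \<open>
  Differentiating \<open>E i = dird (\<theta> i) Y\<close> along itself, the derivative of the coefficients \<open>\<theta> i\<close>
  produces tangent vectors only, so the normal part sees just the second derivatives of \<open>Y\<close>.
\<close>

lemma second_fundamental_form_frame:
  assumes fr: "orthonormal_tangent_frame M V E" and x: "x \<in> ball 0 r" "Y x \<in> V"
    and \<theta>: "\<And>i. \<theta> i = (\<chi> a. pinner (E i (Y x)) (e a))"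
  defines "w \<equiv> \<lambda>i. \<Sum>a\<in>UNIV. \<Sum>b\<in>UNIV. (\<theta> i $ a * \<theta> i $ b) *\<^sub>R pd b (pd a Y) x"
  shows "second_fundamental_form M (E i) (E i) (Y x) =
    w i - (\<Sum>k\<in>UNIV. pinner (w i) (E k (Y x)) *\<^sub>R E k (Y x))"
proof -
  note fc = frame_coefficients[OF fr x \<theta>]
  have V: "open V" and sa: "smooth_along (M \<inter> V) (E i)"
    and T: "\<And>y. y \<in> M \<Longrightarrow> y \<in> V \<Longrightarrow> E i y \<in> tangent_space M y"
    using fr by (auto simp: orthonormal_tangent_frame_def)
  have dE: "((\<lambda>y. E i (Y y)) has_derivative (\<lambda>v. flat_nabla M (dird v Y x) (E i) (Y x))) (at x)"
    by (rule flat_nabla_Y[OF smooth_along_differentiable[OF sa Y_in(1)[OF x(1)] x(2) V] x(1)])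
  let ?D = "\<lambda>v. flat_nabla M (dird v Y x) (E i) (Y x)"
  have op: "open (ball 0 r \<inter> Y -` V)"
    using continuous_open_preimage[OF smooth_on_continuous_on[OF Y_smooth] open_ball V] .
  have bl: "bounded_linear (\<lambda>v. pinner v (e a))" for a
    by (rule bounded_bilinear.bounded_linear_left[OF bounded_bilinear_pinner])
  \<comment> \<open>A tangent vector is determined by its tangential components at the centre.\<close>
  have rep: "E i (Y y) = (\<Sum>a\<in>UNIV. pinner (E i (Y y)) (e a) *\<^sub>R pd a Y y)" if "y \<in> ball 0 r \<inter> Y -` V" for y
  proof -
    have y: "y \<in> ball 0 r" "E i (Y y) \<in> tangent_space M (Y y)" using that T[OF Y_in(1)] by auto
    show ?thesis
      by (subst tangent_expand[OF y], subst dird_expand[OF Y_smooth y(1)]) simp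
  qed
  have "((\<lambda>y. \<Sum>a\<in>UNIV. pinner (E i (Y y)) (e a) *\<^sub>R pd a Y y) has_derivative
      (\<lambda>v. \<Sum>a\<in>UNIV. pinner (E i (Y x)) (e a) *\<^sub>R dird v (pd a Y) x + pinner (?D v) (e a) *\<^sub>R pd a Y x)) (at x)"
    by (intro has_derivative_sum bounded_bilinear.FDERIV[OF bounded_bilinear_scaleR] bounded_linear.has_derivative[OF bl dE]
        smooth_on_has_derivative[OF smooth_on_dird[OF Y_smooth] x(1)])
  then have "((\<lambda>y. E i (Y y)) has_derivative
      (\<lambda>v. \<Sum>a\<in>UNIV. pinner (E i (Y x)) (e a) *\<^sub>R dird v (pd a Y) x + pinner (?D v) (e a) *\<^sub>R pd a Y x)) (at x)"
    by (rule has_derivative_transform_within_open[OF _ op]) (use x rep in auto)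
  with dE have "?D = (\<lambda>v. \<Sum>a\<in>UNIV. pinner (E i (Y x)) (e a) *\<^sub>R dird v (pd a Y) x + pinner (?D v) (e a) *\<^sub>R pd a Y x)"
    by (rule has_derivative_unique)
  then have D: "?D (\<theta> i) = (\<Sum>a\<in>UNIV. pinner (E i (Y x)) (e a) *\<^sub>R dird (\<theta> i) (pd a Y) x + pinner (?D (\<theta> i)) (e a) *\<^sub>R pd a Y x)"
    by (rule fun_cong)
  define t where "t = (\<Sum>a\<in>UNIV. pinner (?D (\<theta> i)) (e a) *\<^sub>R pd a Y x)"
  have "(\<Sum>a\<in>UNIV. pinner (E i (Y x)) (e a) *\<^sub>R dird (\<theta> i) (pd a Y) x) = w i"
    unfolding w_def by (rule sum.cong[OF refl], subst dird_expand[OF smooth_on_dird[OF Y_smooth] x(1), of "\<theta> i"])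
      (simp add: \<theta> scaleR_sum_right)
  with D have D2: "flat_nabla M (E i (Y x)) (E i) (Y x) = t + w i"
    unfolding t_def fc(1)[of i] by (simp add: sum.distrib add.commute)
  have "t \<in> tangent_space M (Y x)"
    unfolding t_def by (intro subspace_sum subspace_scale tangent_space_props[OF Y_in(1)[OF x(1)]] dird_Y_tangent[OF x(1)])
  from normal_part_frame[OF x(1) fc(2) this, of "w i"]
  show ?thesis unfolding second_fundamental_form_def D2 fc(1)[symmetric] .
qed

text \<open>
  A function of the coordinates extends to an open set, the coordinates being affine functions of the point.
\<close>

lemma smooth_along_coord:
  assumes h: "smooth_on (ball 0 r) h" and F: "\<And>q. q \<in> M \<Longrightarrow> q \<in> U \<Longrightarrow> F q = h (coord q)"
  shows "smooth_along (M \<inter> U) F"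
  unfolding smooth_along_def
proof
  fix q assume q: "q \<in> M \<inter> U"
  have "open (coord -` ball 0 r)" using continuous_coord open_vimage open_ball by blast
  moreover have "smooth_on (coord -` ball 0 r) (\<lambda>q. h (coord q))"
    by (rule smooth_on_compose[OF calculation open_ball _ coord_smooth h]) auto
  moreover have "q \<in> coord -` ball 0 r" using q Y_coord(2) by blast
  ultimately show "\<exists>U' G. open U' \<and> q \<in> U' \<and> smooth_on U' G \<and> (\<forall>x\<in>M \<inter> U \<inter> U'. F x = G x)"
    using F by (intro exI[of _ "coord -` ball 0 r"] exI[of _ "\<lambda>q. h (coord q)"]) auto
qed

lemma frame_exists:
  "\<exists>b. (\<forall>i. smooth_on (ball 0 r) (b i)) \<and> orthonormal_tangent_frame M U (\<lambda>i q. b i (coord q))"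
proof -
  have "\<exists>b. (\<forall>i\<in>UNIV. smooth_on (ball 0 r) (b i)) \<and> (\<forall>x\<in>ball 0 r. (\<forall>i\<in>UNIV. b i x \<in> span ((\<lambda>j. pd j Y x) ` UNIV)) \<and>
    (\<forall>i\<in>(UNIV::'m set). \<forall>j\<in>UNIV. 1 * pinner (b i x) (b j x) = (if i = j then 1 else 0)))"
  proof (rule smooth_gram_schmidt[where W = "\<lambda>x. tangent_space M (Y x)"])
    fix x assume x: "x \<in> ball (0::real^'m) r"
    show "subspace (tangent_space M (Y x))" using tangent_space_props(1)[OF Y_in(1)[OF x]] .
    show "0 < 1 * pinner w w" if "w \<in> tangent_space M (Y x)" "w \<noteq> 0" for w
      using tangent_space_props(3)[OF Y_in(1)[OF x]] that by (simp add: pos_def_on_def)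
    show "pd i Y x \<in> tangent_space M (Y x)" for i by (rule dird_Y_tangent[OF x])
    show "pd i Y x \<notin> span ((\<lambda>j. pd j Y x) ` (UNIV - {i}))" for i
    proof
      assume a: "pd i Y x \<in> span ((\<lambda>j. pd j Y x) ` (UNIV - {i}))"
      have "span ((\<lambda>j. pd j Y x) ` (UNIV - {i})) \<subseteq> {v. pinner v (e i) = 0}"
      proof (rule span_minimal)
        show "(\<lambda>j. pd j Y x) ` (UNIV - {i}) \<subseteq> {v. pinner v (e i) = 0}"
          by (auto simp: pinner_dird_Y[OF x] axis_def)
        show "subspace {v. pinner v (e i) = 0}" by (auto simp: subspace_def pinner_simps)
      qed
      with a have "pinner (pd i Y x) (e i) = 0" by auto
      then show False by (simp add: pinner_dird_Y[OF x])
    qed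
  qed (auto intro: smooth_on_dird Y_smooth)
  then obtain b where b0: "(\<forall>i\<in>UNIV. smooth_on (ball 0 r) (b i)) \<and> (\<forall>x\<in>ball 0 r. (\<forall>i\<in>UNIV. b i x \<in> span ((\<lambda>j. pd j Y x) ` UNIV)) \<and>
    (\<forall>i\<in>(UNIV::'m set). \<forall>j\<in>UNIV. 1 * pinner (b i x) (b j x) = (if i = j then 1 else 0)))"
    by (elim exE) (rule that)
  then have b: "\<And>i. smooth_on (ball 0 r) (b i)"
    "\<And>x i. x \<in> ball 0 r \<Longrightarrow> b i x \<in> span (range (\<lambda>j. pd j Y x))"
    "\<And>x i j. x \<in> ball 0 r \<Longrightarrow> pinner (b i x) (b j x) = (if i = j then 1 else 0)"
    by (simp_all only: ball_simps UNIV_I mult_1)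
  have "orthonormal_tangent_frame M U (\<lambda>i q. b i (coord q))"
    unfolding orthonormal_tangent_frame_def
  proof (intro conjI allI ballI)
    show "open U" by (rule U)
    show "smooth_along (M \<inter> U) (\<lambda>q. b i (coord q))" for i
      by (rule smooth_along_coord[OF b(1)]) simp
    fix q assume q: "q \<in> M \<inter> U"
    then have c: "coord q \<in> ball 0 r" "Y (coord q) = q" using Y_coord by blast+
    have "span (range (\<lambda>j. pd j Y (coord q))) \<subseteq> tangent_space M q"
      using dird_Y_tangent[OF c(1)] tangent_space_props(1)[of q] q by (intro span_minimal) (auto simp: c(2))
    then show "b i (coord q) \<in> tangent_space M q" for i using b(2)[OF c(1)] by blast
    show "pinner (b i (coord q)) (b j (coord q)) = (if i = j then 1 else 0)" for i j
      using b(3)[OF c(1)] .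
  qed
  with b(1) show ?thesis by blast
qed

definition trace_hessian :: "'n \<Rightarrow> real ^ 'm \<Rightarrow> real" where
  "trace_hessian s x = (\<Sum>a\<in>UNIV. pd a (pd a (f s)) x)"

text \<open>
  At the centre the coefficients of an orthonormal frame form an orthogonal matrix, so the trace does
  not depend on the frame; this makes the mean curvature well defined.
\<close>

lemma sff_trace_centre:
  assumes fr: "orthonormal_tangent_frame M V E" and pV: "p \<in> V"
  shows "(\<Sum>i\<in>UNIV. second_fundamental_form M (E i) (E i) p) = (\<Sum>s\<in>UNIV. trace_hessian s 0 *\<^sub>R \<nu> s)"
proof -
  note x = open_ball_0(2)
  define \<theta> where "\<theta> i = (\<chi> a. pinner (E i (Y 0)) (e a))" for i
  have pV': "Y 0 \<in> V" using pV by (simp add: Y_0)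
  note fc = frame_coefficients[OF fr x pV' \<theta>_def]
  define D where "D a b = pd b (pd a Y) 0" for a b
  have E0: "pinner (D a b) (E k (Y 0)) = 0" for a b k
    unfolding D_def fc(1) pinner_dird_dird_Y_dird_Y[OF x] by (simp add: df_0)
  have "second_fundamental_form M (E i) (E i) p = (\<Sum>a\<in>UNIV. \<Sum>b\<in>UNIV. (\<theta> i $ a * \<theta> i $ b) *\<^sub>R D a b)" for i
    using second_fundamental_form_frame[OF fr x pV' \<theta>_def, of i]
    unfolding D_def[symmetric] pinner_simps E0 by (simp add: Y_0)
  then have "(\<Sum>i\<in>UNIV. second_fundamental_form M (E i) (E i) p) =
     (\<Sum>i\<in>UNIV. \<Sum>a\<in>UNIV. \<Sum>b\<in>UNIV. (\<theta> i $ a * \<theta> i $ b) *\<^sub>R D a b)" by simp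
  also have "\<dots> = (\<Sum>a\<in>UNIV. \<Sum>b\<in>UNIV. inverse_metric \<theta> a b *\<^sub>R D a b)"
    unfolding inverse_metric_def scaleR_sum_left
    by (subst sum.swap, rule sum.cong[OF refl], subst sum.swap, rule refl)
  also have "\<dots> = (\<Sum>a\<in>UNIV. D a a)"
    using inverse_metric_eq[OF x fc(2)] by (simp add: slope_gram_0 if_distrib[of "\<lambda>c. c *\<^sub>R _"] cong: if_cong)
  also have "\<dots> = (\<Sum>s\<in>UNIV. trace_hessian s 0 *\<^sub>R \<nu> s)"
    unfolding D_def dird_dird_Y[OF x] trace_hessian_def scaleR_sum_left by (rule sum.swap)
  finally show ?thesis .
qed

lemma mean_curvature_centre:
  "mean_curvature M p = (1 / real CARD('m)) *\<^sub>R (\<Sum>s\<in>UNIV. trace_hessian s 0 *\<^sub>R \<nu> s)"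
  unfolding mean_curvature_def
proof (rule the_equality)
  obtain b where b: "orthonormal_tangent_frame M U (\<lambda>i q. b i (coord q))" using frame_exists by blast
  show "\<exists>U e. p \<in> U \<and> orthonormal_tangent_frame M U e \<and>
    (1 / real CARD('m)) *\<^sub>R (\<Sum>s\<in>UNIV. trace_hessian s 0 *\<^sub>R \<nu> s) =
    (1 / real CARD('m)) *\<^sub>R (\<Sum>i\<in>UNIV. second_fundamental_form M (e i) (e i) p)"
    using b p_in(2) sff_trace_centre[OF b p_in(2)] by (intro exI[of _ U] exI[of _ "\<lambda>i q. b i (coord q)"]) simp
next
  fix h assume "\<exists>U e. p \<in> U \<and> orthonormal_tangent_frame M U e \<and>
    h = (1 / real CARD('m)) *\<^sub>R (\<Sum>i\<in>UNIV. second_fundamental_form M (e i) (e i) p)"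
  then show "h = (1 / real CARD('m)) *\<^sub>R (\<Sum>s\<in>UNIV. trace_hessian s 0 *\<^sub>R \<nu> s)"
    using sff_trace_centre by (elim exE conjE) simp
qed

end

lemma mean_curvature_frame:
  fixes M :: "('m::finite, 'n::finite) pseudo set"
  assumes M: "spacelike_submanifold M" "q \<in> M" and fr: "orthonormal_tangent_frame M V E" "q \<in> V"
  shows "mean_curvature M q = (1 / real CARD('m)) *\<^sub>R (\<Sum>i\<in>UNIV. second_fundamental_form M (E i) (E i) q)"
proof -
  obtain e \<nu> r f U where "gauge_chart M q e \<nu> r f U" using gauge_chart_exists[OF M] by blast
  then interpret gauge_chart M q e \<nu> r f U .
  show ?thesis using mean_curvature_centre sff_trace_centre[OF fr] by simp
qed

lemma mean_curvature_normal:
  assumes M: "spacelike_submanifold M" "q \<in> M"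
  shows "mean_curvature M q \<in> pperp (tangent_space M q)"
proof -
  obtain e \<nu> r f U where "gauge_chart M q e \<nu> r f U" using gauge_chart_exists[OF M] by blast
  then interpret gauge_chart M q e \<nu> r f U .
  have "\<nu> s \<in> pperp (tangent_space M q)" for s using ad_to by (simp add: adapted_to_def)
  then show ?thesis unfolding mean_curvature_centre
    by (intro subspace_scale subspace_sum subspace_pperp)
qed

lemma normal_part_eq_0:
  fixes T :: "('m::finite, 'n::finite) pseudo set"
  assumes T: "subspace T" "pos_def_on T" "dim T = CARD('m)" and 0: "normal_part T v = 0"
  shows "v \<in> T"
proof -
  obtain e \<nu> where A: "adapted_to T e \<nu>" using adapted_to_exists[OF T] by blast
  then have ad: "adapted e \<nu>" by (simp add: adapted_to_def)
  let ?N = "\<Sum>s\<in>UNIV. (- pinner v (\<nu> s)) *\<^sub>R \<nu> s"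
  have vN: "v - ?N = (\<Sum>i\<in>UNIV. pinner v (e i) *\<^sub>R e i)"
    using adapted_expand[OF ad, of v] by (simp add: sum_negf algebra_simps)
  have N: "?N \<in> pperp T" using A by (auto simp: adapted_to_def intro!: subspace_sum[OF subspace_pperp] subspace_scale[OF subspace_pperp] simp del: scaleR_minus_left)
  have "v - ?N \<in> T" unfolding vN using A by (auto simp: adapted_to_def intro!: subspace_sum subspace_scale)
  with normal_part_eq[OF T(1,2) N] 0 show ?thesis by simp
qed

context gauge_chart
begin

text \<open>
  The inverse metric through the relation \<open>G = 1 + G A\<close>, as a family of smooth functions on the chart.
\<close>

definition is_inverse_metric :: "('m \<Rightarrow> 'm \<Rightarrow> real ^ 'm \<Rightarrow> real) \<Rightarrow> bool" where
  "is_inverse_metric G \<longleftrightarrow> (\<forall>a b. smooth_on (ball 0 r) (G a b)) \<and>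
    (\<forall>x\<in>ball 0 r. \<forall>a c. G a c x = (if a = c then 1 else 0) + (\<Sum>b\<in>UNIV. G a b x * slope_gram b c x))"

context
  fixes G assumes G: "is_inverse_metric G"
begin

lemma G_smooth: "smooth_on (ball 0 r) (G a b)"
  using G by (simp add: is_inverse_metric_def)

lemma G_eq: "x \<in> ball 0 r \<Longrightarrow> G a c x = (if a = c then 1 else 0) + (\<Sum>b\<in>UNIV. G a b x * slope_gram b c x)"
  using G by (simp add: is_inverse_metric_def)

lemma G_0: "G a c 0 = (if a = c then 1 else 0)"
  using G_eq[OF open_ball_0(2)] by (simp add: slope_gram_0)

lemma G_prod_smooth: "smooth_on (ball 0 r) (\<lambda>x. \<Sum>b\<in>UNIV. G a b x * slope_gram b c x)"
  by (intro smooth_on_sum smooth_on_mult G_smooth slope_gram_smooth open_ball)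

lemma dird_G_0: "dird v (G a c) 0 = 0"
proof -
  have "dird v (G a c) 0 = dird v (\<lambda>x. (if a = c then 1 else 0) + (\<Sum>b\<in>UNIV. G a b x * slope_gram b c x)) 0"
    by (rule dird_cong_open[OF open_ball_0 G_eq])
  also have "\<dots> = dird v (\<lambda>x. \<Sum>b\<in>UNIV. G a b x * slope_gram b c x) 0"
    by (subst dird_add[OF _ smooth_on_differentiable[OF G_prod_smooth open_ball_0(2)]]) (simp_all add: dird_const)
  also have "\<dots> = (\<Sum>b\<in>UNIV. dird v (\<lambda>x. G a b x * slope_gram b c x) 0)"
    by (rule dird_sum) (rule smooth_on_differentiable[OF smooth_on_mult[OF open_ball G_smooth slope_gram_smooth] open_ball_0(2)])
  also have "\<dots> = 0"
    by (rule sum.neutral)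
      (simp add: dird_mult[OF smooth_on_differentiable[OF G_smooth open_ball_0(2)] smooth_on_differentiable[OF slope_gram_smooth open_ball_0(2)]]
        slope_gram_0 dird_slope_gram_0)
  finally show ?thesis .
qed

lemma dird_dird_G_0: "dird w (dird v (G a c)) 0 = dird w (dird v (slope_gram a c)) 0"
proof -
  have "dird w (dird v (G a c)) 0 = dird w (dird v (\<lambda>x. (if a = c then 1 else 0) + (\<Sum>b\<in>UNIV. G a b x * slope_gram b c x))) 0"
    by (rule dird_cong_open[OF open_ball_0], rule dird_cong_open[OF open_ball _ G_eq])
  also have "\<dots> = dird w (dird v (\<lambda>x. \<Sum>b\<in>UNIV. G a b x * slope_gram b c x)) 0"
  proof -
    have "dird w (dird v (\<lambda>x :: real ^ 'm. if a = c then 1 else 0 :: real)) 0 = 0"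
      by (simp add: dird_const[abs_def] dird_def)
    then show ?thesis by (subst dird_dird_add[OF open_ball_0 smooth_on_const G_prod_smooth]) simp
  qed
  also have "\<dots> = (\<Sum>b\<in>UNIV. dird w (dird v (\<lambda>x. G a b x * slope_gram b c x)) 0)"
    by (rule dird_dird_sum[OF open_ball_0]) (rule smooth_on_mult[OF open_ball G_smooth slope_gram_smooth])
  also have "\<dots> = (\<Sum>b\<in>UNIV. if a = b then dird w (dird v (slope_gram b c)) 0 else 0)"
    by (rule sum.cong[OF refl]) (simp add: dird_dird_mult[OF open_ball_0 G_smooth slope_gram_smooth] slope_gram_0 dird_slope_gram_0 G_0)
  finally show ?thesis by simp
qed

definition weighted_hessian :: "'n \<Rightarrow> real ^ 'm \<Rightarrow> real" where
  "weighted_hessian s x = (\<Sum>a\<in>UNIV. \<Sum>b\<in>UNIV. G a b x * pd b (pd a (f s)) x)"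

lemma hess_smooth: "smooth_on (ball 0 r) (dird v (dird w (f s)))"
  by (intro smooth_on_dird f_smooth)

lemma Gh_smooth: "smooth_on (ball 0 r) (\<lambda>x. G a b x * pd b (pd a (f s)) x)"
  by (rule smooth_on_mult[OF open_ball G_smooth hess_smooth])

lemma weighted_hessian_smooth: "smooth_on (ball 0 r) (weighted_hessian s)"
  unfolding weighted_hessian_def[abs_def] by (intro smooth_on_sum Gh_smooth open_ball)

lemma dird_weighted_hessian_0: "dird v (weighted_hessian s) 0 = dird v (trace_hessian s) 0"
proof -
  have "dird v (weighted_hessian s) 0 = (\<Sum>a\<in>UNIV. dird v (\<lambda>x. \<Sum>b\<in>UNIV. G a b x * pd b (pd a (f s)) x) 0)"
    unfolding weighted_hessian_def[abs_def]
    by (rule dird_sum) (rule smooth_on_differentiable[OF smooth_on_sum[OF open_ball Gh_smooth] open_ball_0(2)])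
  also have "\<dots> = (\<Sum>a\<in>UNIV. \<Sum>b\<in>UNIV. dird v (\<lambda>x. G a b x * pd b (pd a (f s)) x) 0)"
    by (intro sum.cong refl dird_sum) (rule smooth_on_differentiable[OF Gh_smooth open_ball_0(2)])
  also have "\<dots> = (\<Sum>a\<in>UNIV. dird v (pd a (pd a (f s))) 0)"
    by (simp add: dird_mult[OF smooth_on_differentiable[OF G_smooth open_ball_0(2)] smooth_on_differentiable[OF hess_smooth open_ball_0(2)]]
      G_0 dird_G_0 if_times_delta)
  also have "\<dots> = dird v (trace_hessian s) 0"
    unfolding trace_hessian_def[abs_def]
    by (rule dird_sum[symmetric]) (rule smooth_on_differentiable[OF hess_smooth open_ball_0(2)])
  finally show ?thesis .
qed

lemma dird_dird_weighted_hessian_0: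
  "dird w (dird v (weighted_hessian s)) 0 = dird w (dird v (trace_hessian s)) 0 +
    (\<Sum>a\<in>UNIV. \<Sum>b\<in>UNIV. dird w (dird v (slope_gram a b)) 0 * pd b (pd a (f s)) 0)"
proof -
  have "dird w (dird v (weighted_hessian s)) 0 = (\<Sum>a\<in>UNIV. dird w (dird v (\<lambda>x. \<Sum>b\<in>UNIV. G a b x * pd b (pd a (f s)) x)) 0)"
    unfolding weighted_hessian_def[abs_def]
    by (rule dird_dird_sum[OF open_ball_0]) (rule smooth_on_sum[OF open_ball Gh_smooth])
  also have "\<dots> = (\<Sum>a\<in>UNIV. \<Sum>b\<in>UNIV. dird w (dird v (\<lambda>x. G a b x * pd b (pd a (f s)) x)) 0)"
    by (intro sum.cong refl dird_dird_sum[OF open_ball_0]) (rule Gh_smooth)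
  also have "\<dots> = (\<Sum>a\<in>UNIV. \<Sum>b\<in>UNIV. dird w (dird v (slope_gram a b)) 0 * pd b (pd a (f s)) 0
       + (if a = b then dird w (dird v (pd b (pd a (f s)))) 0 else 0))"
    by (intro sum.cong refl) (simp add: dird_dird_mult[OF open_ball_0 G_smooth hess_smooth] dird_G_0 dird_dird_G_0 G_0)
  also have "\<dots> = (\<Sum>a\<in>UNIV. \<Sum>b\<in>UNIV. dird w (dird v (slope_gram a b)) 0 * pd b (pd a (f s)) 0)
      + (\<Sum>a\<in>UNIV. dird w (dird v (pd a (pd a (f s)))) 0)"
    by (simp add: sum.distrib)
  also have "(\<Sum>a\<in>UNIV. dird w (dird v (pd a (pd a (f s)))) 0) = dird w (dird v (trace_hessian s)) 0"
    unfolding trace_hessian_def[abs_def]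
    by (rule dird_dird_sum[OF open_ball_0, symmetric]) (rule hess_smooth)
  finally show ?thesis by simp
qed

end

definition second_trace :: "('m \<Rightarrow> 'm \<Rightarrow> real ^ 'm \<Rightarrow> real) \<Rightarrow> real ^ 'm \<Rightarrow> ('m, 'n) pseudo" where
  "second_trace G x = (\<Sum>a\<in>UNIV. \<Sum>b\<in>UNIV. G a b x *\<^sub>R pd b (pd a Y) x)"

lemma second_trace_smooth: "is_inverse_metric G \<Longrightarrow> smooth_on (ball 0 r) (second_trace G)"
  unfolding second_trace_def[abs_def]
  by (intro smooth_on_scaleR smooth_on_sum G_smooth smooth_on_dird Y_smooth open_ball)

lemma pinner_second_trace:
  assumes G: "is_inverse_metric G" and x: "x \<in> ball 0 r"
  shows "pinner (second_trace G x) (e i) = 0" "pinner (second_trace G x) (\<nu> s) = - weighted_hessian G s x"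
  unfolding second_trace_def weighted_hessian_def[OF G] pinner_simps pinner_dird_dird_Y[OF x] by (simp_all add: sum_negf)

text \<open>
  Away from the centre: \<open>m\<close> times the mean curvature is the normal part of the metric trace of the
  second derivatives of the chart, with an orthonormal frame \<open>E\<close> to project by.
\<close>

lemma mean_curvature_in_chart:
  "\<exists>G E. is_inverse_metric G \<and> (\<forall>k::'m. smooth_on (ball 0 r) (E k)) \<and>
    (\<forall>x\<in>ball 0 r. (\<forall>k. E k x \<in> tangent_space M (Y x)) \<and>
      real CARD('m) *\<^sub>R mean_curvature M (Y x) =
        second_trace G x - (\<Sum>k\<in>UNIV. pinner (second_trace G x) (E k x) *\<^sub>R E k x))"
proof -
  obtain E where E: "\<And>k. smooth_on (ball 0 r) (E k)" "orthonormal_tangent_frame M U (\<lambda>i q. E i (coord q))"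
    using frame_exists by blast
  define \<theta> where "\<theta> x i = (\<chi> a. pinner (E i x) (e a))" for x i
  define G where "G a b x = inverse_metric (\<theta> x) a b" for a b x
  let ?W = "second_trace G"
  have \<theta>: "\<theta> x i = (\<chi> a. pinner (E i (coord (Y x))) (e a))" for x i by (simp add: \<theta>_def coord_Y)
  have "is_inverse_metric G" unfolding is_inverse_metric_def
  proof (intro conjI allI ballI)
    show "smooth_on (ball 0 r) (G a b)" for a b
      unfolding G_def[abs_def] inverse_metric_def \<theta>_def vec_lambda_beta
      by (intro smooth_on_sum smooth_on_mult smooth_on_pinner E(1) smooth_on_const open_ball)
    fix x :: "real ^ 'm" and a c assume x: "x \<in> ball 0 r"
    show "G a c x = (if a = c then 1 else 0) + (\<Sum>b\<in>UNIV. G a b x * slope_gram b c x)"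
      unfolding G_def by (rule inverse_metric_eq[OF x frame_coefficients(2)[OF E(2) x Y_in(2)[OF x] \<theta>]])
  qed
  moreover have "E k x \<in> tangent_space M (Y x)" if x: "x \<in> ball 0 r" for k x
  proof -
    have "E k (coord (Y x)) \<in> tangent_space M (Y x)"
      using E(2) Y_in[OF x] unfolding orthonormal_tangent_frame_def by blast
    then show ?thesis by (simp add: coord_Y)
  qed
  moreover have "real CARD('m) *\<^sub>R mean_curvature M (Y x) = ?W x - (\<Sum>k\<in>UNIV. pinner (?W x) (E k x) *\<^sub>R E k x)"
    if x: "x \<in> ball 0 r" for x
  proof -
    define D where "D a b = pd b (pd a Y) x" for a b
    define w where "w i = (\<Sum>a\<in>UNIV. \<Sum>b\<in>UNIV. (\<theta> x i $ a * \<theta> x i $ b) *\<^sub>R D a b)" for i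
    have sw: "(\<Sum>i\<in>UNIV. w i) = ?W x"
      unfolding w_def second_trace_def G_def inverse_metric_def scaleR_sum_left D_def
      by (subst sum.swap, rule sum.cong[OF refl], subst sum.swap, rule refl)
    have "second_fundamental_form M (\<lambda>q. E i (coord q)) (\<lambda>q. E i (coord q)) (Y x) = w i - (\<Sum>k\<in>UNIV. pinner (w i) (E k x) *\<^sub>R E k x)" for i
      using second_fundamental_form_frame[OF E(2) x Y_in(2)[OF x] \<theta>, of i] unfolding coord_Y w_def D_def .
    then have "real CARD('m) *\<^sub>R mean_curvature M (Y x) = (\<Sum>i\<in>UNIV. w i - (\<Sum>k\<in>UNIV. pinner (w i) (E k x) *\<^sub>R E k x))"
      using mean_curvature_frame[OF spacelike Y_in(1)[OF x] E(2) Y_in(2)[OF x]] by simp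
    also have "\<dots> = (\<Sum>i\<in>UNIV. w i) - (\<Sum>k\<in>UNIV. pinner (\<Sum>i\<in>UNIV. w i) (E k x) *\<^sub>R E k x)"
      by (simp add: sum_subtractf bounded_bilinear.sum_left[OF bounded_bilinear_pinner] scaleR_sum_left)
        (rule sum.swap)
    finally show ?thesis unfolding sw .
  qed
  ultimately show ?thesis using E(1) by (intro exI[of _ G] exI[of _ E] conjI allI ballI)
qed

lemma mean_curvature_smooth:
  "\<exists>h. smooth_on (ball 0 r) h \<and> (\<forall>x\<in>ball 0 r. mean_curvature M (Y x) = h x)"
proof -
  obtain G E where G: "is_inverse_metric G" and E: "\<And>k::'m. smooth_on (ball 0 r) (E k)"
    and H: "\<And>x. x \<in> ball 0 r \<Longrightarrow> real CARD('m) *\<^sub>R mean_curvature M (Y x) =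
        second_trace G x - (\<Sum>k\<in>UNIV. pinner (second_trace G x) (E k x) *\<^sub>R E k x)"
    using mean_curvature_in_chart by blast
  let ?h = "\<lambda>x. second_trace G x - (\<Sum>k\<in>UNIV. pinner (second_trace G x) (E k x) *\<^sub>R E k x)"
  have "smooth_on (ball 0 r) (\<lambda>x. (1 / real CARD('m)) *\<^sub>R ?h x)"
    by (intro smooth_on_scaleR smooth_on_diff smooth_on_sum smooth_on_pinner smooth_on_const second_trace_smooth[OF G] E open_ball)
  moreover have "mean_curvature M (Y x) = (1 / real CARD('m)) *\<^sub>R ?h x" if "x \<in> ball 0 r" for x
    using H[OF that, symmetric] by simp
  ultimately show ?thesis by (intro exI[of _ "\<lambda>x. (1 / real CARD('m)) *\<^sub>R ?h x"]) simp
qed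

lemma parallel_dird_mean_curvature:
  assumes par: "parallel_mean_curvature M" and h: "smooth_on (ball 0 r) h" "\<And>x. x \<in> ball 0 r \<Longrightarrow> mean_curvature M (Y x) = h x"
    and x: "x \<in> ball 0 r"
  shows "dird v h x \<in> tangent_space M (Y x)"
proof -
  have "smooth_along (M \<inter> U) (mean_curvature M)"
    by (rule smooth_along_coord[OF h(1)]) (metis h(2) Y_coord)
  then have "mean_curvature M differentiable (at (Y x) within M)"
    using smooth_along_differentiable Y_in[OF x] U by blast
  from flat_nabla_Y[OF this x]
  have "(h has_derivative (\<lambda>v. flat_nabla M (dird v Y x) (mean_curvature M) (Y x))) (at x)"
    by (rule has_derivative_transform_within_open[OF _ open_ball x]) (simp add: h(2))
  then have "dird v h x = flat_nabla M (dird v Y x) (mean_curvature M) (Y x)" by (rule dird_eqI)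
  moreover have "normal_connection M (dird v Y x) (mean_curvature M) (Y x) = 0"
    using par Y_in(1)[OF x] dird_Y_tangent[OF x] unfolding parallel_mean_curvature_def by blast
  ultimately show ?thesis
    unfolding normal_connection_def
    using normal_part_eq_0[OF tangent_space_props(1)[OF Y_in(1)[OF x]] tangent_space_props(3)[OF Y_in(1)[OF x]] tangent_space_props(2)[OF Y_in(1)[OF x]]]
    by simp
qed

text \<open>
  The derivative of a parallel normal field is tangent, hence orthogonal to the field.
\<close>

lemma parallel_length_locally_constant:
  assumes par: "parallel_mean_curvature M" and q: "q \<in> M" "q \<in> U"
  shows "pinner (mean_curvature M q) (mean_curvature M q) = pinner (mean_curvature M p) (mean_curvature M p)"
proof -
  obtain h where h: "smooth_on (ball 0 r) h" "\<And>x. x \<in> ball 0 r \<Longrightarrow> mean_curvature M (Y x) = h x"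
    using mean_curvature_smooth by blast
  have "((\<lambda>x. pinner (h x) (h x)) has_derivative (\<lambda>v. 0)) (at x within ball 0 r)" if x: "x \<in> ball 0 r" for x
  proof -
    have "((\<lambda>x. pinner (h x) (h x)) has_derivative (\<lambda>v. pinner (h x) (dird v h x) + pinner (dird v h x) (h x))) (at x)"
      using bounded_bilinear.FDERIV[OF bounded_bilinear_pinner smooth_on_has_derivative[OF h(1) x] smooth_on_has_derivative[OF h(1) x]] .
    moreover have "pinner (dird v h x) (h x) = 0" for v
      using parallel_dird_mean_curvature[OF par h x] mean_curvature_normal[OF spacelike Y_in(1)[OF x]]
      unfolding h(2)[OF x] pperp_def by blast
    ultimately show ?thesis by (simp add: pinner_commute has_derivative_at_withinI)
  qed
  then obtain c where c: "\<And>x. x \<in> ball 0 r \<Longrightarrow> pinner (h x) (h x) = c"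
    using has_derivative_zero_constant[of "ball 0 r" "\<lambda>x. pinner (h x) (h x)"] by auto
  have "mean_curvature M q = h (coord q)" "mean_curvature M p = h 0"
    using h(2)[of "coord q"] h(2)[of 0] Y_coord[OF q] Y_0 r by auto
  then show ?thesis using c[OF Y_coord(2)[OF q]] c[OF open_ball_0(2)] by simp
qed

text \<open>
  The normal components of the derivative of the mean curvature at the centre.  The projection terms
  are products of two factors that vanish at the centre, and the inverse metric is stationary there,
  so only the derivative of the plain trace survives.
\<close>

theorem parallel_dird_trace_hessian:
  assumes par: "parallel_mean_curvature M"
  shows "dird v (trace_hessian s) 0 = 0"
proof -
  obtain G E where G: "is_inverse_metric G" and E: "\<And>k::'m. smooth_on (ball 0 r) (E k)"
    "\<And>x k. x \<in> ball 0 r \<Longrightarrow> E k x \<in> tangent_space M (Y x)"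
    and H: "\<And>x. x \<in> ball 0 r \<Longrightarrow> real CARD('m) *\<^sub>R mean_curvature M (Y x) =
        second_trace G x - (\<Sum>k\<in>UNIV. pinner (second_trace G x) (E k x) *\<^sub>R E k x)"
    using mean_curvature_in_chart by blast
  note o = open_ball_0(2)
  obtain h where h: "smooth_on (ball 0 r) h" "\<And>x. x \<in> ball 0 r \<Longrightarrow> mean_curvature M (Y x) = h x"
    using mean_curvature_smooth by blast
  define W where "W = second_trace G"
  have Wsm: "smooth_on (ball 0 r) W" unfolding W_def by (rule second_trace_smooth[OF G])
  have Wn: "pinner (W x) (\<nu> s) = - weighted_hessian G s x" if "x \<in> ball 0 r" for x
    unfolding W_def by (rule pinner_second_trace[OF G that])
  have W0: "pinner (W 0) (E k 0) = 0" for k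
  proof -
    have "pinner (W 0) (e i) = 0" for i unfolding W_def by (rule pinner_second_trace[OF G o])
    then have "W 0 \<in> pperp (tangent_space M p)" using adapted_to_mem_pperp[OF ad_to] by blast
    moreover have "E k 0 \<in> tangent_space M p" using E(2)[OF o] by (simp add: Y_0)
    ultimately show ?thesis by (auto simp: pperp_def pinner_commute)
  qed
  have E0: "pinner (E k 0) (\<nu> s) = 0" for k
    using E(2)[OF o] adapted_to_mem[OF ad_to] by (simp add: Y_0)
  have eq: "pinner (h x) (\<nu> s) * real CARD('m) = - weighted_hessian G s x + (\<Sum>k\<in>UNIV. (- pinner (W x) (E k x)) * pinner (E k x) (\<nu> s))"
    if x: "x \<in> ball 0 r" for x
  proof -
    have "pinner (real CARD('m) *\<^sub>R h x) (\<nu> s) = pinner (W x - (\<Sum>k\<in>UNIV. pinner (W x) (E k x) *\<^sub>R E k x)) (\<nu> s)"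
      using H[OF x] unfolding W_def[symmetric] h(2)[OF x] by (rule arg_cong)
    also have "\<dots> = - weighted_hessian G s x - (\<Sum>k\<in>UNIV. pinner (W x) (E k x) * pinner (E k x) (\<nu> s))"
      unfolding pinner_simps Wn[OF x] by simp
    finally show ?thesis by (simp add: pinner_simps sum_negf mult.commute)
  qed
  have smP: "smooth_on (ball 0 r) (\<lambda>x. - pinner (W x) (E k x))" "smooth_on (ball 0 r) (\<lambda>x. pinner (E k x) (\<nu> s))" for k
    by (intro smooth_on_minus smooth_on_pinner Wsm E(1) smooth_on_const open_ball)+
  have d0: "dird v (\<lambda>x. \<Sum>k\<in>UNIV. (- pinner (W x) (E k x)) * pinner (E k x) (\<nu> s)) 0 = 0"
  proof -
    have "dird v (\<lambda>x. \<Sum>k\<in>UNIV. (- pinner (W x) (E k x)) * pinner (E k x) (\<nu> s)) 0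
      = (\<Sum>k\<in>UNIV. dird v (\<lambda>x. (- pinner (W x) (E k x)) * pinner (E k x) (\<nu> s)) 0)"
      by (rule dird_sum) (rule smooth_on_differentiable[OF smooth_on_mult[OF open_ball smP] o])
    also have "\<dots> = 0"
      by (rule sum.neutral) (simp only: dird_mult[OF smooth_on_differentiable[OF smP(1) o] smooth_on_differentiable[OF smP(2) o]] W0 E0; simp)
    finally show ?thesis .
  qed
  have "dird v (\<lambda>x. pinner (h x) (\<nu> s) * real CARD('m)) 0 =
     dird v (\<lambda>x. - weighted_hessian G s x + (\<Sum>k\<in>UNIV. (- pinner (W x) (E k x)) * pinner (E k x) (\<nu> s))) 0"
    by (rule dird_cong_open[OF open_ball_0 eq])
  also have "\<dots> = dird v (\<lambda>x. - weighted_hessian G s x) 0 + 0"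
    unfolding d0[symmetric]
    by (rule dird_add) (rule smooth_on_differentiable[OF _ o],
        intro smooth_on_minus weighted_hessian_smooth[OF G] smooth_on_sum smooth_on_mult smP open_ball)+
  also have "dird v (\<lambda>x. - weighted_hessian G s x) 0 = - dird v (weighted_hessian G s) 0"
    by (rule dird_eqI[of _ "\<lambda>v. - dird v (weighted_hessian G s) 0"]) (intro has_derivative_minus smooth_on_has_derivative[OF weighted_hessian_smooth[OF G] o])
  finally have A: "dird v (\<lambda>x. pinner (h x) (\<nu> s) * real CARD('m)) 0 = - dird v (trace_hessian s) 0"
    by (simp add: dird_weighted_hessian_0[OF G])
  have bl: "bounded_linear (\<lambda>w. pinner w (\<nu> s) * real CARD('m))"
    by (rule bounded_linear_mult_const[OF bounded_bilinear.bounded_linear_left[OF bounded_bilinear_pinner]])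
  have "dird v (\<lambda>x. pinner (h x) (\<nu> s) * real CARD('m)) 0 = pinner (dird v h 0) (\<nu> s) * real CARD('m)"
    by (rule dird_linear_compose[OF bl smooth_on_differentiable[OF h(1) o]])
  also have "pinner (dird v h 0) (\<nu> s) = 0"
    using parallel_dird_mean_curvature[OF par h o, of v] adapted_to_mem[OF ad_to] by (simp add: Y_0)
  finally show ?thesis using A by simp
qed

text \<open>
  For vanishing mean curvature the metric trace of the Hessian of \<open>f\<close> is identically zero.  Its second
  derivative at the centre relates the plain trace to the second derivatives of the inverse metric,
  which are those of \<open>slope_gram\<close>.
\<close>

theorem maximal_dird_dird_trace_hessian:
  assumes H0: "\<And>q. q \<in> M \<Longrightarrow> mean_curvature M q = 0"
  shows "dird w (dird v (trace_hessian s)) 0 =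
    - (\<Sum>a\<in>UNIV. \<Sum>b\<in>UNIV. dird w (dird v (slope_gram a b)) 0 * pd b (pd a (f s)) 0)"
proof -
  obtain G E where G: "is_inverse_metric G" and E: "\<And>k::'m. smooth_on (ball 0 r) (E k)"
    "\<And>x k. x \<in> ball 0 r \<Longrightarrow> E k x \<in> tangent_space M (Y x)"
    and H: "\<And>x. x \<in> ball 0 r \<Longrightarrow> real CARD('m) *\<^sub>R mean_curvature M (Y x) =
        second_trace G x - (\<Sum>k\<in>UNIV. pinner (second_trace G x) (E k x) *\<^sub>R E k x)"
    using mean_curvature_in_chart by blast
  have z: "weighted_hessian G s x = 0" if x: "x \<in> ball 0 r" for x
  proof -
    define W where "W = second_trace G x"
    have "W = (\<Sum>k\<in>UNIV. pinner W (E k x) *\<^sub>R E k x)"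
      using H[OF x] unfolding H0[OF Y_in(1)[OF x]] W_def by simp
    moreover have "(\<Sum>k\<in>UNIV. pinner W (E k x) *\<^sub>R E k x) \<in> tangent_space M (Y x)"
      by (intro subspace_sum subspace_scale tangent_space_props[OF Y_in(1)[OF x]] E(2)[OF x])
    ultimately have WT: "W \<in> tangent_space M (Y x)" by simp
    have "pinner W (e i) = 0" for i unfolding W_def by (rule pinner_second_trace[OF G x])
    then have "(\<chi> i. pinner W (e i)) = 0" by (simp add: vec_eq_iff)
    with tangent_expand[OF x WT] have "W = dird 0 Y x" by simp
    then have "W = 0" using linear_0[OF linear_dird_Y[OF x]] by simp
    moreover have "pinner W (\<nu> s) = - weighted_hessian G s x"
      unfolding W_def by (rule pinner_second_trace[OF G x])
    ultimately show ?thesis by (simp add: pinner_simps)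
  qed
  have "dird w (dird v (weighted_hessian G s)) 0 = dird w (dird v (\<lambda>x. 0)) 0"
    by (rule dird_cong_open[OF open_ball_0], rule dird_cong_open[OF open_ball _ z])
  also have "\<dots> = 0" by (simp add: dird_const[abs_def] dird_def)
  finally show "dird w (dird v (trace_hessian s)) 0 =
    - (\<Sum>a\<in>UNIV. \<Sum>b\<in>UNIV. dird w (dird v (slope_gram a b)) 0 * pd b (pd a (f s)) 0)"
    unfolding dird_dird_weighted_hessian_0[OF G] by simp

qed

end

lemma parallel_length_constant:
  assumes M: "spacelike_submanifold M" "connected M" "parallel_mean_curvature M" and pq: "p \<in> M" "q \<in> M"
  shows "pinner (mean_curvature M p) (mean_curvature M p) = pinner (mean_curvature M q) (mean_curvature M q)"
proof (rule connected_local_const[OF M(2) pq], intro ballI)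
  fix a assume a: "a \<in> M"
  obtain e \<nu> r f U where "gauge_chart M a e \<nu> r f U" using gauge_chart_exists[OF M(1) a] by blast
  then interpret gauge_chart M a e \<nu> r f U .
  show "\<forall>\<^sub>F b in at a within M. pinner (mean_curvature M a) (mean_curvature M a) = pinner (mean_curvature M b) (mean_curvature M b)"
    unfolding eventually_at_topological
    using U p_in(2) parallel_length_locally_constant[OF M(3)] by (intro exI[of _ U]) auto
qed

section \<open>Comparison of charts\<close>

lemma linear_vec_inner:
  fixes h :: "real ^ 'm::finite \<Rightarrow> real"
  assumes "linear h"
  shows "h v = (\<chi> a. h (axis a 1)) \<bullet> v"
proof -
  have "h v = h (\<Sum>a\<in>UNIV. (v $ a) *\<^sub>R axis a 1)" using vec_eq_sum_axis[of v] by simp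
  also have "\<dots> = (\<Sum>a\<in>UNIV. (v $ a) *\<^sub>R h (axis a 1))"
    by (simp add: linear_sum[OF assms] linear_cmul[OF assms])
  finally show ?thesis by (simp add: inner_vec_def mult.commute)
qed

lemma norm_sq_eq_sum_Basis: "(norm (v :: 'a::euclidean_space))\<^sup>2 = (\<Sum>b\<in>Basis. (v \<bullet> b)\<^sup>2)"
  unfolding power2_norm_eq_inner by (subst euclidean_inner) (simp add: power2_eq_square)

context gauge_chart
begin

text \<open>
  The Euclidean size of an orthonormal frame of the tangent space at \<open>p\<close>: the trace of the tangential
  projection against the Euclidean metric, a convex function on the space of planes.
\<close>

definition frame_energy :: real where
  "frame_energy = (\<Sum>i\<in>UNIV. (norm (e i))\<^sup>2)"

text \<open>
  The squared norm of the second fundamental form at \<open>p\<close>, with the sign that makes it nonnegative.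
\<close>

definition curvature_energy :: real where
  "curvature_energy = (\<Sum>i\<in>UNIV. \<Sum>j\<in>UNIV. \<Sum>s\<in>UNIV. (pd i (pd j (f s)) 0)\<^sup>2)"

definition slope_sq :: "real ^ 'm \<Rightarrow> real" where
  "slope_sq x = (\<Sum>s\<in>UNIV. \<Sum>a\<in>UNIV. (pd a (f s) x)\<^sup>2)"

definition slope :: "'n \<Rightarrow> real ^ 'm \<Rightarrow> real ^ 'm" where
  "slope s x = (\<chi> a. pd a (f s) x)"

lemma dird_f_slope: "x \<in> ball 0 r \<Longrightarrow> dird v (f s) x = v \<bullet> slope s x"
  by (subst dird_expand[OF f_smooth]) (simp_all add: slope_def inner_vec_def)

lemma linear_dird_f: "x \<in> ball 0 r \<Longrightarrow> linear (\<lambda>v. dird v (f s) x)"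
  by (rule smooth_on_linear_dird[OF f_smooth])

text \<open>
  The sum on the right is the squared norm of the functional \<open>h\<close> in the inverse metric.  The bound is
  \<open>(1 - A)\<^sup>-\<^sup>1 \<ge> 1 + A\<close>: expand the square of the difference between the values of \<open>h\<close> on the frame
  and the metric components of the vector dual to \<open>h\<close> in the standard inner product.
\<close>

lemma test_lower:
  fixes h :: "real ^ 'm \<Rightarrow> real"
  assumes x: "x \<in> ball 0 r" and on: "metric_orthonormal x \<theta>" and h: "linear h"
  shows "(\<Sum>a\<in>UNIV. (h (axis a 1))\<^sup>2) + (\<Sum>s\<in>UNIV. (h (slope s x))\<^sup>2) \<le> (\<Sum>i\<in>UNIV. (h (\<theta> i))\<^sup>2)"
proof -
  define c :: "real ^ 'm" where "c = (\<chi> a. h (axis a 1))"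
  have hc: "h v = c \<bullet> v" for v unfolding c_def by (rule linear_vec_inner[OF h])
  define k where "k i = metric x c (\<theta> i)" for i
  have ce: "c = (\<Sum>i\<in>UNIV. k i *\<^sub>R \<theta> i)" unfolding k_def by (rule metric_expand[OF x on])
  have cc: "c \<bullet> c = (\<Sum>i\<in>UNIV. k i * (c \<bullet> \<theta> i))"
    by (subst (2) ce) (simp add: inner_sum_right)
  have ks: "metric x (\<theta> i) c = k i" for i
    by (simp add: k_def metric_def inner_commute mult.commute)
  have "metric x c c = metric x (\<Sum>i\<in>UNIV. k i *\<^sub>R \<theta> i) c" using ce by simp
  then have kk: "metric x c c = (\<Sum>i\<in>UNIV. (k i)\<^sup>2)"
    by (simp add: linear_sum[OF linear_metric[OF x]] linear_cmul[OF linear_metric[OF x]] ks power2_eq_square)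
  have "0 \<le> (\<Sum>i\<in>UNIV. (c \<bullet> \<theta> i - k i)\<^sup>2)" by (intro sum_nonneg) simp
  also have "\<dots> = (\<Sum>i\<in>UNIV. (c \<bullet> \<theta> i)\<^sup>2) - 2 * (c \<bullet> c) + metric x c c"
    unfolding kk cc by (simp add: power2_diff sum.distrib sum_subtractf sum_distrib_left mult_ac)
  also have "metric x c c = c \<bullet> c - (\<Sum>s\<in>UNIV. (c \<bullet> slope s x)\<^sup>2)"
    unfolding metric_def dird_f_slope[OF x] by (simp add: power2_eq_square)
  finally have "c \<bullet> c + (\<Sum>s\<in>UNIV. (c \<bullet> slope s x)\<^sup>2) \<le> (\<Sum>i\<in>UNIV. (c \<bullet> \<theta> i)\<^sup>2)" by simp
  moreover have "c \<bullet> c = (\<Sum>a\<in>UNIV. (h (axis a 1))\<^sup>2)"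
    by (simp add: c_def inner_vec_def power2_eq_square)
  ultimately show ?thesis by (simp add: hc)
qed

text \<open>
  The metric is at least \<open>1 - slope_sq x\<close> times the standard one, so its inverse is at most the
  reciprocal multiple.
\<close>

lemma test_upper:
  fixes h :: "real ^ 'm \<Rightarrow> real"
  assumes x: "x \<in> ball 0 r" and on: "metric_orthonormal x \<theta>" and h: "linear h" and \<rho>: "slope_sq x < 1"
  shows "(1 - slope_sq x) * (\<Sum>i\<in>UNIV. (h (\<theta> i))\<^sup>2) \<le> (\<Sum>a\<in>UNIV. (h (axis a 1))\<^sup>2)"
proof -
  define c :: "real ^ 'm" where "c = (\<chi> a. h (axis a 1))"
  have hc: "h v = c \<bullet> v" for v unfolding c_def by (rule linear_vec_inner[OF h])
  have c2: "c \<bullet> c = (\<Sum>a\<in>UNIV. (h (axis a 1))\<^sup>2)"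
    by (simp add: c_def inner_vec_def power2_eq_square)
  define w where "w = (\<Sum>i\<in>UNIV. (c \<bullet> \<theta> i) *\<^sub>R \<theta> i)"
  define S where "S = (\<Sum>i\<in>UNIV. (c \<bullet> \<theta> i)\<^sup>2)"
  have cw: "c \<bullet> w = S" unfolding w_def S_def by (simp add: inner_sum_right power2_eq_square)
  have mt: "metric x w (\<theta> j) = c \<bullet> \<theta> j" for j
    using on unfolding w_def
    by (simp add: linear_sum[OF linear_metric[OF x]] linear_cmul[OF linear_metric[OF x]] metric_orthonormal_def if_times_delta)
  have ms: "metric x (\<theta> i) w = c \<bullet> \<theta> i" for i
    using mt[of i] by (simp add: metric_def inner_commute mult.commute)
  have "metric x w w = metric x (\<Sum>i\<in>UNIV. (c \<bullet> \<theta> i) *\<^sub>R \<theta> i) w" unfolding w_def[symmetric] ..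
  then have ww: "metric x w w = S"
    by (simp add: linear_sum[OF linear_metric[OF x]] linear_cmul[OF linear_metric[OF x]] ms S_def power2_eq_square)
  have "(\<Sum>s\<in>UNIV. (dird w (f s) x)\<^sup>2) \<le> (\<Sum>s\<in>UNIV. (\<Sum>a\<in>UNIV. (pd a (f s) x)\<^sup>2) * (w \<bullet> w))"
  proof (rule sum_mono)
    fix s
    have "(dird w (f s) x)\<^sup>2 \<le> (w \<bullet> w) * (slope s x \<bullet> slope s x)"
      unfolding dird_f_slope[OF x] by (rule Cauchy_Schwarz_ineq)
    then show "(dird w (f s) x)\<^sup>2 \<le> (\<Sum>a\<in>UNIV. (pd a (f s) x)\<^sup>2) * (w \<bullet> w)"
      by (simp add: slope_def inner_vec_def[of "slope s x"] inner_vec_def[of "vec_lambda _"] power2_eq_square mult.commute)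
  qed
  then have 1: "(1 - slope_sq x) * (w \<bullet> w) \<le> S"
    unfolding ww[symmetric] metric_def slope_sq_def by (simp add: power2_eq_square algebra_simps sum_distrib_right sum_distrib_left)
  have "S * S \<le> (c \<bullet> c) * (w \<bullet> w)" using Cauchy_Schwarz_ineq[of c w] unfolding cw by (simp add: power2_eq_square)
  then have "(1 - slope_sq x) * (S * S) \<le> (c \<bullet> c) * ((1 - slope_sq x) * (w \<bullet> w))"
    using \<rho> by (metis (no_types, opaque_lifting) diff_ge_0_iff_ge less_imp_le mult.left_commute mult_left_mono)
  also have "\<dots> \<le> (c \<bullet> c) * S" using 1 by (intro mult_left_mono) auto
  finally have 2: "((1 - slope_sq x) * S) * S \<le> (c \<bullet> c) * S" by (simp add: mult.assoc)
  have "S \<ge> 0" unfolding S_def by (intro sum_nonneg) simp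
  then have "(1 - slope_sq x) * S \<le> c \<bullet> c"
    using 2 by (cases "S = 0") (auto intro: mult_right_le_imp_le)
  then show ?thesis unfolding S_def c2 by (simp only: hc)
qed

lemma bilinear_hessian:
  assumes x: "x \<in> ball 0 r"
  shows "linear (\<lambda>v. dird v (dird w (f s)) x)" "linear (\<lambda>w. dird v (dird w (f s)) x)"
proof -
  show *: "linear (\<lambda>v. dird v (dird w (f s)) x)" for w
    by (rule smooth_on_linear_dird[OF smooth_on_dird[OF f_smooth] x])
  have "dird v (dird w (f s)) x = dird w (dird v (f s)) x" for w
    by (rule dird_commute[OF open_ball x f_smooth])
  then show "linear (\<lambda>w. dird v (dird w (f s)) x)" using *[of v] by simp
qed

lemma test_lower_bilinear:
  assumes x: "x \<in> ball 0 r" and on: "metric_orthonormal x \<theta>"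
    and B: "\<And>w. linear (\<lambda>v. B v w)" "\<And>v. linear (\<lambda>w. B v w)" and sym: "\<And>v w. B v w = B w v"
  shows "(\<Sum>a\<in>UNIV. \<Sum>b\<in>UNIV. (B (axis a 1) (axis b 1))\<^sup>2) + 2 * (\<Sum>a\<in>UNIV. \<Sum>s\<in>UNIV. (B (axis a 1) (slope s x))\<^sup>2)
    \<le> (\<Sum>i\<in>UNIV. \<Sum>j\<in>UNIV. ((B (\<theta> i) (\<theta> j))::real)\<^sup>2)"
proof -
  have 0: "(\<Sum>a\<in>UNIV. (B v (axis a 1))\<^sup>2) + (\<Sum>s\<in>UNIV. (B v (slope s x))\<^sup>2) \<le> (\<Sum>j\<in>UNIV. (B v (\<theta> j))\<^sup>2)" for v
    by (rule test_lower[OF x on B(2)])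
  have 1: "(\<Sum>b\<in>UNIV. (B v (axis b 1))\<^sup>2) \<le> (\<Sum>j\<in>UNIV. (B v (\<theta> j))\<^sup>2)" for v
    using 0[of v] sum_nonneg[of UNIV "\<lambda>s. (B v (slope s x))\<^sup>2"] by simp
  have 2: "(\<Sum>a\<in>UNIV. (B (axis a 1) w)\<^sup>2) + (\<Sum>s\<in>UNIV. (B (slope s x) w)\<^sup>2) \<le> (\<Sum>i\<in>UNIV. (B (\<theta> i) w)\<^sup>2)" for w
    by (rule test_lower[OF x on B(1)])
  have "(\<Sum>i\<in>UNIV. \<Sum>j\<in>UNIV. (B (\<theta> i) (\<theta> j))\<^sup>2) = (\<Sum>j\<in>UNIV. \<Sum>i\<in>UNIV. (B (\<theta> i) (\<theta> j))\<^sup>2)" by (rule sum.swap)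
  also have "\<dots> \<ge> (\<Sum>j\<in>UNIV. (\<Sum>a\<in>UNIV. (B (axis a 1) (\<theta> j))\<^sup>2) + (\<Sum>s\<in>UNIV. (B (slope s x) (\<theta> j))\<^sup>2))"
    by (intro sum_mono 2)
  moreover have "(\<Sum>j\<in>UNIV. (\<Sum>a\<in>UNIV. (B (axis a 1) (\<theta> j))\<^sup>2) + (\<Sum>s\<in>UNIV. (B (slope s x) (\<theta> j))\<^sup>2))
    = (\<Sum>a\<in>UNIV. \<Sum>j\<in>UNIV. (B (axis a 1) (\<theta> j))\<^sup>2) + (\<Sum>s\<in>UNIV. \<Sum>j\<in>UNIV. (B (slope s x) (\<theta> j))\<^sup>2)"
    unfolding sum.distrib by (intro arg_cong2[of _ _ _ _ "(+)"] sum.swap)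
  moreover have "\<dots> \<ge> (\<Sum>a\<in>UNIV. (\<Sum>b\<in>UNIV. (B (axis a 1) (axis b 1))\<^sup>2) + (\<Sum>s\<in>UNIV. (B (axis a 1) (slope s x))\<^sup>2))
     + (\<Sum>s\<in>UNIV. \<Sum>b\<in>UNIV. (B (slope s x) (axis b 1))\<^sup>2)"
    by (intro add_mono sum_mono 0 1)
  moreover have "(\<Sum>s\<in>UNIV. \<Sum>b\<in>UNIV. (B (slope s x) (axis b 1))\<^sup>2) = (\<Sum>a\<in>UNIV. \<Sum>s\<in>UNIV. (B (axis a 1) (slope s x))\<^sup>2)"
    by (subst sum.swap) (simp add: sym)
  ultimately show ?thesis by (simp add: sum.distrib)
qed

lemma test_upper_bilinear:
  assumes x: "x \<in> ball 0 r" and on: "metric_orthonormal x \<theta>" and \<rho>: "slope_sq x < 1"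
    and B: "\<And>w. linear (\<lambda>v. B v w)" "\<And>v. linear (\<lambda>w. B v w)"
  shows "(1 - slope_sq x)\<^sup>2 * (\<Sum>i\<in>UNIV. \<Sum>j\<in>UNIV. ((B (\<theta> i) (\<theta> j))::real)\<^sup>2)
    \<le> (\<Sum>a\<in>UNIV. \<Sum>b\<in>UNIV. (B (axis a 1) (axis b 1))\<^sup>2)"
proof -
  have "(1 - slope_sq x)\<^sup>2 * (\<Sum>i\<in>UNIV. \<Sum>j\<in>UNIV. (B (\<theta> i) (\<theta> j))\<^sup>2)
     = (1 - slope_sq x) * (\<Sum>i\<in>UNIV. (1 - slope_sq x) * (\<Sum>j\<in>UNIV. (B (\<theta> i) (\<theta> j))\<^sup>2))"
    by (simp add: power2_eq_square sum_distrib_left mult.assoc)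
  also have "\<dots> \<le> (1 - slope_sq x) * (\<Sum>i\<in>UNIV. \<Sum>b\<in>UNIV. (B (\<theta> i) (axis b 1))\<^sup>2)"
    using \<rho> by (intro mult_left_mono sum_mono test_upper[OF x on B(2) \<rho>]) auto
  also have "\<dots> = (\<Sum>b\<in>UNIV. (1 - slope_sq x) * (\<Sum>i\<in>UNIV. (B (\<theta> i) (axis b 1))\<^sup>2))"
    by (subst sum.swap) (simp add: sum_distrib_left)
  also have "\<dots> \<le> (\<Sum>b\<in>UNIV. \<Sum>a\<in>UNIV. (B (axis a 1) (axis b 1))\<^sup>2)"
    by (intro sum_mono test_upper[OF x on B(1) \<rho>])
  also have "\<dots> = (\<Sum>a\<in>UNIV. \<Sum>b\<in>UNIV. (B (axis a 1) (axis b 1))\<^sup>2)" by (rule sum.swap)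
  finally show ?thesis .
qed

text \<open>
  How the data at the centre of the chart at \<open>Y x\<close> look in the present chart.  The second derivatives of
  the two parametrizations differ by tangent vectors; the Hessian of \<open>f'\<close> is therefore the normal part
  of that of \<open>f\<close>, and removing the tangential components, on which the pseudo inner product is
  positive, adds their squares to the length.
\<close>

lemma chart_transition:
  assumes x: "x \<in> ball 0 r" and Q: "gauge_chart M (Y x) e' \<nu>' r' f' U'"
  shows "\<exists>\<theta>. metric_orthonormal x \<theta> \<and> (\<forall>i. e' i = dird (\<theta> i) Y x) \<and>
    (\<forall>i j. (\<Sum>s\<in>UNIV. (pd i (pd j (f' s)) 0)\<^sup>2) =
      (\<Sum>s\<in>UNIV. (dird (\<theta> i) (dird (\<theta> j) (f s)) x)\<^sup>2) +
      (\<Sum>k\<in>UNIV. (\<Sum>s\<in>UNIV. dird (\<theta> i) (dird (\<theta> j) (f s)) x * dird (\<theta> k) (f s) x)\<^sup>2))"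
proof -
  interpret Q: gauge_chart M "Y x" e' \<nu>' r' f' U' by (rule Q)
  define \<theta> where "\<theta> i = (\<chi> a. pinner (e' i) (e a))" for i
  have eT: "e' i \<in> tangent_space M (Y x)" for i using Q.ad_to by (simp add: adapted_to_def)
  have e\<theta>: "e' i = dird (\<theta> i) Y x" for i unfolding \<theta>_def by (rule tangent_expand[OF x eT])
  have on: "metric_orthonormal x \<theta>"
    unfolding metric_orthonormal_def metric_eq[OF x] e\<theta>[symmetric] by (simp add: Q.ad_simps)
  define N where "N = ball 0 r' \<inter> Q.Y -` U"
  have opN: "open N" unfolding N_def
    by (rule continuous_open_preimage[OF smooth_on_continuous_on[OF Q.Y_smooth] open_ball U])
  have N0: "0 \<in> N" using Q.open_ball_0(2) Y_in(2)[OF x] by (simp add: N_def Q.Y_0)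
  define t where "t z = coord (Q.Y z)" for z
  have Nin: "z \<in> ball 0 r'" "Q.Y z \<in> M" "Q.Y z \<in> U" if "z \<in> N" for z
    using that Q.Y_in(1) by (auto simp: N_def)
  have t: "Y (t z) = Q.Y z" "t z \<in> ball 0 r" if "z \<in> N" for z
    unfolding t_def using Y_coord Nin[OF that] by blast+
  have t0: "t 0 = x" by (simp add: t_def Q.Y_0 coord_Y)
  have tsm: "smooth_on N t" unfolding t_def[abs_def]
    by (rule smooth_on_compose[OF opN open_UNIV _ smooth_on_subset[OF Q.Y_smooth] coord_smooth]) (auto simp: N_def)
  have tcs: "smooth_on N (\<lambda>z. dird v t z $ a)" for v a
    by (rule smooth_on_vec_nth[OF opN smooth_on_dird[OF tsm]])
  have chain: "((\<lambda>z. F (t z)) has_derivative (\<lambda>v. dird (dird v t z) F (t z))) (at z)"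
    if "smooth_on (ball 0 r) F" "z \<in> N" for F :: "real ^ 'm \<Rightarrow> ('m, 'n) pseudo" and z
    using diff_chain_at[OF smooth_on_has_derivative[OF tsm that(2)] smooth_on_has_derivative[OF that(1) t(2)[OF that(2)]]]
    by (simp add: o_def)
  have dQ: "dird v Q.Y z = (\<Sum>a\<in>UNIV. (dird v t z $ a) *\<^sub>R pd a Y (t z))" if z: "z \<in> N" for v z
  proof -
    have "dird v Q.Y z = dird v (\<lambda>z. Y (t z)) z"
      by (rule dird_cong_open[OF opN z]) (simp add: t)
    also have "\<dots> = dird (dird v t z) Y (t z)" by (rule dird_eqI[OF chain[OF Y_smooth z]])
    also have "\<dots> = (\<Sum>a\<in>UNIV. (dird v t z $ a) *\<^sub>R pd a Y (t z))"
      by (rule dird_expand[OF Y_smooth t(2)[OF z]])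
    finally show ?thesis .
  qed
  have t\<theta>: "pd i t 0 = \<theta> i" for i
  proof -
    have "e' i = dird (pd i t 0) Y x"
      using dQ[OF N0, of "axis i 1"] dird_expand[OF Y_smooth x, of "pd i t 0"]
      unfolding Q.dird_axis_Y_0 t0 by simp
    then have "pinner (e' i) (e a) = pd i t 0 $ a" for a
      using pinner_dird_Y(1)[OF x] by metis
    then show ?thesis by (simp add: \<theta>_def vec_eq_iff)
  qed
  have "(\<Sum>s\<in>UNIV. (pd i (pd j (f' s)) 0)\<^sup>2) =
      (\<Sum>s\<in>UNIV. (dird (\<theta> i) (dird (\<theta> j) (f s)) x)\<^sup>2) +
      (\<Sum>k\<in>UNIV. (\<Sum>s\<in>UNIV. dird (\<theta> i) (dird (\<theta> j) (f s)) x * dird (\<theta> k) (f s) x)\<^sup>2)" for i j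
  proof -
    define w where "w = (\<Sum>a\<in>UNIV. (\<theta> j $ a) *\<^sub>R dird (\<theta> i) (pd a Y) x)"
    define u where "u = (\<Sum>a\<in>UNIV. (pd i (\<lambda>z. pd j t z $ a) 0) *\<^sub>R pd a Y x)"
    define n where "n = pd i (pd j Q.Y) 0"
    have "((\<lambda>z. \<Sum>a\<in>UNIV. (pd j t z $ a) *\<^sub>R pd a Y (t z)) has_derivative
       (\<lambda>v. \<Sum>a\<in>UNIV. (pd j t 0 $ a) *\<^sub>R dird (dird v t 0) (pd a Y) (t 0)
          + dird v (\<lambda>z. pd j t z $ a) 0 *\<^sub>R pd a Y (t 0))) (at 0)"
      by (intro has_derivative_sum bounded_bilinear.FDERIV[OF bounded_bilinear_scaleR]
          smooth_on_has_derivative[OF tcs N0] chain[OF smooth_on_dird[OF Y_smooth] N0])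
    then have "(pd j Q.Y has_derivative
       (\<lambda>v. \<Sum>a\<in>UNIV. (pd j t 0 $ a) *\<^sub>R dird (dird v t 0) (pd a Y) (t 0)
          + dird v (\<lambda>z. pd j t z $ a) 0 *\<^sub>R pd a Y (t 0))) (at 0)"
      by (rule has_derivative_transform_within_open[OF _ opN N0]) (simp add: dQ)
    from dird_eqI[OF this, of "axis i 1"] have nwu: "n = w + u"
      unfolding n_def w_def u_def t\<theta> t0 by (simp add: sum.distrib)
    have uT: "u \<in> tangent_space M (Y x)"
      unfolding u_def by (intro subspace_sum subspace_scale tangent_space_props[OF Y_in(1)[OF x]] dird_Y_tangent[OF x])
    have n1: "pinner n (e' k) = 0" "pinner n (\<nu>' s) = - pd i (pd j (f' s)) 0" for k s
      unfolding n_def using Q.pinner_dird_dird_Y[OF Q.open_ball_0(2)] by auto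
    have we: "pinner w (e a) = 0" for a
      unfolding w_def pinner_simps pinner_dird_dird_Y[OF x] by simp
    have wn: "pinner w (\<nu> s) = - dird (\<theta> i) (dird (\<theta> j) (f s)) x" for s
    proof -
      have l: "linear (\<lambda>w. dird (\<theta> i) (dird w (f s)) x)" by (rule bilinear_hessian[OF x])
      have "dird (\<theta> i) (dird (\<theta> j) (f s)) x = dird (\<theta> i) (dird (\<Sum>a\<in>UNIV. (\<theta> j $ a) *\<^sub>R axis a 1) (f s)) x"
        using vec_eq_sum_axis[of "\<theta> j"] by simp
      also have "\<dots> = (\<Sum>a\<in>UNIV. \<theta> j $ a * dird (\<theta> i) (pd a (f s)) x)"
        by (simp add: linear_sum[OF l] linear_cmul[OF l])
      finally show ?thesis
        unfolding w_def pinner_simps pinner_dird_dird_Y[OF x] by (simp add: sum_negf)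
    qed
    have ww: "pinner w w = - (\<Sum>s\<in>UNIV. (dird (\<theta> i) (dird (\<theta> j) (f s)) x)\<^sup>2)"
      using adapted_pinner[OF ad, of w w] by (simp add: we wn power2_eq_square)
    have wek: "pinner w (e' k) = - (\<Sum>s\<in>UNIV. dird (\<theta> i) (dird (\<theta> j) (f s)) x * dird (\<theta> k) (f s) x)" for k
      using adapted_pinner[OF ad, of w "e' k"] by (simp add: we wn e\<theta>[of k] pinner_dird_Y[OF x])
    have uk: "pinner u (e' k) = - pinner w (e' k)" for k
      using n1(1)[of k] by (simp add: nwu pinner_simps)
    have un: "pinner u (\<nu>' s) = 0" for s using uT adapted_to_mem[OF Q.ad_to] by blast
    have uu: "pinner u u = (\<Sum>k\<in>UNIV. (pinner w (e' k))\<^sup>2)"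
      using adapted_pinner[OF Q.ad, of u u] by (simp add: un uk power2_eq_square)
    have nn: "pinner n n = - (\<Sum>s\<in>UNIV. (pd i (pd j (f' s)) 0)\<^sup>2)"
      using adapted_pinner[OF Q.ad, of n n] by (simp add: n1 power2_eq_square)
    have nu: "pinner n u = 0"
      using adapted_pinner[OF Q.ad, of n u] by (simp add: n1 un)
    \<comment> \<open>Pythagoras for the normal part \<open>n\<close> and the tangential part \<open>- u\<close> of \<open>w\<close>.\<close>
    have "w = n - u" by (simp add: nwu)
    then have "pinner w w = pinner n n + pinner u u"
      using nu by (simp add: pinner_simps pinner_commute)
    then show ?thesis unfolding ww nn uu wek by simp
  qed
  with on e\<theta> show ?thesis by blast
qed

text \<open>
  A smooth lower barrier for the frame energy along the chart, touching it at the centre.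
\<close>

definition energy_lower :: "real ^ 'm \<Rightarrow> real" where
  "energy_lower x = (\<Sum>a\<in>UNIV. pd a Y x \<bullet> pd a Y x)"

text \<open>
  The Euclidean norm is a sum of squares of functionals, to each of which the two bounds apply.  The
  upper bound gives upper semicontinuity at the centre.
\<close>

lemma frame_energy_comparison:
  assumes x: "x \<in> ball 0 r" and Q: "gauge_chart M (Y x) e' \<nu>' r' f' U'"
  shows "energy_lower x \<le> gauge_chart.frame_energy e'"
    and "slope_sq x < 1 \<Longrightarrow> (1 - slope_sq x) * gauge_chart.frame_energy e' \<le> energy_lower x"
proof -
  interpret Q: gauge_chart M "Y x" e' \<nu>' r' f' U' by (rule Q)
  obtain \<theta> where on: "metric_orthonormal x \<theta>" and e: "\<And>i. e' i = dird (\<theta> i) Y x"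
    using chart_transition[OF x Q] by blast
  have lin: "linear (\<lambda>v. dird v Y x \<bullet> b)" for b
    by (rule linear_compose[OF linear_dird_Y[OF x], of "\<lambda>u. u \<bullet> b", unfolded o_def])
      (rule bounded_linear.linear[OF bounded_linear_inner_left])
  have F: "Q.frame_energy = (\<Sum>b\<in>Basis. \<Sum>i\<in>UNIV. (dird (\<theta> i) Y x \<bullet> b)\<^sup>2)"
    unfolding Q.frame_energy_def e norm_sq_eq_sum_Basis by (rule sum.swap)
  have L: "energy_lower x = (\<Sum>b\<in>Basis. \<Sum>a\<in>UNIV. (pd a Y x \<bullet> b)\<^sup>2)"
    unfolding energy_lower_def power2_norm_eq_inner[symmetric] norm_sq_eq_sum_Basis by (rule sum.swap)
  show "energy_lower x \<le> Q.frame_energy"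
    unfolding F L
  proof (rule sum_mono)
    fix b :: "('m, 'n) pseudo"
    show "(\<Sum>a\<in>UNIV. (pd a Y x \<bullet> b)\<^sup>2) \<le> (\<Sum>i\<in>UNIV. (dird (\<theta> i) Y x \<bullet> b)\<^sup>2)"
      using test_lower[OF x on lin, of b] sum_nonneg[of UNIV "\<lambda>s. (dird (slope s x) Y x \<bullet> b)\<^sup>2"] by simp
  qed
  show "(1 - slope_sq x) * Q.frame_energy \<le> energy_lower x" if "slope_sq x < 1"
    unfolding F L sum_distrib_left[of "1 - slope_sq x" _ Basis]
    by (intro sum_mono test_upper[OF x on lin that])
qed

definition curvature_cross :: "'m \<Rightarrow> 'n \<Rightarrow> 'n \<Rightarrow> real ^ 'm \<Rightarrow> real" where
  "curvature_cross a t s x = (\<Sum>c\<in>UNIV. pd c (f t) x * pd a (pd c (f s)) x)"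

definition curvature_tangential :: "'m \<Rightarrow> 'm \<Rightarrow> 'm \<Rightarrow> real ^ 'm \<Rightarrow> real" where
  "curvature_tangential a b c x = (\<Sum>s\<in>UNIV. pd a (pd b (f s)) x * pd c (f s) x)"

definition hessian_sq :: "real ^ 'm \<Rightarrow> real" where
  "hessian_sq x = (\<Sum>s\<in>UNIV. \<Sum>a\<in>UNIV. \<Sum>b\<in>UNIV. (pd a (pd b (f s)) x)\<^sup>2)"

definition tangential_sq :: "real ^ 'm \<Rightarrow> real" where
  "tangential_sq x = (\<Sum>a\<in>UNIV. \<Sum>b\<in>UNIV. \<Sum>c\<in>UNIV. (curvature_tangential a b c x)\<^sup>2)"

definition cross_sq :: "real ^ 'm \<Rightarrow> real" where
  "cross_sq x = (\<Sum>s\<in>UNIV. \<Sum>a\<in>UNIV. \<Sum>t\<in>UNIV. (curvature_cross a t s x)\<^sup>2)"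

text \<open>
  A smooth lower barrier for the curvature energy along the chart, touching it at the centre.  It is a
  polynomial in the derivatives of \<open>f\<close>; the terms beyond the Hessian carry the second-order effect of
  the inverse metric and of the projection to the normal space.
\<close>

definition curvature_lower :: "real ^ 'm \<Rightarrow> real" where
  "curvature_lower x = hessian_sq x + 2 * cross_sq x + tangential_sq x"

lemma curvature_energy_comparison:
  assumes x: "x \<in> ball 0 r" and Q: "gauge_chart M (Y x) e' \<nu>' r' f' U'"
  shows "curvature_lower x \<le> gauge_chart.curvature_energy f'"
    and "slope_sq x < 1 \<Longrightarrow> (1 - slope_sq x)^3 * gauge_chart.curvature_energy f' \<le> hessian_sq x + tangential_sq x"
proof -
  interpret Q: gauge_chart M "Y x" e' \<nu>' r' f' U' by (rule Q)
  obtain \<theta> where on: "metric_orthonormal x \<theta>" and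
    tr: "\<And>i j. (\<Sum>s\<in>UNIV. (pd i (pd j (f' s)) 0)\<^sup>2) =
      (\<Sum>s\<in>UNIV. (dird (\<theta> i) (dird (\<theta> j) (f s)) x)\<^sup>2) +
      (\<Sum>k\<in>UNIV. (\<Sum>s\<in>UNIV. dird (\<theta> i) (dird (\<theta> j) (f s)) x * dird (\<theta> k) (f s) x)\<^sup>2)"
    using chart_transition[OF x Q] by blast
  define B where "B s v w = dird v (dird w (f s)) x" for s v w
  define C where "C u v w = (\<Sum>s\<in>UNIV. B s v w * dird u (f s) x)" for u v w
  have linB: "linear (\<lambda>v. B s v w)" "linear (\<lambda>w. B s v w)" for s v w
    unfolding B_def by (rule bilinear_hessian[OF x])+
  have symB: "B s v w = B s w v" for s v w
    unfolding B_def by (rule dird_commute[OF open_ball x f_smooth])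
  have linC: "linear (\<lambda>v. C u v w)" "linear (\<lambda>w. C u v w)" "linear (\<lambda>u. C u v w)" for u v w
    unfolding C_def
    by (rule linearI;
      simp add: linear_add[OF linB(1)] linear_cmul[OF linB(1)] linear_add[OF linB(2)] linear_cmul[OF linB(2)]
        linear_add[OF linear_dird_f[OF x]] linear_cmul[OF linear_dird_f[OF x]] algebra_simps sum.distrib sum_distrib_left)+
  have symC: "C u v w = C u w v" for u v w unfolding C_def by (simp add: symB)
  have CE: "Q.curvature_energy = (\<Sum>s\<in>UNIV. \<Sum>i\<in>UNIV. \<Sum>j\<in>UNIV. (B s (\<theta> i) (\<theta> j))\<^sup>2)
    + (\<Sum>i\<in>UNIV. \<Sum>j\<in>UNIV. \<Sum>k\<in>UNIV. (C (\<theta> k) (\<theta> i) (\<theta> j))\<^sup>2)"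
  proof -
    have "Q.curvature_energy = (\<Sum>i\<in>UNIV. \<Sum>j\<in>UNIV. (\<Sum>s\<in>UNIV. (B s (\<theta> i) (\<theta> j))\<^sup>2) + (\<Sum>k\<in>UNIV. (C (\<theta> k) (\<theta> i) (\<theta> j))\<^sup>2))"
      unfolding Q.curvature_energy_def tr B_def C_def ..
    also have "\<dots> = (\<Sum>i\<in>UNIV. \<Sum>j\<in>UNIV. \<Sum>s\<in>UNIV. (B s (\<theta> i) (\<theta> j))\<^sup>2)
      + (\<Sum>i\<in>UNIV. \<Sum>j\<in>UNIV. \<Sum>k\<in>UNIV. (C (\<theta> k) (\<theta> i) (\<theta> j))\<^sup>2)"
      by (simp add: sum.distrib)
    also have "(\<Sum>i\<in>UNIV. \<Sum>j\<in>UNIV. \<Sum>s\<in>UNIV. (B s (\<theta> i) (\<theta> j))\<^sup>2) = (\<Sum>i\<in>UNIV. \<Sum>s\<in>UNIV. \<Sum>j\<in>UNIV. (B s (\<theta> i) (\<theta> j))\<^sup>2)"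
      by (rule sum.cong[OF refl], rule sum.swap)
    also have "\<dots> = (\<Sum>s\<in>UNIV. \<Sum>i\<in>UNIV. \<Sum>j\<in>UNIV. (B s (\<theta> i) (\<theta> j))\<^sup>2)" by (rule sum.swap)
    finally show ?thesis .
  qed
  have C3: "(\<Sum>i\<in>UNIV. \<Sum>j\<in>UNIV. \<Sum>c\<in>UNIV. (C (g c) (\<theta> i) (\<theta> j))\<^sup>2) = (\<Sum>c\<in>UNIV. \<Sum>i\<in>UNIV. \<Sum>j\<in>UNIV. (C (g c) (\<theta> i) (\<theta> j))\<^sup>2)" for g :: "'m \<Rightarrow> real ^ 'm"
  proof -
    have "(\<Sum>i\<in>UNIV. \<Sum>j\<in>UNIV. \<Sum>c\<in>UNIV. (C (g c) (\<theta> i) (\<theta> j))\<^sup>2) = (\<Sum>i\<in>UNIV. \<Sum>c\<in>UNIV. \<Sum>j\<in>UNIV. (C (g c) (\<theta> i) (\<theta> j))\<^sup>2)"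
      by (rule sum.cong[OF refl], rule sum.swap)
    also have "\<dots> = (\<Sum>c\<in>UNIV. \<Sum>i\<in>UNIV. \<Sum>j\<in>UNIV. (C (g c) (\<theta> i) (\<theta> j))\<^sup>2)" by (rule sum.swap)
    finally show ?thesis .
  qed
  have Tsq: "tangential_sq x = (\<Sum>c\<in>UNIV. \<Sum>a\<in>UNIV. \<Sum>b\<in>UNIV. (C (axis c 1) (axis a 1) (axis b 1))\<^sup>2)"
  proof -
    have "tangential_sq x = (\<Sum>a\<in>UNIV. \<Sum>b\<in>UNIV. \<Sum>c\<in>UNIV. (C (axis c 1) (axis a 1) (axis b 1))\<^sup>2)"
      unfolding tangential_sq_def curvature_tangential_def C_def B_def ..
    also have "\<dots> = (\<Sum>a\<in>UNIV. \<Sum>c\<in>UNIV. \<Sum>b\<in>UNIV. (C (axis c 1) (axis a 1) (axis b 1))\<^sup>2)"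
      by (rule sum.cong[OF refl], rule sum.swap)
    also have "\<dots> = (\<Sum>c\<in>UNIV. \<Sum>a\<in>UNIV. \<Sum>b\<in>UNIV. (C (axis c 1) (axis a 1) (axis b 1))\<^sup>2)" by (rule sum.swap)
    finally show ?thesis .
  qed
  have Hsq: "hessian_sq x = (\<Sum>s\<in>UNIV. \<Sum>a\<in>UNIV. \<Sum>b\<in>UNIV. (B s (axis a 1) (axis b 1))\<^sup>2)"
    unfolding hessian_sq_def B_def ..
  have cr: "curvature_cross a t s x = B s (axis a 1) (slope t x)" for a t s
    unfolding curvature_cross_def
    by (subst linear_vec_inner[OF linB(2)]) (simp add: inner_vec_def slope_def B_def mult.commute)
  show "curvature_lower x \<le> Q.curvature_energy"
  proof -
    have "hessian_sq x + 2 * cross_sq x \<le> (\<Sum>s\<in>UNIV. \<Sum>i\<in>UNIV. \<Sum>j\<in>UNIV. (B s (\<theta> i) (\<theta> j))\<^sup>2)"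
      unfolding Hsq cross_sq_def cr sum_distrib_left[of 2 _ "UNIV :: 'n set"] sum.distrib[symmetric]
    proof (rule sum_mono)
      fix s
      show "(\<Sum>a\<in>UNIV. \<Sum>b\<in>UNIV. (B s (axis a 1) (axis b 1))\<^sup>2) + 2 * (\<Sum>a\<in>UNIV. \<Sum>t\<in>UNIV. (B s (axis a 1) (slope t x))\<^sup>2)
         \<le> (\<Sum>i\<in>UNIV. \<Sum>j\<in>UNIV. (B s (\<theta> i) (\<theta> j))\<^sup>2)"
        by (rule test_lower_bilinear[OF x on linB(1,2) symB])
    qed
    moreover have "tangential_sq x \<le> (\<Sum>i\<in>UNIV. \<Sum>j\<in>UNIV. \<Sum>k\<in>UNIV. (C (\<theta> k) (\<theta> i) (\<theta> j))\<^sup>2)"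
    proof -
      have "tangential_sq x \<le> (\<Sum>c\<in>UNIV. \<Sum>i\<in>UNIV. \<Sum>j\<in>UNIV. (C (axis c 1) (\<theta> i) (\<theta> j))\<^sup>2)"
        unfolding Tsq
      proof (rule sum_mono)
        fix c :: 'm
        have "0 \<le> 2 * (\<Sum>a\<in>UNIV. \<Sum>s\<in>UNIV. (C (axis c 1) (axis a 1) (slope s x))\<^sup>2)"
          by (intro mult_nonneg_nonneg sum_nonneg) auto
        with test_lower_bilinear[OF x on linC(1,2) symC, of "axis c 1"]
        show "(\<Sum>a\<in>UNIV. \<Sum>b\<in>UNIV. (C (axis c 1) (axis a 1) (axis b 1))\<^sup>2) \<le> (\<Sum>i\<in>UNIV. \<Sum>j\<in>UNIV. (C (axis c 1) (\<theta> i) (\<theta> j))\<^sup>2)"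
          by linarith
      qed
      also have "\<dots> = (\<Sum>i\<in>UNIV. \<Sum>j\<in>UNIV. \<Sum>c\<in>UNIV. (C (axis c 1) (\<theta> i) (\<theta> j))\<^sup>2)" by (rule C3[symmetric])
      also have "\<dots> \<le> (\<Sum>i\<in>UNIV. \<Sum>j\<in>UNIV. \<Sum>k\<in>UNIV. (C (\<theta> k) (\<theta> i) (\<theta> j))\<^sup>2)"
      proof (rule sum_mono, rule sum_mono)
        fix i j :: 'm
        have "0 \<le> (\<Sum>s\<in>UNIV. (C (slope s x) (\<theta> i) (\<theta> j))\<^sup>2)" by (intro sum_nonneg) auto
        with test_lower[OF x on linC(3), of "\<theta> i" "\<theta> j"]
        show "(\<Sum>c\<in>UNIV. (C (axis c 1) (\<theta> i) (\<theta> j))\<^sup>2) \<le> (\<Sum>k\<in>UNIV. (C (\<theta> k) (\<theta> i) (\<theta> j))\<^sup>2)" by linarith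
      qed
      finally show ?thesis .
    qed
    ultimately show ?thesis unfolding CE curvature_lower_def by linarith
  qed
  show "(1 - slope_sq x)^3 * Q.curvature_energy \<le> hessian_sq x + tangential_sq x" if \<rho>: "slope_sq x < 1"
  proof -
    have r0: "0 \<le> slope_sq x" unfolding slope_sq_def by (intro sum_nonneg) auto
    let ?c = "1 - slope_sq x"
    have c: "0 \<le> ?c" "?c \<le> 1" using \<rho> r0 by auto
    have "?c^2 * (\<Sum>s\<in>UNIV. \<Sum>i\<in>UNIV. \<Sum>j\<in>UNIV. (B s (\<theta> i) (\<theta> j))\<^sup>2) \<le> hessian_sq x"
      unfolding Hsq sum_distrib_left[of "?c^2" _ "UNIV :: 'n set"]
      by (intro sum_mono test_upper_bilinear[OF x on \<rho> linB(1,2)])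
    moreover have "?c^3 * (\<Sum>s\<in>UNIV. \<Sum>i\<in>UNIV. \<Sum>j\<in>UNIV. (B s (\<theta> i) (\<theta> j))\<^sup>2) \<le> ?c^2 * (\<Sum>s\<in>UNIV. \<Sum>i\<in>UNIV. \<Sum>j\<in>UNIV. (B s (\<theta> i) (\<theta> j))\<^sup>2)"
      using c by (intro mult_right_mono power_decreasing sum_nonneg) auto
    moreover have "?c^3 * (\<Sum>i\<in>UNIV. \<Sum>j\<in>UNIV. \<Sum>k\<in>UNIV. (C (\<theta> k) (\<theta> i) (\<theta> j))\<^sup>2) \<le> tangential_sq x"
    proof -
      have "?c * (\<Sum>i\<in>UNIV. \<Sum>j\<in>UNIV. \<Sum>k\<in>UNIV. (C (\<theta> k) (\<theta> i) (\<theta> j))\<^sup>2)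
          = (\<Sum>i\<in>UNIV. \<Sum>j\<in>UNIV. ?c * (\<Sum>k\<in>UNIV. (C (\<theta> k) (\<theta> i) (\<theta> j))\<^sup>2))"
        by (simp add: sum_distrib_left)
      also have "\<dots> \<le> (\<Sum>i\<in>UNIV. \<Sum>j\<in>UNIV. \<Sum>c\<in>UNIV. (C (axis c 1) (\<theta> i) (\<theta> j))\<^sup>2)"
        by (intro sum_mono test_upper[OF x on linC(3) \<rho>])
      also have "\<dots> = (\<Sum>c\<in>UNIV. \<Sum>i\<in>UNIV. \<Sum>j\<in>UNIV. (C (axis c 1) (\<theta> i) (\<theta> j))\<^sup>2)" by (rule C3)
      finally have "?c^2 * (?c * (\<Sum>i\<in>UNIV. \<Sum>j\<in>UNIV. \<Sum>k\<in>UNIV. (C (\<theta> k) (\<theta> i) (\<theta> j))\<^sup>2))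
         \<le> ?c^2 * (\<Sum>c\<in>UNIV. \<Sum>i\<in>UNIV. \<Sum>j\<in>UNIV. (C (axis c 1) (\<theta> i) (\<theta> j))\<^sup>2)"
        by (rule mult_left_mono) simp
      also have "\<dots> = (\<Sum>c\<in>UNIV. ?c^2 * (\<Sum>i\<in>UNIV. \<Sum>j\<in>UNIV. (C (axis c 1) (\<theta> i) (\<theta> j))\<^sup>2))"
        by (rule sum_distrib_left)
      also have "\<dots> \<le> tangential_sq x"
        unfolding Tsq by (intro sum_mono test_upper_bilinear[OF x on \<rho> linC(1,2)])
      finally show ?thesis by (simp add: power3_eq_cube power2_eq_square mult.assoc)
    qed
    ultimately show ?thesis unfolding CE distrib_left by linarith
  qed
qed

end

section \<open>Laplacians at the centre of a chart\<close>

lemma dird_rotate: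
  fixes F :: "'a::real_normed_vector \<Rightarrow> real"
  assumes S: "open S" "x \<in> S" "smooth_on S F"
  shows "dird u (dird v (dird w F)) x = dird w (dird u (dird v F)) x"
proof -
  have "dird u (dird v (dird w F)) x = dird u (dird w (dird v F)) x"
    by (rule dird_cong_open[OF S(1,2)]) (rule dird_commute[OF S(1) _ S(3)])
  also have "\<dots> = dird w (dird u (dird v F)) x"
    by (rule dird_commute[OF S(1,2) smooth_on_dird[OF S(3)]])
  finally show ?thesis .
qed

lemma sum_squared_le:
  fixes y :: "'i::finite \<Rightarrow> real"
  shows "(\<Sum>i\<in>UNIV. y i)\<^sup>2 \<le> real CARD('i) * (\<Sum>i\<in>UNIV. (y i)\<^sup>2)"
  using Cauchy_Schwarz_ineq_sum[of "\<lambda>_. 1" y UNIV] by simp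

text \<open>
  The algebraic core of the Simons inequality.  With symmetric matrices \<open>A s\<close> for \<open>h s\<close>, both sides
  are twice a sum over \<open>s\<close> and \<open>t\<close>: of the traces of \<open>A s A t A s A t\<close> on the left, and of the squared
  norms of \<open>A s A t\<close> on the right.  The difference is the sum of the squared norms of the commutators.
\<close>

lemma commutator_trace_le:
  fixes h :: "'n::finite \<Rightarrow> 'm::finite \<Rightarrow> 'm \<Rightarrow> real"
  assumes sym: "\<And>s i j. h s i j = h s j i"
  shows "(\<Sum>s\<in>UNIV. \<Sum>a\<in>UNIV. \<Sum>b\<in>UNIV. h s a b *
      (\<Sum>c\<in>UNIV. \<Sum>d\<in>UNIV. (\<Sum>t\<in>UNIV. h t b c * h t a d + h t a c * h t b d) * h s d c))
    \<le> 2 * (\<Sum>s\<in>UNIV. \<Sum>t\<in>UNIV. \<Sum>a\<in>UNIV. \<Sum>p\<in>UNIV. (\<Sum>c\<in>UNIV. h s a c * h t c p)\<^sup>2)"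
proof -
  define P where "P s t a c = (\<Sum>b\<in>UNIV. h s a b * h t b c)" for s t a c
  have K: "(\<Sum>a\<in>UNIV. \<Sum>b\<in>UNIV. \<Sum>c\<in>UNIV. \<Sum>d\<in>UNIV. h s a b * (h t b c * h t a d * h s d c))
      = (\<Sum>a\<in>UNIV. \<Sum>c\<in>UNIV. P s t a c * P t s a c)" for s t
  proof (rule sum.cong[OF refl])
    fix a
    have "(\<Sum>b\<in>UNIV. \<Sum>c\<in>UNIV. \<Sum>d\<in>UNIV. h s a b * (h t b c * h t a d * h s d c))
       = (\<Sum>c\<in>UNIV. \<Sum>b\<in>UNIV. \<Sum>d\<in>UNIV. h s a b * (h t b c * h t a d * h s d c))" by (rule sum.swap)
    also have "\<dots> = (\<Sum>c\<in>UNIV. P s t a c * P t s a c)"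
      unfolding P_def sum_product by (intro sum.cong refl) (simp only: mult_ac)
    finally show "(\<Sum>b\<in>UNIV. \<Sum>c\<in>UNIV. \<Sum>d\<in>UNIV. h s a b * (h t b c * h t a d * h s d c))
      = (\<Sum>c\<in>UNIV. P s t a c * P t s a c)" .
  qed
  have K': "(\<Sum>a\<in>UNIV. \<Sum>b\<in>UNIV. \<Sum>c\<in>UNIV. \<Sum>d\<in>UNIV. h s a b * (h t a c * h t b d * h s d c))
      = (\<Sum>a\<in>UNIV. \<Sum>c\<in>UNIV. P s t a c * P t s a c)" for s t
    unfolding K[symmetric] by (subst sum.swap) (simp add: sym[of s])
  have out: "(\<Sum>a\<in>UNIV. \<Sum>b\<in>UNIV. \<Sum>c\<in>UNIV. \<Sum>d\<in>UNIV. \<Sum>t\<in>UNIV. F a b c d t)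
    = (\<Sum>t\<in>UNIV. \<Sum>a\<in>UNIV. \<Sum>b\<in>UNIV. \<Sum>c\<in>UNIV. \<Sum>d\<in>UNIV. F a b c d t)"
    for F :: "'m \<Rightarrow> 'm \<Rightarrow> 'm \<Rightarrow> 'm \<Rightarrow> 'n \<Rightarrow> real"
  proof -
    have 1: "(\<Sum>d\<in>UNIV. \<Sum>t\<in>UNIV. F a b c d t) = (\<Sum>t\<in>UNIV. \<Sum>d\<in>UNIV. F a b c d t)" for a b c by (rule sum.swap)
    have 2: "(\<Sum>c\<in>UNIV. \<Sum>t\<in>UNIV. \<Sum>d\<in>UNIV. F a b c d t) = (\<Sum>t\<in>UNIV. \<Sum>c\<in>UNIV. \<Sum>d\<in>UNIV. F a b c d t)" for a b by (rule sum.swap)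
    have 3: "(\<Sum>b\<in>UNIV. \<Sum>t\<in>UNIV. \<Sum>c\<in>UNIV. \<Sum>d\<in>UNIV. F a b c d t) = (\<Sum>t\<in>UNIV. \<Sum>b\<in>UNIV. \<Sum>c\<in>UNIV. \<Sum>d\<in>UNIV. F a b c d t)" for a by (rule sum.swap)
    have 4: "(\<Sum>a\<in>UNIV. \<Sum>t\<in>UNIV. \<Sum>b\<in>UNIV. \<Sum>c\<in>UNIV. \<Sum>d\<in>UNIV. F a b c d t) = (\<Sum>t\<in>UNIV. \<Sum>a\<in>UNIV. \<Sum>b\<in>UNIV. \<Sum>c\<in>UNIV. \<Sum>d\<in>UNIV. F a b c d t)" by (rule sum.swap)
    show ?thesis unfolding 1 2 3 4 ..
  qed
  have "(\<Sum>a\<in>UNIV. \<Sum>b\<in>UNIV. h s a b *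
      (\<Sum>c\<in>UNIV. \<Sum>d\<in>UNIV. (\<Sum>t\<in>UNIV. h t b c * h t a d + h t a c * h t b d) * h s d c))
    = (\<Sum>t\<in>UNIV. \<Sum>a\<in>UNIV. \<Sum>c\<in>UNIV. 2 * (P s t a c * P t s a c))" for s
  proof -
    have "(\<Sum>a\<in>UNIV. \<Sum>b\<in>UNIV. h s a b *
      (\<Sum>c\<in>UNIV. \<Sum>d\<in>UNIV. (\<Sum>t\<in>UNIV. h t b c * h t a d + h t a c * h t b d) * h s d c))
     = (\<Sum>a\<in>UNIV. \<Sum>b\<in>UNIV. \<Sum>c\<in>UNIV. \<Sum>d\<in>UNIV. \<Sum>t\<in>UNIV.
          h s a b * (h t b c * h t a d * h s d c) + h s a b * (h t a c * h t b d * h s d c))"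
      by (simp add: sum_distrib_left sum_distrib_right distrib_left distrib_right)
    also have "\<dots> = (\<Sum>t\<in>UNIV. \<Sum>a\<in>UNIV. \<Sum>b\<in>UNIV. \<Sum>c\<in>UNIV. \<Sum>d\<in>UNIV.
          h s a b * (h t b c * h t a d * h s d c) + h s a b * (h t a c * h t b d * h s d c))" by (rule out)
    also have "\<dots> = (\<Sum>t\<in>UNIV. (\<Sum>a\<in>UNIV. \<Sum>c\<in>UNIV. P s t a c * P t s a c) + (\<Sum>a\<in>UNIV. \<Sum>c\<in>UNIV. P s t a c * P t s a c))"
      unfolding sum.distrib K K' ..
    finally show ?thesis by (simp add: sum_distrib_left sum.distrib)
  qed
  then have "(\<Sum>s\<in>UNIV. \<Sum>a\<in>UNIV. \<Sum>b\<in>UNIV. h s a b *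
      (\<Sum>c\<in>UNIV. \<Sum>d\<in>UNIV. (\<Sum>t\<in>UNIV. h t b c * h t a d + h t a c * h t b d) * h s d c))
    = (\<Sum>s\<in>UNIV. \<Sum>t\<in>UNIV. \<Sum>a\<in>UNIV. \<Sum>c\<in>UNIV. 2 * (P s t a c * P t s a c))" by simp
  also have "\<dots> \<le> (\<Sum>s\<in>UNIV. \<Sum>t\<in>UNIV. \<Sum>a\<in>UNIV. \<Sum>c\<in>UNIV. (P s t a c)\<^sup>2 + (P t s a c)\<^sup>2)"
  proof (intro sum_mono)
    fix s t a c
    show "2 * (P s t a c * P t s a c) \<le> (P s t a c)\<^sup>2 + (P t s a c)\<^sup>2"
      using sum_squares_bound[of "P s t a c" "P t s a c"] by (simp add: mult.assoc)
  qed
  also have "\<dots> = (\<Sum>s\<in>UNIV. \<Sum>t\<in>UNIV. \<Sum>a\<in>UNIV. \<Sum>c\<in>UNIV. (P s t a c)\<^sup>2)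
     + (\<Sum>s\<in>UNIV. \<Sum>t\<in>UNIV. \<Sum>a\<in>UNIV. \<Sum>c\<in>UNIV. (P t s a c)\<^sup>2)"
    by (simp add: sum.distrib)
  also have "(\<Sum>s\<in>UNIV. \<Sum>t\<in>UNIV. \<Sum>a\<in>UNIV. \<Sum>c\<in>UNIV. (P t s a c)\<^sup>2) = (\<Sum>s\<in>UNIV. \<Sum>t\<in>UNIV. \<Sum>a\<in>UNIV. \<Sum>c\<in>UNIV. (P s t a c)\<^sup>2)"
    by (rule sum.swap)
  finally show ?thesis by (simp add: P_def)
qed

text \<open>
  The diagonal entries of the Gram matrix of the vectors \<open>h _ a b\<close> already carry enough of its square
  norm, by Cauchy--Schwarz over the pairs \<open>(a, b)\<close>.
\<close>

lemma gram_square_lower_bound: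
  fixes h :: "'n::finite \<Rightarrow> 'm::finite \<Rightarrow> 'm \<Rightarrow> real"
  shows "(\<Sum>s\<in>UNIV. \<Sum>a\<in>UNIV. \<Sum>b\<in>UNIV. (h s a b)\<^sup>2)\<^sup>2
    \<le> (real CARD('m))\<^sup>2 * (\<Sum>a\<in>UNIV. \<Sum>b\<in>UNIV. \<Sum>c\<in>UNIV. \<Sum>p\<in>UNIV. (\<Sum>s\<in>UNIV. h s p c * h s a b)\<^sup>2)"
proof -
  define y where "y a b = (\<Sum>s\<in>UNIV. (h s a b)\<^sup>2)" for a b
  have "(\<Sum>s\<in>UNIV. \<Sum>a\<in>UNIV. \<Sum>b\<in>UNIV. (h s a b)\<^sup>2) = (\<Sum>a\<in>UNIV. \<Sum>s\<in>UNIV. \<Sum>b\<in>UNIV. (h s a b)\<^sup>2)" by (rule sum.swap)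
  also have "\<dots> = (\<Sum>a\<in>UNIV. \<Sum>b\<in>UNIV. y a b)" unfolding y_def by (rule sum.cong[OF refl], rule sum.swap)
  finally have S: "(\<Sum>s\<in>UNIV. \<Sum>a\<in>UNIV. \<Sum>b\<in>UNIV. (h s a b)\<^sup>2) = (\<Sum>a\<in>UNIV. \<Sum>b\<in>UNIV. y a b)" .
  have "(\<Sum>a\<in>UNIV. \<Sum>b\<in>UNIV. y a b)\<^sup>2 \<le> real CARD('m) * (\<Sum>a\<in>UNIV. (\<Sum>b\<in>UNIV. y a b)\<^sup>2)"
    by (rule sum_squared_le)
  also have "\<dots> \<le> real CARD('m) * (\<Sum>a\<in>UNIV. real CARD('m) * (\<Sum>b\<in>UNIV. (y a b)\<^sup>2))"
    by (intro mult_left_mono sum_mono sum_squared_le) simp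
  also have "\<dots> = (real CARD('m))\<^sup>2 * (\<Sum>a\<in>UNIV. \<Sum>b\<in>UNIV. (y a b)\<^sup>2)"
    by (simp add: sum_distrib_left power2_eq_square mult.assoc)
  also have "\<dots> \<le> (real CARD('m))\<^sup>2 * (\<Sum>a\<in>UNIV. \<Sum>b\<in>UNIV. \<Sum>c\<in>UNIV. \<Sum>p\<in>UNIV. (\<Sum>s\<in>UNIV. h s p c * h s a b)\<^sup>2)"
  proof (intro mult_left_mono sum_mono)
    fix a b
    have "(y a b)\<^sup>2 = (\<Sum>s\<in>UNIV. h s a b * h s a b)\<^sup>2" by (simp add: y_def power2_eq_square)
    also have "\<dots> \<le> (\<Sum>p\<in>UNIV. (\<Sum>s\<in>UNIV. h s p b * h s a b)\<^sup>2)"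
      by (rule member_le_sum[where f = "\<lambda>p. (\<Sum>s\<in>UNIV. h s p b * h s a b)\<^sup>2"]) auto
    also have "\<dots> \<le> (\<Sum>c\<in>UNIV. \<Sum>p\<in>UNIV. (\<Sum>s\<in>UNIV. h s p c * h s a b)\<^sup>2)"
      by (rule member_le_sum[where f = "\<lambda>c. \<Sum>p\<in>UNIV. (\<Sum>s\<in>UNIV. h s p c * h s a b)\<^sup>2"]) (auto intro: sum_nonneg)
    finally show "(y a b)\<^sup>2 \<le> (\<Sum>c\<in>UNIV. \<Sum>p\<in>UNIV. (\<Sum>s\<in>UNIV. h s p c * h s a b)\<^sup>2)" .
  qed simp
  finally show ?thesis unfolding S .
qed

context gauge_chart
begin

text \<open>
  At the centre of the chart this is the Laplacian of the induced metric, as the Christoffel symbols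
  vanish there.
\<close>

definition laplacian :: "(real ^ 'm \<Rightarrow> real) \<Rightarrow> real" where
  "laplacian u = (\<Sum>p\<in>UNIV. pd p (pd p u) 0)"

lemma laplacian_sum:
  "(\<And>i. i \<in> I \<Longrightarrow> smooth_on (ball 0 r) (u i)) \<Longrightarrow> laplacian (\<lambda>x. \<Sum>i\<in>I. u i x) = (\<Sum>i\<in>I. laplacian (u i))"
  unfolding laplacian_def by (simp add: dird_dird_sum[OF open_ball_0] sum.swap[of _ I])

lemma laplacian_add:
  "smooth_on (ball 0 r) u \<Longrightarrow> smooth_on (ball 0 r) v \<Longrightarrow> laplacian (\<lambda>x. u x + v x) = laplacian u + laplacian v"
  unfolding laplacian_def by (simp add: dird_dird_add[OF open_ball_0] sum.distrib)

lemma laplacian_cmult: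
  assumes "smooth_on (ball 0 r) u"
  shows "laplacian (\<lambda>x. c * u x) = c * laplacian u"
proof -
  have "dird w (dird v (\<lambda>x. c * u x)) 0 = c * dird w (dird v u) 0" for v w
    using dird_dird_mult[OF open_ball_0 smooth_on_const assms, of w v c]
    by (simp add: dird_const) (simp add: dird_const[abs_def] dird_def)
  then show ?thesis by (simp add: laplacian_def sum_distrib_left)
qed

lemma laplacian_square:
  assumes u: "smooth_on (ball 0 r) u"
  shows "laplacian (\<lambda>x. (u x)\<^sup>2) = 2 * (\<Sum>p\<in>UNIV. (pd p u 0)\<^sup>2) + 2 * u 0 * laplacian u"
  unfolding laplacian_def power2_eq_square dird_dird_mult[OF open_ball_0 u u]
  by (simp add: sum.distrib sum_distrib_left algebra_simps)

lemma smooth_on_square: "smooth_on (ball 0 r) u \<Longrightarrow> smooth_on (ball 0 r) (\<lambda>x. (u x)\<^sup>2 :: real)"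
  unfolding power2_eq_square by (intro smooth_on_mult open_ball)

lemma laplacian_gradient: "laplacian (dird v (f s)) = dird v (trace_hessian s) 0"
proof -
  have "laplacian (dird v (f s)) = (\<Sum>p\<in>UNIV. dird v (pd p (pd p (f s))) 0)"
    unfolding laplacian_def by (rule sum.cong[OF refl], rule dird_rotate[OF open_ball_0 f_smooth])
  also have "\<dots> = dird v (trace_hessian s) 0"
    unfolding trace_hessian_def[abs_def]
    by (rule dird_sum[symmetric]) (rule smooth_on_differentiable[OF smooth_on_dird[OF smooth_on_dird[OF f_smooth]] open_ball_0(2)])
  finally show ?thesis .
qed

lemma laplacian_hessian: "laplacian (dird v (dird w (f s))) = dird v (dird w (trace_hessian s)) 0"
proof -
  have "laplacian (dird v (dird w (f s))) = (\<Sum>p\<in>UNIV. dird v (dird w (pd p (pd p (f s)))) 0)"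
    unfolding laplacian_def
  proof (rule sum.cong[OF refl])
    fix p :: 'm
    have "pd p (pd p (dird v (dird w (f s)))) 0 = dird v (pd p (pd p (dird w (f s)))) 0"
      by (rule dird_rotate[OF open_ball_0 smooth_on_dird[OF f_smooth]])
    also have "\<dots> = dird v (dird w (pd p (pd p (f s)))) 0"
      by (rule dird_cong_open[OF open_ball_0]) (rule dird_rotate[OF open_ball _ f_smooth])
    finally show "pd p (pd p (dird v (dird w (f s)))) 0 = dird v (dird w (pd p (pd p (f s)))) 0" .
  qed
  also have "\<dots> = dird v (dird w (trace_hessian s)) 0"
    unfolding trace_hessian_def[abs_def]
    by (rule dird_dird_sum[OF open_ball_0, symmetric]) (intro smooth_on_dird f_smooth)
  finally show ?thesis .
qed

lemma energy_lower_0: "energy_lower 0 = frame_energy"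
  by (simp add: energy_lower_def frame_energy_def dird_axis_Y_0 power2_norm_eq_inner)

lemma energy_lower_smooth: "smooth_on (ball 0 r) energy_lower"
  unfolding energy_lower_def[abs_def]
  by (intro smooth_on_sum smooth_on_bilinear[OF bounded_bilinear_inner] smooth_on_dird Y_smooth open_ball)

lemma curvature_energy_eq: "curvature_energy = hessian_sq 0"
proof -
  have "curvature_energy = (\<Sum>i\<in>UNIV. \<Sum>s\<in>UNIV. \<Sum>j\<in>UNIV. (pd i (pd j (f s)) 0)\<^sup>2)"
    unfolding curvature_energy_def by (rule sum.cong[OF refl], rule sum.swap)
  also have "\<dots> = hessian_sq 0" unfolding hessian_sq_def by (rule sum.swap)
  finally show ?thesis .
qed

text \<open>
  The Gauss map of a submanifold with parallel mean curvature is harmonic, and the frame energy is a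
  convex function of the plane.  Concretely, the terms with third derivatives of \<open>f\<close> sum to the
  derivative of the trace, and the remaining ones are Euclidean squares of normal vectors.
\<close>

theorem laplacian_energy_lower:
  assumes par: "\<And>v s. dird v (trace_hessian s) 0 = 0"
  shows "laplacian energy_lower \<ge> 2 * curvature_energy"
proof -
  have "laplacian energy_lower = (\<Sum>a\<in>UNIV. laplacian (\<lambda>x. pd a Y x \<bullet> pd a Y x))"
    unfolding energy_lower_def[abs_def]
    by (rule laplacian_sum) (intro smooth_on_bilinear[OF bounded_bilinear_inner] smooth_on_dird Y_smooth open_ball)
  also have "\<dots> = (\<Sum>a\<in>UNIV. 2 * (\<Sum>p\<in>UNIV. (norm (pd p (pd a Y) 0))\<^sup>2))"
  proof (rule sum.cong[OF refl])
    fix a :: 'm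
    let ?u = "pd a Y"
    have u: "smooth_on (ball 0 r) ?u" by (rule smooth_on_dird[OF Y_smooth])
    have third: "dird v (dird v ?u) 0 = (\<Sum>s\<in>UNIV. dird v (dird v (pd a (f s))) 0 *\<^sub>R \<nu> s)" for v
    proof -
      have "dird v (dird v ?u) 0 = dird v (\<lambda>x. \<Sum>s\<in>UNIV. dird v (pd a (f s)) x *\<^sub>R \<nu> s) 0"
        by (rule dird_cong_open[OF open_ball_0]) (rule dird_dird_Y)
      also have "\<dots> = (\<Sum>s\<in>UNIV. dird v (dird v (pd a (f s))) 0 *\<^sub>R \<nu> s)"
        by (rule dird_eqI)
          (auto intro!: derivative_eq_intros smooth_on_has_derivative[OF smooth_on_dird[OF smooth_on_dird[OF f_smooth]] open_ball_0(2)])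
      finally show ?thesis .
    qed
    have "(\<Sum>p\<in>UNIV. pd p (pd p ?u) 0) = (\<Sum>s\<in>UNIV. laplacian (pd a (f s)) *\<^sub>R \<nu> s)"
      unfolding third laplacian_def scaleR_sum_left by (rule sum.swap)
    also have "\<dots> = 0" by (simp add: laplacian_gradient par)
    finally have z: "(\<Sum>p\<in>UNIV. pd p (pd p ?u) 0) = 0" .
    have "laplacian (\<lambda>x. ?u x \<bullet> ?u x) = (\<Sum>p\<in>UNIV. 2 * (norm (pd p ?u 0))\<^sup>2 + 2 * (?u 0 \<bullet> pd p (pd p ?u) 0))"
      unfolding laplacian_def dird_dird_bilinear[OF bounded_bilinear_inner open_ball_0 u u]
      by (rule sum.cong[OF refl]) (simp add: power2_norm_eq_inner inner_commute)
    also have "\<dots> = 2 * (\<Sum>p\<in>UNIV. (norm (pd p ?u 0))\<^sup>2) + 2 * (?u 0 \<bullet> (\<Sum>p\<in>UNIV. pd p (pd p ?u) 0))"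
      by (simp add: sum.distrib sum_distrib_left inner_sum_right)
    finally show "laplacian (\<lambda>x. ?u x \<bullet> ?u x) = 2 * (\<Sum>p\<in>UNIV. (norm (pd p ?u 0))\<^sup>2)" unfolding z by simp
  qed
  also have "\<dots> \<ge> (\<Sum>a\<in>UNIV. 2 * (\<Sum>p\<in>UNIV. \<Sum>s\<in>UNIV. (pd p (pd a (f s)) 0)\<^sup>2))"
  proof (intro sum_mono mult_left_mono)
    fix a p :: 'm
    let ?n = "pd p (pd a Y) 0"
    have "pinner ?n ?n = - (\<Sum>s\<in>UNIV. (pd p (pd a (f s)) 0)\<^sup>2)"
      using adapted_pinner[OF ad, of ?n ?n] by (simp add: pinner_dird_dird_Y[OF open_ball_0(2)] power2_eq_square)
    then show "(\<Sum>s\<in>UNIV. (pd p (pd a (f s)) 0)\<^sup>2) \<le> (norm ?n)\<^sup>2"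
      using abs_pinner_le[of ?n ?n] by (simp add: power2_eq_square)
  qed simp
  moreover have "(\<Sum>a\<in>UNIV. 2 * (\<Sum>p\<in>UNIV. \<Sum>s\<in>UNIV. (pd p (pd a (f s)) 0)\<^sup>2)) = 2 * curvature_energy"
    unfolding curvature_energy_def sum_distrib_left[symmetric] by (subst sum.swap) (rule refl)
  ultimately show ?thesis by linarith
qed

abbreviation hess :: "'n \<Rightarrow> 'm \<Rightarrow> 'm \<Rightarrow> real" where
  "hess s a b \<equiv> pd a (pd b (f s)) 0"

lemma hess_sym: "hess s a b = hess s b a"
  by (rule dird_commute[OF open_ball_0 f_smooth])

lemma curvature_cross_smooth: "smooth_on (ball 0 r) (curvature_cross a t s)"
  unfolding curvature_cross_def[abs_def] by (intro smooth_on_sum smooth_on_mult smooth_on_dird f_smooth open_ball)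

lemma curvature_tangential_smooth: "smooth_on (ball 0 r) (curvature_tangential a b c)"
  unfolding curvature_tangential_def[abs_def] by (intro smooth_on_sum smooth_on_mult smooth_on_dird f_smooth open_ball)

lemma hessian_sq_smooth: "smooth_on (ball 0 r) hessian_sq"
  unfolding hessian_sq_def[abs_def] by (intro smooth_on_sum smooth_on_square smooth_on_dird f_smooth open_ball)

lemma cross_sq_smooth: "smooth_on (ball 0 r) cross_sq"
  unfolding cross_sq_def[abs_def] by (intro smooth_on_sum smooth_on_square curvature_cross_smooth open_ball)

lemma tangential_sq_smooth: "smooth_on (ball 0 r) tangential_sq"
  unfolding tangential_sq_def[abs_def] by (intro smooth_on_sum smooth_on_square curvature_tangential_smooth open_ball)

lemma curvature_cross_0: "curvature_cross a t s 0 = 0" "dird v (curvature_cross a t s) 0 = (\<Sum>c\<in>UNIV. dird v (pd c (f t)) 0 * hess s a c)"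
proof -
  show "curvature_cross a t s 0 = 0" by (simp add: curvature_cross_def df_0)
  have "dird v (curvature_cross a t s) 0 = (\<Sum>c\<in>UNIV. dird v (\<lambda>x. pd c (f t) x * pd a (pd c (f s)) x) 0)"
    unfolding curvature_cross_def[abs_def]
    by (rule dird_sum) (intro smooth_on_differentiable[OF _ open_ball_0(2)] smooth_on_mult smooth_on_dird f_smooth open_ball)
  also have "\<dots> = (\<Sum>c\<in>UNIV. dird v (pd c (f t)) 0 * hess s a c)"
    unfolding dird_mult[OF smooth_on_differentiable[OF smooth_on_dird[OF f_smooth] open_ball_0(2)] smooth_on_differentiable[OF smooth_on_dird[OF smooth_on_dird[OF f_smooth]] open_ball_0(2)]]
    by (simp add: df_0)
  finally show "dird v (curvature_cross a t s) 0 = (\<Sum>c\<in>UNIV. dird v (pd c (f t)) 0 * hess s a c)" .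
qed

lemma curvature_tangential_0: "curvature_tangential a b c 0 = 0" "dird v (curvature_tangential a b c) 0 = (\<Sum>s\<in>UNIV. dird v (pd c (f s)) 0 * hess s a b)"
proof -
  show "curvature_tangential a b c 0 = 0" by (simp add: curvature_tangential_def df_0)
  have "dird v (curvature_tangential a b c) 0 = (\<Sum>s\<in>UNIV. dird v (\<lambda>x. pd a (pd b (f s)) x * pd c (f s) x) 0)"
    unfolding curvature_tangential_def[abs_def]
    by (rule dird_sum) (intro smooth_on_differentiable[OF _ open_ball_0(2)] smooth_on_mult smooth_on_dird f_smooth open_ball)
  also have "\<dots> = (\<Sum>s\<in>UNIV. dird v (pd c (f s)) 0 * hess s a b)"
    unfolding dird_mult[OF smooth_on_differentiable[OF smooth_on_dird[OF smooth_on_dird[OF f_smooth]] open_ball_0(2)] smooth_on_differentiable[OF smooth_on_dird[OF f_smooth] open_ball_0(2)]]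
    by (simp add: df_0 mult.commute)
  finally show "dird v (curvature_tangential a b c) 0 = (\<Sum>s\<in>UNIV. dird v (pd c (f s)) 0 * hess s a b)" .
qed

lemma curvature_lower_0: "curvature_lower 0 = curvature_energy"
  by (simp add: curvature_lower_def curvature_energy_eq cross_sq_def tangential_sq_def curvature_cross_0 curvature_tangential_0)

lemma curvature_lower_smooth: "smooth_on (ball 0 r) curvature_lower"
  unfolding curvature_lower_def[abs_def]
  by (intro smooth_on_add smooth_on_mult smooth_on_const hessian_sq_smooth cross_sq_smooth tangential_sq_smooth open_ball)

lemma laplacian_hessian_sq:
  assumes H0: "\<And>q. q \<in> M \<Longrightarrow> mean_curvature M q = 0"
  shows "laplacian hessian_sq \<ge> - 2 * (\<Sum>s\<in>UNIV. \<Sum>a\<in>UNIV. \<Sum>b\<in>UNIV. hess s a b *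
      (\<Sum>c\<in>UNIV. \<Sum>d\<in>UNIV. (\<Sum>t\<in>UNIV. hess t b c * hess t a d + hess t a c * hess t b d) * hess s d c))"
proof -
  have md: "dird w (dird v (trace_hessian s)) 0 =
    - (\<Sum>a\<in>UNIV. \<Sum>b\<in>UNIV. dird w (dird v (slope_gram a b)) 0 * hess s b a)" for v w s
    by (rule maximal_dird_dird_trace_hessian) (rule H0)
  have sm: "smooth_on (ball 0 r) (dird v (dird w (f s)))" for v w s by (intro smooth_on_dird f_smooth)
  have "laplacian hessian_sq = (\<Sum>s\<in>UNIV. \<Sum>a\<in>UNIV. \<Sum>b\<in>UNIV. laplacian (\<lambda>x. (pd a (pd b (f s)) x)\<^sup>2))"
    unfolding hessian_sq_def[abs_def]
    by (subst laplacian_sum, (intro smooth_on_sum smooth_on_square sm open_ball), rule sum.cong[OF refl])+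
      (rule refl)
  also have "\<dots> \<ge> (\<Sum>s\<in>UNIV. \<Sum>a\<in>UNIV. \<Sum>b\<in>UNIV. - 2 * (hess s a b *
      (\<Sum>c\<in>UNIV. \<Sum>d\<in>UNIV. (\<Sum>t\<in>UNIV. hess t b c * hess t a d + hess t a c * hess t b d) * hess s d c)))"
  proof (intro sum_mono)
    fix s a b
    have "laplacian (pd a (pd b (f s))) =
      - (\<Sum>c\<in>UNIV. \<Sum>d\<in>UNIV. (\<Sum>t\<in>UNIV. hess t b c * hess t a d + hess t a c * hess t b d) * hess s d c)"
      unfolding laplacian_hessian md dird_dird_slope_gram_0 ..
    moreover have "0 \<le> 2 * (\<Sum>p\<in>UNIV. (pd p (pd a (pd b (f s))) 0)\<^sup>2)"
      by (intro mult_nonneg_nonneg sum_nonneg) auto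
    ultimately show "- 2 * (hess s a b * (\<Sum>c\<in>UNIV. \<Sum>d\<in>UNIV. (\<Sum>t\<in>UNIV. hess t b c * hess t a d + hess t a c * hess t b d) * hess s d c))
       \<le> laplacian (\<lambda>x. (pd a (pd b (f s)) x)\<^sup>2)"
      unfolding laplacian_square[OF sm] by simp
  qed
  finally show ?thesis by (simp only: sum_distrib_left)
qed

lemma laplacian_cross_sq:
  "laplacian cross_sq = 2 * (\<Sum>s\<in>UNIV. \<Sum>t\<in>UNIV. \<Sum>a\<in>UNIV. \<Sum>p\<in>UNIV. (\<Sum>c\<in>UNIV. hess s a c * hess t c p)\<^sup>2)"
proof -
  have "laplacian cross_sq = (\<Sum>s\<in>UNIV. \<Sum>a\<in>UNIV. \<Sum>t\<in>UNIV. laplacian (\<lambda>x. (curvature_cross a t s x)\<^sup>2))"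
    unfolding cross_sq_def[abs_def]
    by (subst laplacian_sum, (intro smooth_on_sum smooth_on_square curvature_cross_smooth open_ball), rule sum.cong[OF refl])+
      (rule refl)
  also have "\<dots> = (\<Sum>s\<in>UNIV. \<Sum>a\<in>UNIV. \<Sum>t\<in>UNIV. 2 * (\<Sum>p\<in>UNIV. (\<Sum>c\<in>UNIV. hess s a c * hess t c p)\<^sup>2))"
    unfolding laplacian_square[OF curvature_cross_smooth] curvature_cross_0
    by (simp add: hess_sym mult.commute)
  also have "\<dots> = (\<Sum>s\<in>UNIV. \<Sum>t\<in>UNIV. \<Sum>a\<in>UNIV. 2 * (\<Sum>p\<in>UNIV. (\<Sum>c\<in>UNIV. hess s a c * hess t c p)\<^sup>2))"
    by (rule sum.cong[OF refl], rule sum.swap)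
  finally show ?thesis by (simp only: sum_distrib_left)
qed

lemma laplacian_tangential_sq:
  "laplacian tangential_sq = 2 * (\<Sum>a\<in>UNIV. \<Sum>b\<in>UNIV. \<Sum>c\<in>UNIV. \<Sum>p\<in>UNIV. (\<Sum>s\<in>UNIV. hess s p c * hess s a b)\<^sup>2)"
proof -
  have "laplacian tangential_sq = (\<Sum>a\<in>UNIV. \<Sum>b\<in>UNIV. \<Sum>c\<in>UNIV. laplacian (\<lambda>x. (curvature_tangential a b c x)\<^sup>2))"
    unfolding tangential_sq_def[abs_def]
    by (subst laplacian_sum, (intro smooth_on_sum smooth_on_square curvature_tangential_smooth open_ball), rule sum.cong[OF refl])+
      (rule refl)
  also have "\<dots> = (\<Sum>a\<in>UNIV. \<Sum>b\<in>UNIV. \<Sum>c\<in>UNIV. 2 * (\<Sum>p\<in>UNIV. (\<Sum>s\<in>UNIV. hess s p c * hess s a b)\<^sup>2))"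
    unfolding laplacian_square[OF curvature_tangential_smooth] curvature_tangential_0 by simp
  finally show ?thesis by (simp only: sum_distrib_left)
qed

text \<open>
  Twice differentiating the equation \<open>H = 0\<close> expresses the Laplacian of the Hessian term by traces of
  products of four Hessians.  By the commutator estimate the cross term compensates them.  The
  tangential term remains, and the Gram matrix estimate bounds it below by the squared energy.
\<close>

theorem simons_inequality:
  assumes H0: "\<And>q. q \<in> M \<Longrightarrow> mean_curvature M q = 0"
  shows "2 * curvature_energy\<^sup>2 \<le> (real CARD('m))\<^sup>2 * laplacian curvature_lower"
proof -
  have "laplacian curvature_lower = laplacian hessian_sq + 2 * laplacian cross_sq + laplacian tangential_sq"
    unfolding curvature_lower_def[abs_def]
    by (subst laplacian_add, intro smooth_on_add smooth_on_mult smooth_on_const hessian_sq_smooth cross_sq_smooth open_ball,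
        rule tangential_sq_smooth, subst laplacian_add, rule hessian_sq_smooth,
        intro smooth_on_mult smooth_on_const cross_sq_smooth open_ball, subst laplacian_cmult[OF cross_sq_smooth], rule refl)
  moreover have "laplacian hessian_sq + 2 * laplacian cross_sq \<ge> 0"
    using laplacian_hessian_sq[OF H0] commutator_trace_le[of hess, OF hess_sym] unfolding laplacian_cross_sq by linarith
  ultimately have "laplacian curvature_lower \<ge> 2 * (\<Sum>a\<in>UNIV. \<Sum>b\<in>UNIV. \<Sum>c\<in>UNIV. \<Sum>p\<in>UNIV. (\<Sum>s\<in>UNIV. hess s p c * hess s a b)\<^sup>2)"
    unfolding laplacian_tangential_sq by linarith
  then have "(real CARD('m))\<^sup>2 * laplacian curvature_lower \<ge> (real CARD('m))\<^sup>2 * (2 * (\<Sum>a\<in>UNIV. \<Sum>b\<in>UNIV. \<Sum>c\<in>UNIV. \<Sum>p\<in>UNIV. (\<Sum>s\<in>UNIV. hess s p c * hess s a b)\<^sup>2))"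
    by (intro mult_left_mono) auto
  moreover have "curvature_energy\<^sup>2 \<le> (real CARD('m))\<^sup>2 * (\<Sum>a\<in>UNIV. \<Sum>b\<in>UNIV. \<Sum>c\<in>UNIV. \<Sum>p\<in>UNIV. (\<Sum>s\<in>UNIV. hess s p c * hess s a b)\<^sup>2)"
    unfolding curvature_energy_eq hessian_sq_def by (rule gram_square_lower_bound)
  ultimately show ?thesis by linarith
qed

end

section \<open>The maximum principle on the submanifold\<close>

text \<open>
  The energies are defined through a chart chosen at each point.  The upper bounds in the comparison
  of charts make them upper semicontinuous, which is enough for maxima on compact sets to exist.
\<close>

definition usc_at :: "'a::topological_space set \<Rightarrow> ('a \<Rightarrow> real) \<Rightarrow> 'a \<Rightarrow> bool" where
  "usc_at M u p \<longleftrightarrow> (\<forall>a>u p. \<forall>\<^sub>F q in at p within M. u q < a)"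

lemma usc_at_subset: "usc_at M u p \<Longrightarrow> K \<subseteq> M \<Longrightarrow> usc_at K u p"
  unfolding usc_at_def by (meson at_le filter_leD)

lemma usc_at_add:
  assumes u: "usc_at M u p" and g: "continuous (at p within M) g"
  shows "usc_at M (\<lambda>q. u q + g q) p"
  unfolding usc_at_def
proof (intro allI impI)
  fix a assume a: "u p + g p < a"
  define \<delta> where "\<delta> = (a - (u p + g p)) / 2"
  have d: "\<delta> > 0" using a by (simp add: \<delta>_def)
  have 1: "\<forall>\<^sub>F q in at p within M. u q < u p + \<delta>" using u d unfolding usc_at_def by simp
  have 2: "\<forall>\<^sub>F q in at p within M. g q < g p + \<delta>"
    using g d unfolding continuous_within by (intro order_tendstoD) auto
  show "\<forall>\<^sub>F q in at p within M. u q + g q < a"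
    using eventually_conj[OF 1 2] by (rule eventually_mono) (auto simp: \<delta>_def field_simps)
qed

lemma usc_at_mult:
  assumes u: "usc_at M u p" and g: "continuous (at p within M) g" and nn: "\<And>q. g q \<ge> 0"
  shows "usc_at M (\<lambda>q. g q * u q) p"
  unfolding usc_at_def
proof (intro allI impI)
  fix a assume a: "g p * u p < a"
  \<comment> \<open>A value above \<open>u p\<close> with \<open>g p * b < a\<close>; the \<open>+ 1\<close> covers \<open>g p = 0\<close>.\<close>
  define b where "b = u p + (a - g p * u p) / (2 * (g p + 1))"
  have gp: "g p + 1 > 0" using nn[of p] by simp
  have b: "u p < b" using a gp by (simp add: b_def)
  have "g p * b = g p * u p + (g p / (g p + 1)) * ((a - g p * u p) / 2)"
    using gp by (simp add: b_def field_simps)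
  also have "\<dots> \<le> g p * u p + 1 * ((a - g p * u p) / 2)"
    using a gp nn[of p] by (intro add_left_mono mult_right_mono) auto
  also have "\<dots> < a" using a by (simp add: field_simps)
  finally have gb: "g p * b < a" .
  have 1: "\<forall>\<^sub>F q in at p within M. u q < b" using u b unfolding usc_at_def by simp
  have "((\<lambda>q. g q * b) \<longlongrightarrow> g p * b) (at p within M)"
    using g unfolding continuous_within by (intro tendsto_mult_right)
  then have 2: "\<forall>\<^sub>F q in at p within M. g q * b < a"
    using gb by (rule order_tendstoD)
  show "\<forall>\<^sub>F q in at p within M. g q * u q < a"
    using eventually_conj[OF 1 2]
  proof (rule eventually_mono)
    fix q assume q: "u q < b \<and> g q * b < a"
    then have "g q * u q \<le> g q * b" using nn[of q] by (intro mult_left_mono) auto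
    then show "g q * u q < a" using q by linarith
  qed
qed

text \<open>
  Otherwise each point has a neighbourhood on which \<open>u\<close> stays below a value attained elsewhere; for a
  finite subcover, the largest of these values contradicts itself.
\<close>

lemma usc_attains_max:
  fixes u :: "'a::topological_space \<Rightarrow> real"
  assumes K: "compact K" "K \<noteq> {}" and u: "\<And>p. p \<in> K \<Longrightarrow> usc_at K u p"
  shows "\<exists>p\<in>K. \<forall>q\<in>K. u q \<le> u p"
proof (rule ccontr)
  assume "\<not> ?thesis"
  then have "\<forall>p\<in>K. \<exists>q. q \<in> K \<and> u p < u q" by (meson not_le)
  then obtain g where g: "\<And>p. p \<in> K \<Longrightarrow> g p \<in> K" "\<And>p. p \<in> K \<Longrightarrow> u p < u (g p)" by metis
  have "\<exists>V. open V \<and> p \<in> V \<and> (\<forall>q\<in>K \<inter> V. u q < u (g p))" if p: "p \<in> K" for p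
  proof -
    have "\<forall>\<^sub>F q in at p within K. u q < u (g p)" using u[OF p] g(2)[OF p] unfolding usc_at_def by blast
    then obtain V where "open V" "p \<in> V" "\<forall>q\<in>V. q \<noteq> p \<longrightarrow> q \<in> K \<longrightarrow> u q < u (g p)"
      unfolding eventually_at_topological by blast
    then show ?thesis using g(2)[OF p] by (intro exI[of _ V]) auto
  qed
  then obtain V where V: "\<And>p. p \<in> K \<Longrightarrow> open (V p)" "\<And>p. p \<in> K \<Longrightarrow> p \<in> V p"
    "\<And>p q. p \<in> K \<Longrightarrow> q \<in> K \<Longrightarrow> q \<in> V p \<Longrightarrow> u q < u (g p)" by (metis IntI)
  obtain D where D: "D \<subseteq> K" "finite D" "K \<subseteq> (\<Union>p\<in>D. V p)"
  proof (rule compactE_image[OF K(1), of K V])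
    show "open (V t)" if "t \<in> K" for t by (rule V(1)[OF that])
    show "K \<subseteq> (\<Union>p\<in>K. V p)" using V(2) by blast
  qed
  have Dn: "D \<noteq> {}" using D(3) K(2) by auto
  define mx where "mx = Max ((\<lambda>p. u (g p)) ` D)"
  have "mx \<in> (\<lambda>p. u (g p)) ` D" unfolding mx_def using D(2) Dn by (intro Max_in) auto
  then obtain p where p: "p \<in> D" "mx = u (g p)" by blast
  have "g p \<in> K" using g(1) p D(1) by blast
  then obtain p' where p': "p' \<in> D" "g p \<in> V p'" using D(3) by blast
  have "u (g p) < u (g p')" using V(3)[of p' "g p"] p' D(1) \<open>g p \<in> K\<close> by blast
  moreover have "u (g p') \<le> mx" unfolding mx_def using D(2) p'(1) by (intro Max_ge) auto
  ultimately show False using p(2) by simp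
qed

context gauge_chart
begin

lemma local_max_centre:
  assumes N: "open N" "0 \<in> N" "N \<subseteq> ball 0 r" and u: "smooth_on (ball 0 r) u" and mx: "\<And>x. x \<in> N \<Longrightarrow> u x \<le> u 0"
  shows "dird v u 0 = 0" "dird v (dird v u) 0 \<le> 0" "laplacian u \<le> 0"
proof -
  note lm = local_max_second_derivative[OF N(1,2) smooth_on_subset[OF u N(3)] mx]
  show "dird v u 0 = 0" "dird v (dird v u) 0 \<le> 0" by (rule lm; assumption)+
  show "laplacian u \<le> 0" unfolding laplacian_def by (rule sum_nonpos) (rule lm(2))
qed

definition distance_sq :: "('m, 'n) pseudo \<Rightarrow> real ^ 'm \<Rightarrow> real" where
  "distance_sq c x = (Y x - c) \<bullet> (Y x - c)"

lemma Y_diff_smooth: "smooth_on (ball 0 r) (\<lambda>x. Y x - c)"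
  by (intro smooth_on_diff Y_smooth smooth_on_const open_ball)

lemma distance_sq_smooth: "smooth_on (ball 0 r) (distance_sq c)"
  unfolding distance_sq_def[abs_def] by (intro smooth_on_bilinear[OF bounded_bilinear_inner] Y_diff_smooth open_ball)

lemma dird_Y_diff: "x \<in> ball 0 r \<Longrightarrow> dird v (\<lambda>x. Y x - c) x = dird v Y x"
  by (rule dird_eqI[of _ "\<lambda>v. dird v Y x"]) (auto intro!: derivative_eq_intros smooth_on_has_derivative[OF Y_smooth])

lemma dird_distance_sq_0: "pd i (distance_sq c) 0 = 2 * ((p - c) \<bullet> e i)"
proof -
  note d = smooth_on_differentiable[OF Y_diff_smooth open_ball_0(2), of c]
  have "pd i (distance_sq c) 0 = (Y 0 - c) \<bullet> pd i (\<lambda>x. Y x - c) 0 + pd i (\<lambda>x. Y x - c) 0 \<bullet> (Y 0 - c)"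
    unfolding distance_sq_def[abs_def] by (rule dird_bilinear[OF bounded_bilinear_inner d d])
  then show ?thesis by (simp add: dird_Y_diff[OF open_ball_0(2)] dird_axis_Y_0 Y_0 inner_commute)
qed

lemma laplacian_distance_sq:
  "laplacian (distance_sq c) = 2 * frame_energy + 2 * real CARD('m) * ((p - c) \<bullet> mean_curvature M p)"
proof -
  have "dird v (dird v (distance_sq c)) 0 = 2 * (norm (dird v Y 0))\<^sup>2 + 2 * ((p - c) \<bullet> dird v (dird v Y) 0)" for v
  proof -
    have dd: "dird v (dird v (\<lambda>x. Y x - c)) 0 = dird v (dird v Y) 0"
      by (rule dird_cong_open[OF open_ball_0]) (rule dird_Y_diff)
    show ?thesis
      unfolding distance_sq_def[abs_def]
      by (subst dird_dird_bilinear[OF bounded_bilinear_inner open_ball_0 Y_diff_smooth Y_diff_smooth])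
        (simp add: dd dird_Y_diff[OF open_ball_0(2)] Y_0 power2_norm_eq_inner inner_commute)
  qed
  then have "laplacian (distance_sq c) = 2 * frame_energy + 2 * ((p - c) \<bullet> (\<Sum>i\<in>UNIV. pd i (pd i Y) 0))"
    by (simp add: laplacian_def sum.distrib sum_distrib_left inner_sum_right dird_axis_Y_0 frame_energy_def)
  also have "(\<Sum>i\<in>UNIV. pd i (pd i Y) 0) = (\<Sum>s\<in>UNIV. trace_hessian s 0 *\<^sub>R \<nu> s)"
    unfolding dird_dird_Y[OF open_ball_0(2)] trace_hessian_def scaleR_sum_left by (rule sum.swap)
  also have "\<dots> = real CARD('m) *\<^sub>R mean_curvature M p"
    unfolding mean_curvature_centre by simp
  finally show ?thesis by simp
qed

text \<open>
  The square of the trace is at most \<open>m\<close> times the squared norm, by Cauchy--Schwarz.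
\<close>

lemma mean_curvature_length_le:
  "- (real CARD('m) * pinner (mean_curvature M p) (mean_curvature M p)) \<le> curvature_energy"
proof -
  let ?m = "real CARD('m)" and ?H = "mean_curvature M p"
  have "?m *\<^sub>R ?H = (\<Sum>s\<in>UNIV. trace_hessian s 0 *\<^sub>R \<nu> s)" unfolding mean_curvature_centre by simp
  then have "?m * (?m * pinner ?H ?H) = pinner (\<Sum>s\<in>UNIV. trace_hessian s 0 *\<^sub>R \<nu> s) (\<Sum>s\<in>UNIV. trace_hessian s 0 *\<^sub>R \<nu> s)"
    by (metis pinner_simps(7) pinner_simps(8) real_scaleR_def)
  also have "\<dots> = - (\<Sum>s\<in>UNIV. (trace_hessian s 0)\<^sup>2)"
    unfolding pinner_simps ad_simps by (simp add: if_times_delta power2_eq_square sum_negf)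
  finally have 1: "- (?m * (?m * pinner ?H ?H)) = (\<Sum>s\<in>UNIV. (trace_hessian s 0)\<^sup>2)" by simp
  also have "\<dots> \<le> (\<Sum>s\<in>UNIV. ?m * (\<Sum>a\<in>UNIV. \<Sum>b\<in>UNIV. (hess s a b)\<^sup>2))"
  proof (rule sum_mono)
    fix s
    have "(trace_hessian s 0)\<^sup>2 \<le> ?m * (\<Sum>a\<in>UNIV. (hess s a a)\<^sup>2)"
      unfolding trace_hessian_def by (rule sum_squared_le)
    also have "\<dots> \<le> ?m * (\<Sum>a\<in>UNIV. \<Sum>b\<in>UNIV. (hess s a b)\<^sup>2)"
      by (intro mult_left_mono sum_mono member_le_sum[where f = "\<lambda>b. (hess s _ b)\<^sup>2"]) auto
    finally show "(trace_hessian s 0)\<^sup>2 \<le> ?m * (\<Sum>a\<in>UNIV. \<Sum>b\<in>UNIV. (hess s a b)\<^sup>2)" .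
  qed
  also have "\<dots> = ?m * curvature_energy"
    by (simp add: curvature_energy_eq hessian_sq_def sum_distrib_left)
  finally have "?m * (- (?m * pinner ?H ?H)) \<le> ?m * curvature_energy" by simp
  then show ?thesis by (rule mult_left_le_imp_le) simp
qed

lemma slope_sq_smooth: "smooth_on (ball 0 r) slope_sq"
  unfolding slope_sq_def[abs_def] by (intro smooth_on_sum smooth_on_square smooth_on_dird f_smooth open_ball)

lemma slope_sq_0: "slope_sq 0 = 0"
  by (simp add: slope_sq_def df_0)

lemma eventually_chart:
  assumes N: "open N" "0 \<in> N" and P: "\<And>x. x \<in> N \<Longrightarrow> x \<in> ball 0 r \<Longrightarrow> P (Y x)"
  shows "\<forall>\<^sub>F q in at p within M. P q"
proof -
  have "open (coord -` N)" using continuous_coord open_vimage[OF N(1)] by blast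
  then have "open (U \<inter> coord -` N)" using U by auto
  moreover have "p \<in> U \<inter> coord -` N" using p_in coord_p N(2) by simp
  moreover have "P q" if "q \<in> U \<inter> coord -` N" "q \<in> M" for q
    using P[of "coord q"] Y_coord[of q] that by simp
  ultimately show ?thesis unfolding eventually_at_topological by blast
qed

lemma frame_energy_usc:
  assumes Q: "\<And>q. q \<in> M \<Longrightarrow> gauge_chart M q (E' q) (N' q) (R' q) (F' q) (U' q)" and a: "frame_energy < a"
  shows "\<forall>\<^sub>F q in at p within M. gauge_chart.frame_energy (E' q) < a"
proof (rule eventually_chart)
  let ?N = "{x \<in> ball 0 r. slope_sq x < 1} \<inter> {x \<in> ball 0 r. energy_lower x < a * (1 - slope_sq x)}"
  have "continuous_on (ball 0 r) slope_sq" "continuous_on (ball 0 r) energy_lower"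
    using smooth_on_continuous_on slope_sq_smooth energy_lower_smooth by blast+
  then have c: "continuous_on (ball 0 r) slope_sq" "continuous_on (ball 0 r) energy_lower"
    "continuous_on (ball 0 r) (\<lambda>x. a * (1 - slope_sq x))" by (auto intro!: continuous_intros)
  have "{x \<in> ball 0 r. slope_sq x < 1} = ball 0 r \<inter> slope_sq -` {..<1}"
    "{x \<in> ball 0 r. energy_lower x < a * (1 - slope_sq x)} = ball 0 r \<inter> (\<lambda>x. a * (1 - slope_sq x) - energy_lower x) -` {0<..}" by auto
  moreover have "open (ball 0 r \<inter> slope_sq -` {..<1})"
    by (rule continuous_open_preimage[OF c(1) open_ball]) simp
  moreover have "open (ball 0 r \<inter> (\<lambda>x. a * (1 - slope_sq x) - energy_lower x) -` {0<..})"
    by (rule continuous_open_preimage[OF continuous_on_diff[OF c(3,2)] open_ball]) simp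
  ultimately show "open ?N" by auto
  show "0 \<in> ?N" using r a by (simp add: slope_sq_0 energy_lower_0)
  fix x assume x: "x \<in> ?N" "x \<in> ball 0 r"
  have "(1 - slope_sq x) * gauge_chart.frame_energy (E' (Y x)) \<le> energy_lower x"
    using frame_energy_comparison(2)[OF x(2) Q[OF Y_in(1)[OF x(2)]]] x(1) by blast
  also have "energy_lower x < (1 - slope_sq x) * a"
    using x(1) by (simp add: mult.commute)
  finally show "gauge_chart.frame_energy (E' (Y x)) < a"
    using x(1) by (auto simp: mult_less_cancel_left)
qed

lemma curvature_energy_usc:
  assumes Q: "\<And>q. q \<in> M \<Longrightarrow> gauge_chart M q (E' q) (N' q) (R' q) (F' q) (U' q)" and a: "curvature_energy < a"
  shows "\<forall>\<^sub>F q in at p within M. gauge_chart.curvature_energy (F' q) < a"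
proof (rule eventually_chart)
  let ?g = "\<lambda>x. a * (1 - slope_sq x) ^ 3 - (hessian_sq x + tangential_sq x)"
  let ?N = "(ball 0 r \<inter> slope_sq -` {..<1}) \<inter> (ball 0 r \<inter> ?g -` {0<..})"
  have c: "continuous_on (ball 0 r) slope_sq" "continuous_on (ball 0 r) hessian_sq" "continuous_on (ball 0 r) tangential_sq"
    using smooth_on_continuous_on slope_sq_smooth hessian_sq_smooth tangential_sq_smooth by blast+
  have "open (ball 0 r \<inter> slope_sq -` {..<1})"
    by (rule continuous_open_preimage[OF c(1) open_ball]) simp
  moreover have "open (ball 0 r \<inter> ?g -` {0<..})"
    by (rule continuous_open_preimage[OF _ open_ball]) (intro continuous_intros c, simp)
  ultimately show "open ?N" by (rule open_Int)
  have "tangential_sq 0 = 0" by (simp add: tangential_sq_def curvature_tangential_0)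
  then show "0 \<in> ?N" using r a by (simp add: slope_sq_0 curvature_energy_eq)
  fix x assume x: "x \<in> ?N" "x \<in> ball 0 r"
  have "(1 - slope_sq x) ^ 3 * gauge_chart.curvature_energy (F' (Y x)) \<le> hessian_sq x + tangential_sq x"
    using curvature_energy_comparison(2)[OF x(2) Q[OF Y_in(1)[OF x(2)]]] x(1) by blast
  also have "hessian_sq x + tangential_sq x < (1 - slope_sq x) ^ 3 * a"
    using x(1) by (simp add: mult.commute)
  finally have "(1 - slope_sq x) ^ 3 * gauge_chart.curvature_energy (F' (Y x)) < (1 - slope_sq x) ^ 3 * a" .
  moreover have "(1 - slope_sq x) ^ 3 > 0" using x(1) by simp
  ultimately show "gauge_chart.curvature_energy (F' (Y x)) < a"
    using mult_less_cancel_left_pos by blast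
qed

end

text \<open>
  The standing assumptions, with one chart chosen at every point.  The constant \<open>K\<close> expresses that the
  induced metric is uniformly equivalent to the Euclidean one, on tangent and on normal spaces.
\<close>

locale gauge_atlas =
  fixes M :: "('m::finite, 'n::finite) pseudo set"
    and E :: "('m, 'n) pseudo \<Rightarrow> 'm \<Rightarrow> ('m, 'n) pseudo" and N :: "('m, 'n) pseudo \<Rightarrow> 'n \<Rightarrow> ('m, 'n) pseudo"
    and R :: "('m, 'n) pseudo \<Rightarrow> real" and F :: "('m, 'n) pseudo \<Rightarrow> 'n \<Rightarrow> real ^ 'm \<Rightarrow> real"
    and W :: "('m, 'n) pseudo \<Rightarrow> ('m, 'n) pseudo set" and K :: real
  assumes chart: "q \<in> M \<Longrightarrow> gauge_chart M q (E q) (N q) (R q) (F q) (W q)"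
    and M_spacelike: "spacelike_submanifold M" and M_connected: "connected M" and M_closed: "closed M"
    and M_parallel: "parallel_mean_curvature M"
    and K: "K > 0"
    and tangent_bound: "q \<in> M \<Longrightarrow> v \<in> tangent_space M q \<Longrightarrow> (norm v)\<^sup>2 \<le> K * pinner v v"
    and normal_bound: "q \<in> M \<Longrightarrow> w \<in> pperp (tangent_space M q) \<Longrightarrow> (norm w)\<^sup>2 \<le> - (K * pinner w w)"
begin

definition frame_energy_at :: "('m, 'n) pseudo \<Rightarrow> real" where "frame_energy_at q = gauge_chart.frame_energy (E q)"

definition curvature_energy_at :: "('m, 'n) pseudo \<Rightarrow> real" where "curvature_energy_at q = gauge_chart.curvature_energy (F q)"

lemma frame_energy_at_usc: "p \<in> M \<Longrightarrow> usc_at M frame_energy_at p"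
  unfolding usc_at_def frame_energy_at_def using gauge_chart.frame_energy_usc[OF chart chart] by blast

lemma curvature_energy_at_usc: "p \<in> M \<Longrightarrow> usc_at M curvature_energy_at p"
  unfolding usc_at_def curvature_energy_at_def using gauge_chart.curvature_energy_usc[OF chart chart] by blast

lemma frame_energy_at_bounds:
  assumes q: "q \<in> M"
  shows "frame_energy_at q \<le> real CARD('m) * K" "frame_energy_at q \<ge> 0"
proof -
  interpret gauge_chart M q "E q" "N q" "R q" "F q" "W q" by (rule chart[OF q])
  have "(norm (E q i))\<^sup>2 \<le> K" for i
    using tangent_bound[OF q, of "E q i"] ad_to by (simp add: adapted_to_def ad_simps)
  then have "frame_energy \<le> (\<Sum>i\<in>(UNIV::'m set). K)" unfolding frame_energy_def by (intro sum_mono)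
  then show "frame_energy_at q \<le> real CARD('m) * K" by (simp add: frame_energy_at_def)
  show "frame_energy_at q \<ge> 0" unfolding frame_energy_at_def frame_energy_def by (intro sum_nonneg) simp
qed

lemma curvature_energy_at_nonneg: "q \<in> M \<Longrightarrow> curvature_energy_at q \<ge> 0"
  unfolding curvature_energy_at_def by (subst gauge_chart.curvature_energy_def[OF chart]) (auto intro!: sum_nonneg)

text \<open>
  Maximize the frame energy minus \<open>\<delta>\<^sup>2 (norm q)\<^sup>2\<close>.  At the maximum the Laplacian of the frame energy,
  at least a constant times \<open>\<kappa>\<close>, is bounded by that of the penalty.  The latter is \<open>O(\<delta>)\<close>: the maximum
  lies at distance \<open>O(1/\<delta>)\<close> since the frame energy is bounded, and the Laplacian of the squared
  distance grows linearly.
\<close>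

lemma mean_curvature_small:
  assumes q0: "q0 \<in> M" and \<delta>: "0 < \<delta>" "\<delta> \<le> 1"
    and \<kappa>: "\<kappa> > 0" "\<And>q. q \<in> M \<Longrightarrow> pinner (mean_curvature M q) (mean_curvature M q) = - \<kappa>"
  shows "\<kappa> \<le> \<delta> * (K + sqrt (real CARD('m) * K + (norm q0)\<^sup>2) * sqrt (K * \<kappa>))"
proof -
  let ?m = "real CARD('m)" and ?\<epsilon> = "\<delta>\<^sup>2"
  let ?u = "\<lambda>q. frame_energy_at q + (- ?\<epsilon> * (norm q)\<^sup>2)"
  have e: "?\<epsilon> > 0" "?\<epsilon> \<le> 1" using \<delta> by (auto simp: power_le_one)
  \<comment> \<open>Beyond this radius the penalty outweighs the bound on the frame energy.\<close>
  define \<rho> where "\<rho> = sqrt ((?m * K + ?\<epsilon> * (norm q0)\<^sup>2) / ?\<epsilon>)"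
  have q0\<rho>: "norm q0 \<le> \<rho>"
  proof -
    have "(norm q0)\<^sup>2 \<le> (?m * K + ?\<epsilon> * (norm q0)\<^sup>2) / ?\<epsilon>" using e(1) K by (simp add: field_simps)
    then show ?thesis unfolding \<rho>_def by (simp add: real_le_rsqrt)
  qed
  have comp: "compact (M \<inter> cball 0 \<rho>)" using M_closed compact_cball closed_Int_compact by blast
  have "\<exists>p\<in>M \<inter> cball 0 \<rho>. \<forall>q\<in>M \<inter> cball 0 \<rho>. ?u q \<le> ?u p"
  proof (rule usc_attains_max[OF comp])
    show "M \<inter> cball 0 \<rho> \<noteq> {}" using q0 q0\<rho> by auto
    fix p assume p: "p \<in> M \<inter> cball 0 \<rho>"
    have "usc_at M ?u p" by (rule usc_at_add[OF frame_energy_at_usc]) (use p in \<open>auto intro!: continuous_intros\<close>)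
    then show "usc_at (M \<inter> cball 0 \<rho>) ?u p" by (rule usc_at_subset) auto
  qed
  then obtain p where p: "p \<in> M" "\<And>q. q \<in> M \<Longrightarrow> norm q \<le> \<rho> \<Longrightarrow> ?u q \<le> ?u p" by auto
  have pmax: "?u q \<le> ?u p" if q: "q \<in> M" for q
  proof (cases "norm q \<le> \<rho>")
    case True then show ?thesis using p(2) q by blast
  next
    case False
    then have "(norm q)\<^sup>2 > (?m * K + ?\<epsilon> * (norm q0)\<^sup>2) / ?\<epsilon>"
      unfolding \<rho>_def by (meson not_le real_le_rsqrt)
    then have "?\<epsilon> * (norm q)\<^sup>2 > ?m * K + ?\<epsilon> * (norm q0)\<^sup>2" using e(1) by (simp add: field_simps)
    then have "?u q \<le> ?u q0" using frame_energy_at_bounds(1)[OF q] frame_energy_at_bounds(2)[OF q0] by simp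
    also have "\<dots> \<le> ?u p" by (rule p(2)[OF q0 q0\<rho>])
    finally show ?thesis .
  qed
  have pB: "\<delta> * norm p \<le> sqrt (?m * K + (norm q0)\<^sup>2)"
  proof -
    have "?\<epsilon> * (norm p)\<^sup>2 \<le> ?m * K + ?\<epsilon> * (norm q0)\<^sup>2"
      using pmax[OF q0] frame_energy_at_bounds(1)[OF p(1)] frame_energy_at_bounds(2)[OF q0] by simp
    also have "\<dots> \<le> ?m * K + 1 * (norm q0)\<^sup>2" using e by (intro add_left_mono mult_right_mono) auto
    finally have "(\<delta> * norm p)\<^sup>2 \<le> ?m * K + (norm q0)\<^sup>2" by (simp add: power_mult_distrib)
    then show ?thesis by (rule real_le_rsqrt)
  qed
  interpret gauge_chart M p "E p" "N p" "R p" "F p" "W p" by (rule chart[OF p(1)])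
  let ?\<phi> = "\<lambda>x. energy_lower x + (- ?\<epsilon>) * distance_sq 0 x"
  let ?H = "mean_curvature M p"
  have sm: "smooth_on (ball 0 (R p)) (\<lambda>x. (- ?\<epsilon>) * distance_sq 0 x)"
    by (intro smooth_on_mult smooth_on_const distance_sq_smooth open_ball)
  have "laplacian ?\<phi> \<le> 0"
  proof (rule local_max_centre(3)[OF open_ball_0 order_refl])
    show "smooth_on (ball 0 (R p)) ?\<phi>" by (rule smooth_on_add[OF open_ball energy_lower_smooth sm])
    fix x :: "real ^ 'm" assume x: "x \<in> ball 0 (R p)"
    have "?\<phi> x \<le> ?u (Y x)"
      using frame_energy_comparison(1)[OF x chart[OF Y_in(1)[OF x]]] by (simp add: frame_energy_at_def distance_sq_def power2_norm_eq_inner)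
    also have "\<dots> \<le> ?u p" by (rule pmax[OF Y_in(1)[OF x]])
    also have "\<dots> = ?\<phi> 0" by (simp add: energy_lower_0 frame_energy_at_def distance_sq_def Y_0 power2_norm_eq_inner)
    finally show "?\<phi> x \<le> ?\<phi> 0" .
  qed
  moreover have "laplacian ?\<phi> = laplacian energy_lower - ?\<epsilon> * laplacian (distance_sq 0)"
    by (subst laplacian_add[OF energy_lower_smooth sm], subst laplacian_cmult[OF distance_sq_smooth]) simp
  moreover have "2 * curvature_energy \<le> laplacian energy_lower"
    by (rule laplacian_energy_lower) (rule parallel_dird_trace_hessian[OF M_parallel])
  ultimately have 1: "curvature_energy \<le> ?\<epsilon> * (frame_energy + ?m * (p \<bullet> ?H))"
    unfolding laplacian_distance_sq by (simp add: algebra_simps)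
  have "?m * \<kappa> \<le> curvature_energy" using mean_curvature_length_le \<kappa>(2)[OF p(1)] by simp
  also note 1
  also have "?\<epsilon> * (frame_energy + ?m * (p \<bullet> ?H)) \<le> \<delta> * (?m * K + ?m * (sqrt (?m * K + (norm q0)\<^sup>2) * sqrt (K * \<kappa>)))"
  proof -
    have nH: "norm ?H \<le> sqrt (K * \<kappa>)"
      using normal_bound[OF p(1) mean_curvature_normal[OF M_spacelike p(1)]] \<kappa>(2)[OF p(1)] by (intro real_le_rsqrt) simp
    have "\<delta> * (p \<bullet> ?H) \<le> \<delta> * (norm p * norm ?H)"
      using \<delta> norm_cauchy_schwarz by (intro mult_left_mono) auto
    also have "\<dots> = (\<delta> * norm p) * norm ?H" by simp
    also have "\<dots> \<le> sqrt (?m * K + (norm q0)\<^sup>2) * sqrt (K * \<kappa>)"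
      using pB nH K by (intro mult_mono) auto
    finally have 2: "\<delta> * (p \<bullet> ?H) \<le> sqrt (?m * K + (norm q0)\<^sup>2) * sqrt (K * \<kappa>)" .
    have fe: "frame_energy \<le> ?m * K" "0 \<le> frame_energy" using frame_energy_at_bounds[OF p(1)] by (auto simp: frame_energy_at_def)
    have "\<delta> * frame_energy \<le> 1 * (?m * K)" using \<delta> fe by (intro mult_mono) auto
    moreover have "?m * (\<delta> * (p \<bullet> ?H)) \<le> ?m * (sqrt (?m * K + (norm q0)\<^sup>2) * sqrt (K * \<kappa>))"
      using 2 by (intro mult_left_mono) auto
    ultimately have "\<delta> * frame_energy + ?m * (\<delta> * (p \<bullet> ?H)) \<le> ?m * K + ?m * (sqrt (?m * K + (norm q0)\<^sup>2) * sqrt (K * \<kappa>))" by linarith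
    then have "\<delta> * (\<delta> * frame_energy + ?m * (\<delta> * (p \<bullet> ?H))) \<le> \<delta> * (?m * K + ?m * (sqrt (?m * K + (norm q0)\<^sup>2) * sqrt (K * \<kappa>)))"
      using \<delta> by (intro mult_left_mono) auto
    then show ?thesis by (simp add: power2_eq_square algebra_simps)
  qed
  finally have "?m * \<kappa> \<le> ?m * (\<delta> * (K + sqrt (?m * K + (norm q0)\<^sup>2) * sqrt (K * \<kappa>)))" by (simp add: algebra_simps)
  then show ?thesis by (rule mult_left_le_imp_le) simp
qed

theorem mean_curvature_zero:
  assumes q0: "q0 \<in> M"
  shows "mean_curvature M q0 = 0"
proof (rule ccontr)
  assume H: "mean_curvature M q0 \<noteq> 0"
  define \<kappa> where "\<kappa> = - pinner (mean_curvature M q0) (mean_curvature M q0)"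
  have "0 < (norm (mean_curvature M q0))\<^sup>2" using H by simp
  also have "\<dots> \<le> K * \<kappa>"
    using normal_bound[OF q0 mean_curvature_normal[OF M_spacelike q0]] by (simp add: \<kappa>_def)
  finally have k: "\<kappa> > 0" using K by (simp add: zero_less_mult_iff)
  have kc: "pinner (mean_curvature M q) (mean_curvature M q) = - \<kappa>" if "q \<in> M" for q
    using parallel_length_constant[OF M_spacelike M_connected M_parallel that q0] by (simp add: \<kappa>_def)
  define A where "A = K + sqrt (real CARD('m) * K + (norm q0)\<^sup>2) * sqrt (K * \<kappa>)"
  have A: "A > 0" unfolding A_def using K k by (intro add_pos_nonneg mult_nonneg_nonneg) auto
  define \<delta> where "\<delta> = min 1 (\<kappa> / (2 * A))"
  have d: "0 < \<delta>" "\<delta> \<le> 1" using A k by (auto simp: \<delta>_def)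
  have "\<kappa> \<le> \<delta> * A" unfolding A_def by (rule mean_curvature_small[OF q0 d k kc])
  also have "\<dots> \<le> (\<kappa> / (2 * A)) * A" using A by (intro mult_right_mono) (auto simp: \<delta>_def)
  also have "\<dots> = \<kappa> / 2" using A by simp
  finally show False using k by simp
qed

text \<open>
  Maximize the curvature energy times the square of the cutoff \<open>\<rho>\<^sup>2 - (norm (q - p0))\<^sup>2\<close>.  At the maximum
  the Simons inequality bounds the curvature energy by derivatives of the cutoff.  These are controlled
  because the mean curvature vanishes and tangent frames are bounded.  The distance in
  the cutoff is Euclidean, so the part of the closed set \<open>M\<close> where it is nonnegative is compact.
\<close>

lemma curvature_decay:
  assumes p0: "p0 \<in> M" and \<rho>: "\<rho> > 0"
  shows "curvature_energy_at p0 * \<rho>\<^sup>2 \<le> 14 * (real CARD('m))\<^sup>2 * (real CARD('m) * K)"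
proof (cases "curvature_energy_at p0 = 0")
  case True then show ?thesis using K by simp
next
  case False
  then have c0: "curvature_energy_at p0 > 0" using curvature_energy_at_nonneg[OF p0] by simp
  let ?m = "real CARD('m)"
  define \<eta> where "\<eta> q = \<rho>\<^sup>2 - (norm (q - p0))\<^sup>2" for q
  let ?u = "\<lambda>q. (\<eta> q)\<^sup>2 * curvature_energy_at q"
  have \<eta>n: "\<eta> q \<ge> 0" if "q \<in> cball p0 \<rho>" for q
    using that unfolding \<eta>_def by (simp add: dist_norm norm_minus_commute power_mono)
  have comp: "compact (M \<inter> cball p0 \<rho>)" using M_closed compact_cball closed_Int_compact by blast
  have "\<exists>p\<in>M \<inter> cball p0 \<rho>. \<forall>q\<in>M \<inter> cball p0 \<rho>. ?u q \<le> ?u p"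
  proof (rule usc_attains_max[OF comp])
    show "M \<inter> cball p0 \<rho> \<noteq> {}" using p0 \<rho> by auto
    fix p assume p: "p \<in> M \<inter> cball p0 \<rho>"
    have "usc_at M ?u p" by (rule usc_at_mult[OF curvature_energy_at_usc]) (use p in \<open>auto simp: \<eta>_def intro!: continuous_intros\<close>)
    then show "usc_at (M \<inter> cball p0 \<rho>) ?u p" by (rule usc_at_subset) auto
  qed
  then obtain p where p: "p \<in> M" "p \<in> cball p0 \<rho>" "\<And>q. q \<in> M \<Longrightarrow> q \<in> cball p0 \<rho> \<Longrightarrow> ?u q \<le> ?u p" by blast
  have up0: "?u p0 = \<rho>^4 * curvature_energy_at p0" by (simp add: \<eta>_def flip: power_mult)
  have "0 < ?u p0" unfolding up0 using \<rho> c0 by simp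
  also have u0: "?u p0 \<le> ?u p" using p(3)[OF p0] \<rho> by simp
  finally have upos: "?u p > 0" .
  then have \<eta>p: "\<eta> p > 0" using \<eta>n[OF p(2)] by (metis less_eq_real_def mult_zero_left power_zero_numeral less_irrefl)
  have cp: "curvature_energy_at p > 0" using upos curvature_energy_at_nonneg[OF p(1)] by (metis less_eq_real_def mult_zero_right less_irrefl)
  interpret gauge_chart M p "E p" "N p" "R p" "F p" "W p" by (rule chart[OF p(1)])
  define h where "h x = \<rho>\<^sup>2 + (-1) * distance_sq p0 x" for x
  have h\<eta>: "h x = \<eta> (Y x)" for x by (simp add: h_def \<eta>_def distance_sq_def power2_norm_eq_inner)
  have hsm: "smooth_on (ball 0 (R p)) h" unfolding h_def[abs_def]
    by (intro smooth_on_add smooth_on_mult smooth_on_const distance_sq_smooth open_ball)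
  let ?c = curvature_lower
  let ?\<phi> = "\<lambda>x. (h x * h x) * ?c x"
  have hh: "smooth_on (ball 0 (R p)) (\<lambda>x. h x * h x)" by (rule smooth_on_mult[OF open_ball hsm hsm])
  have \<phi>sm: "smooth_on (ball 0 (R p)) ?\<phi>" by (rule smooth_on_mult[OF open_ball hh curvature_lower_smooth])
  define NN where "NN = ball 0 (R p) \<inter> h -` {0<..}"
  have opN: "open NN" unfolding NN_def
    by (rule continuous_open_preimage[OF smooth_on_continuous_on[OF hsm] open_ball]) simp
  have N0: "0 \<in> NN" using \<eta>p open_ball_0(2) by (simp add: NN_def h\<eta> Y_0)
  have mx: "?\<phi> x \<le> ?\<phi> 0" if x: "x \<in> NN" for x
  proof -
    have xb: "x \<in> ball 0 (R p)" and hx: "h x > 0" using x by (auto simp: NN_def)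
    have "(norm (Y x - p0))\<^sup>2 < \<rho>\<^sup>2" using hx by (simp add: h\<eta> \<eta>_def)
    then have "norm (Y x - p0) < \<rho>" using \<rho> by (simp add: power_less_imp_less_base)
    then have inc: "Y x \<in> cball p0 \<rho>" by (simp add: dist_norm norm_minus_commute)
    have "?\<phi> x \<le> (h x * h x) * curvature_energy_at (Y x)"
      using curvature_energy_comparison(1)[OF xb chart[OF Y_in(1)[OF xb]]] by (intro mult_left_mono) (auto simp: curvature_energy_at_def)
    also have "\<dots> = ?u (Y x)" by (simp add: h\<eta> power2_eq_square)
    also have "\<dots> \<le> ?u p" by (rule p(3)[OF Y_in(1)[OF xb] inc])
    also have "\<dots> = ?\<phi> 0" by (simp add: h\<eta> Y_0 power2_eq_square curvature_lower_0 curvature_energy_at_def)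
    finally show ?thesis .
  qed
  have NNs: "NN \<subseteq> ball 0 (R p)" by (auto simp: NN_def)
  note lm = local_max_centre[OF opN N0 NNs \<phi>sm mx]
  define e where "e = h 0"
  define c where "c = ?c 0"
  have ep: "e = \<eta> p" by (simp add: e_def h\<eta> Y_0)
  have cE: "c = curvature_energy_at p" by (simp add: c_def curvature_lower_0 curvature_energy_at_def)
  have dif: "h differentiable at 0" "?c differentiable at 0" "(\<lambda>x. h x * h x) differentiable at 0"
    using smooth_on_differentiable[OF _ open_ball_0(2)] hsm hh curvature_lower_smooth by blast+
  \<comment> \<open>The first-order condition \<open>e c' = - 2 e' c\<close> eliminates the gradient of the curvature barrier.\<close>
  have key: "e * e * dird v (dird v ?c) 0 \<le> (6 * (dird v h 0)\<^sup>2 - 2 * e * dird v (dird v h) 0) * c" for v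
  proof -
    define h1 where "h1 = dird v h 0"
    define h2 where "h2 = dird v (dird v h) 0"
    define c1 where "c1 = dird v ?c 0"
    define c2 where "c2 = dird v (dird v ?c) 0"
    have d1: "dird v (\<lambda>x. h x * h x) 0 = 2 * e * h1"
      unfolding dird_mult[OF dif(1,1)] by (simp add: e_def h1_def)
    have "dird v ?\<phi> 0 = (e * e) * c1 + (2 * e * h1) * c"
      unfolding dird_mult[OF dif(3,2)] d1 by (simp add: e_def c_def c1_def)
    then have "e * (e * c1 + 2 * h1 * c) = 0" using lm(1)[of v] by (simp add: distrib_left mult_ac)
    then have z: "e * c1 = - 2 * h1 * c" using \<eta>p by (simp add: ep)
    have d2: "dird v (dird v (\<lambda>x. h x * h x)) 0 = 2 * e * h2 + 2 * h1 * h1"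
      unfolding dird_dird_mult[OF open_ball_0 hsm hsm] by (simp add: e_def h1_def h2_def)
    have "dird v (dird v ?\<phi>) 0 = (2 * e * h2 + 2 * h1 * h1) * c + 2 * ((2 * e * h1) * c1) + (e * e) * c2"
      unfolding dird_dird_mult[OF open_ball_0 hh curvature_lower_smooth] d1 d2
      by (simp add: e_def c_def c1_def c2_def)
    with lm(2)[of v] have "(2 * e * h2 + 2 * h1 * h1) * c + 4 * h1 * (e * c1) + (e * e) * c2 \<le> 0"
      by (simp add: mult_ac)
    then show ?thesis unfolding z h1_def[symmetric] h2_def[symmetric] c2_def[symmetric]
      by (simp add: power2_eq_square algebra_simps)
  qed
  have "e * e * laplacian ?c \<le> (\<Sum>i\<in>UNIV. (6 * (pd i h 0)\<^sup>2 - 2 * e * pd i (pd i h) 0) * c)"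
    unfolding laplacian_def sum_distrib_left by (intro sum_mono key)
  also have "\<dots> = (6 * (\<Sum>i\<in>UNIV. (pd i h 0)\<^sup>2) - 2 * e * laplacian h) * c"
    by (simp add: laplacian_def sum_distrib_left sum_subtractf sum_distrib_right left_diff_distrib)
  also have "\<dots> \<le> (28 * \<rho>\<^sup>2 * (?m * K)) * c"
  proof (rule mult_right_mono)
    have hl: "laplacian h = - 2 * frame_energy"
    proof -
      have "laplacian (\<lambda>x. \<rho>\<^sup>2 + (-1) * distance_sq p0 x) = laplacian (\<lambda>x. \<rho>\<^sup>2) + laplacian (\<lambda>x. (-1) * distance_sq p0 x)"
        by (rule laplacian_add) (intro smooth_on_mult smooth_on_const distance_sq_smooth open_ball)+
      also have "laplacian (\<lambda>x. \<rho>\<^sup>2) = 0" by (simp add: laplacian_def dird_const[abs_def])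
      also have "laplacian (\<lambda>x. (-1) * distance_sq p0 x) = (-1) * laplacian (distance_sq p0)" by (rule laplacian_cmult[OF distance_sq_smooth])
      finally show ?thesis unfolding h_def[abs_def] laplacian_distance_sq by (simp add: mean_curvature_zero[OF p(1)])
    qed
    have pn: "norm (p - p0) \<le> \<rho>" using p(2) by (simp add: dist_norm norm_minus_commute)
    have "(pd i h 0)\<^sup>2 \<le> 4 * \<rho>\<^sup>2 * (norm (E p i))\<^sup>2" for i
    proof -
      have "pd i h 0 = - pd i (distance_sq p0) 0"
      proof (rule dird_eqI[of _ "\<lambda>v. - dird v (distance_sq p0) 0"])
        show "(h has_derivative (\<lambda>v. - dird v (distance_sq p0) 0)) (at 0)"
          unfolding h_def[abs_def] by (auto intro!: derivative_eq_intros smooth_on_has_derivative[OF distance_sq_smooth open_ball_0(2)])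
      qed
      then have "(pd i h 0)\<^sup>2 = 4 * ((p - p0) \<bullet> E p i)\<^sup>2"
        unfolding dird_distance_sq_0 by (simp add: power_mult_distrib)
      also have "((p - p0) \<bullet> E p i)\<^sup>2 \<le> (norm (p - p0) * norm (E p i))\<^sup>2"
        using power_mono[OF Cauchy_Schwarz_ineq2[of "p - p0" "E p i"], of 2] by simp
      also have "\<dots> \<le> (\<rho> * norm (E p i))\<^sup>2" using pn by (intro power_mono mult_right_mono) auto
      finally show ?thesis by (simp add: power_mult_distrib)
    qed
    then have "(\<Sum>i\<in>UNIV. (pd i h 0)\<^sup>2) \<le> (\<Sum>i\<in>UNIV. 4 * \<rho>\<^sup>2 * (norm (E p i))\<^sup>2)" by (intro sum_mono)
    also have "\<dots> = 4 * \<rho>\<^sup>2 * frame_energy" by (simp add: frame_energy_def sum_distrib_left)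
    finally have g: "(\<Sum>i\<in>UNIV. (pd i h 0)\<^sup>2) \<le> 4 * \<rho>\<^sup>2 * frame_energy" .
    have fe: "frame_energy \<le> ?m * K" "0 \<le> frame_energy" using frame_energy_at_bounds[OF p(1)] by (auto simp: frame_energy_at_def)
    have "e \<le> \<rho>\<^sup>2" by (simp add: ep \<eta>_def)
    then have "e * frame_energy \<le> \<rho>\<^sup>2 * frame_energy" using fe by (intro mult_right_mono)
    with g have "6 * (\<Sum>i\<in>UNIV. (pd i h 0)\<^sup>2) - 2 * e * laplacian h \<le> 28 * (\<rho>\<^sup>2 * frame_energy)"
      unfolding hl by simp
    also have "\<dots> \<le> 28 * (\<rho>\<^sup>2 * (?m * K))" using fe by (intro mult_left_mono) auto
    finally show "6 * (\<Sum>i\<in>UNIV. (pd i h 0)\<^sup>2) - 2 * e * laplacian h \<le> 28 * \<rho>\<^sup>2 * (?m * K)" by (simp add: mult.assoc)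
    show "0 \<le> c" using cp by (simp add: cE)
  qed
  finally have lap: "e * e * laplacian ?c \<le> 28 * \<rho>\<^sup>2 * (?m * K) * c" .
  have "2 * c\<^sup>2 \<le> ?m\<^sup>2 * laplacian ?c"
    unfolding cE curvature_energy_at_def by (rule simons_inequality) (rule mean_curvature_zero)
  then have "e * e * (2 * c\<^sup>2) \<le> e * e * (?m\<^sup>2 * laplacian ?c)" by (intro mult_left_mono) auto
  also have "\<dots> = ?m\<^sup>2 * (e * e * laplacian ?c)" by simp
  also have "\<dots> \<le> ?m\<^sup>2 * (28 * \<rho>\<^sup>2 * (?m * K) * c)" using lap by (intro mult_left_mono) auto
  finally have "(2 * (e\<^sup>2 * c)) * c \<le> (28 * ?m\<^sup>2 * \<rho>\<^sup>2 * (?m * K)) * c" by (simp add: power2_eq_square mult_ac)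
  then have "2 * (e\<^sup>2 * c) \<le> 28 * ?m\<^sup>2 * \<rho>\<^sup>2 * (?m * K)" using cp by (simp add: cE)
  then have "\<rho>^4 * curvature_energy_at p0 \<le> 14 * ?m\<^sup>2 * \<rho>\<^sup>2 * (?m * K)"
    using u0 unfolding up0 ep cE by linarith
  then have "(curvature_energy_at p0 * \<rho>\<^sup>2) * \<rho>\<^sup>2 \<le> (14 * ?m\<^sup>2 * (?m * K)) * \<rho>\<^sup>2"
    by (simp add: power4_eq_xxxx power2_eq_square mult_ac)
  then show ?thesis using \<rho> by (simp add: mult_le_cancel_right)
qed

theorem curvature_zero:
  assumes q: "q \<in> M"
  shows "curvature_energy_at q = 0"
proof (rule ccontr)
  assume "curvature_energy_at q \<noteq> 0"
  then have c: "curvature_energy_at q > 0" using curvature_energy_at_nonneg[OF q] by simp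
  define B where "B = 14 * (real CARD('m))\<^sup>2 * (real CARD('m) * K)"
  have B: "B > 0" using K by (simp add: B_def)
  \<comment> \<open>At this radius the decay estimate reads \<open>2 * B \<le> B\<close>.\<close>
  have "curvature_energy_at q * (sqrt (2 * B / curvature_energy_at q))\<^sup>2 \<le> B" unfolding B_def
    by (rule curvature_decay[OF q]) (use c B in \<open>simp add: B_def\<close>)
  then show False using c B by simp
qed

text \<open>
  Vanishing curvature along the whole chart kills the Hessian of \<open>f\<close>, hence \<open>f\<close>.
\<close>

lemma flat_neighbourhood:
  assumes p: "p \<in> M"
  shows "\<exists>\<epsilon>>0. \<forall>q\<in>ball p \<epsilon>. q \<in> M \<longleftrightarrow> q - p \<in> tangent_space M p"
proof -
  interpret gauge_chart M p "E p" "N p" "R p" "F p" "W p" by (rule chart[OF p])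
  let ?f = "F p"
  have H0: "pd a (pd b (?f s)) x = 0" if x: "x \<in> ball 0 (R p)" for x a b s
  proof -
    have "0 \<le> cross_sq x" "0 \<le> tangential_sq x"
      unfolding cross_sq_def tangential_sq_def by (intro sum_nonneg; simp)+
    moreover have "curvature_lower x \<le> curvature_energy_at (Y x)"
      unfolding curvature_energy_at_def by (rule curvature_energy_comparison(1)[OF x chart[OF Y_in(1)[OF x]]])
    ultimately have "hessian_sq x \<le> 0"
      using curvature_zero[OF Y_in(1)[OF x]] unfolding curvature_lower_def by linarith
    moreover have "(pd a (pd b (?f s)) x)\<^sup>2 \<le> hessian_sq x"
    proof -
      have "(pd a (pd b (?f s)) x)\<^sup>2 \<le> (\<Sum>b\<in>UNIV. (pd a (pd b (?f s)) x)\<^sup>2)"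
        by (rule member_le_sum[where f = "\<lambda>b. (pd a (pd b (?f s)) x)\<^sup>2"]) auto
      also have "\<dots> \<le> (\<Sum>a\<in>UNIV. \<Sum>b\<in>UNIV. (pd a (pd b (?f s)) x)\<^sup>2)"
        by (rule member_le_sum[where f = "\<lambda>a. \<Sum>b\<in>UNIV. (pd a (pd b (?f s)) x)\<^sup>2"]) (auto intro: sum_nonneg)
      also have "\<dots> \<le> hessian_sq x" unfolding hessian_sq_def
        by (rule member_le_sum[where f = "\<lambda>s. \<Sum>a\<in>UNIV. \<Sum>b\<in>UNIV. (pd a (pd b (?f s)) x)\<^sup>2"]) (auto intro!: sum_nonneg)
      finally show ?thesis .
    qed
    ultimately have "(pd a (pd b (?f s)) x)\<^sup>2 \<le> 0" by linarith
    then show ?thesis by simp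
  qed
  have const0: "g x = 0" if g: "smooth_on (ball 0 (R p)) g" "g 0 = 0" "\<And>x a. x \<in> ball 0 (R p) \<Longrightarrow> pd a g x = 0"
    and x: "x \<in> ball 0 (R p)" for g :: "real ^ 'm \<Rightarrow> real" and x
  proof -
    have "(g has_derivative (\<lambda>v. 0)) (at y within ball 0 (R p))" if y: "y \<in> ball 0 (R p)" for y
    proof -
      have "dird v g y = 0" for v by (subst dird_expand[OF g(1) y]) (simp add: g(3)[OF y])
      then show ?thesis using smooth_on_has_derivative[OF g(1) y] has_derivative_at_withinI by fastforce
    qed
    then obtain k where "\<And>y. y \<in> ball 0 (R p) \<Longrightarrow> g y = k"
      using has_derivative_zero_constant[of "ball 0 (R p)" g] by auto
    then show ?thesis using g(2) x open_ball_0(2) by metis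
  qed
  have f1: "pd b (?f s) x = 0" if "x \<in> ball 0 (R p)" for x b s
    by (rule const0[OF smooth_on_dird[OF f_smooth] df_0 H0 that])
  have fz: "?f s x = 0" if "x \<in> ball 0 (R p)" for x s
    by (rule const0[OF f_smooth f_0 f1 that])
  have Yx: "Y x = p + (\<Sum>i\<in>UNIV. (x $ i) *\<^sub>R E p i)" if "x \<in> ball 0 (R p)" for x
    by (simp add: Y_def fz[OF that])
  have "open (coord -` ball 0 (R p))" using continuous_coord open_vimage open_ball by blast
  then have "open (W p \<inter> coord -` ball 0 (R p))" using U by auto
  moreover have "p \<in> W p \<inter> coord -` ball 0 (R p)" using p_in coord_p open_ball_0(2) by simp
  ultimately obtain \<epsilon> where \<epsilon>: "\<epsilon> > 0" "ball p \<epsilon> \<subseteq> W p \<inter> coord -` ball 0 (R p)"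
    using open_contains_ball by blast
  have ET: "E p i \<in> tangent_space M p" for i using ad_to by (simp add: adapted_to_def)
  have "q \<in> M \<longleftrightarrow> q - p \<in> tangent_space M p" if q: "q \<in> ball p \<epsilon>" for q
  proof
    have qW: "q \<in> W p" "coord q \<in> ball 0 (R p)" using q \<epsilon>(2) by auto
    {
      assume "q \<in> M"
      then have "q = Y (coord q)" using Y_coord(1) qW(1) by simp
      also have "\<dots> = p + (\<Sum>i\<in>UNIV. (coord q $ i) *\<^sub>R E p i)" by (rule Yx[OF qW(2)])
      finally have "q - p = (\<Sum>i\<in>UNIV. (coord q $ i) *\<^sub>R E p i)" by (metis add_diff_cancel_left')
      then show "q - p \<in> tangent_space M p"
        using ET tangent_space_props(1)[OF p] by (simp add: subspace_sum subspace_scale)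
    }
    {
      assume T: "q - p \<in> tangent_space M p"
      have "q - p = (\<Sum>i\<in>UNIV. pinner (q - p) (E p i) *\<^sub>R E p i) - (\<Sum>s\<in>UNIV. pinner (q - p) (N p s) *\<^sub>R N p s)"
        by (rule adapted_expand[OF ad])
      also have "(\<Sum>s\<in>UNIV. pinner (q - p) (N p s) *\<^sub>R N p s) = 0"
        using T adapted_to_mem[OF ad_to] by (intro sum.neutral) simp
      finally have "q = Y (coord q)" unfolding Yx[OF qW(2)] by (simp add: coord_def algebra_simps)
      then show "q \<in> M" using Y_in(1)[OF qW(2)] by simp
    }
  qed
  with \<epsilon>(1) show ?thesis by blast
qed

end

section \<open>Rigidity\<close>

text \<open>
  The tangent plane is locally constant, so by connectedness \<open>M\<close> lies in one affine plane.  It is open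
  and closed in that plane.
\<close>

lemma locally_flat_imp_affine:
  fixes M :: "'a::real_normed_vector set"
  assumes M: "closed M" "connected M" and T: "\<And>p. p \<in> M \<Longrightarrow> subspace (T p)"
    and flat: "\<And>p. p \<in> M \<Longrightarrow> \<exists>\<epsilon>>0. \<forall>q\<in>ball p \<epsilon>. q \<in> M \<longleftrightarrow> q - p \<in> T p"
  shows "affine M"
proof (cases "M = {}")
  case True then show ?thesis by simp
next
  case False
  then obtain p0 where p0: "p0 \<in> M" by blast
  have small: "\<exists>t>0. q + t *\<^sub>R v \<in> ball a \<epsilon> \<and> q + t *\<^sub>R v \<in> ball q \<epsilon>'" if "q \<in> ball a \<epsilon>" "\<epsilon>' > 0" for q v a :: 'a and \<epsilon> \<epsilon>'
  proof -
    have "open (ball a \<epsilon> \<inter> ball q \<epsilon>')" by auto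
    moreover have "q \<in> ball a \<epsilon> \<inter> ball q \<epsilon>'" using that by simp
    ultimately obtain d where d: "d > 0" "ball q d \<subseteq> ball a \<epsilon> \<inter> ball q \<epsilon>'"
      using open_contains_ball by blast
    define t where "t = d / (2 * (norm v + 1))"
    have nv: "norm v + 1 > 0" by (simp add: add_nonneg_pos)
    have t: "t > 0" using d nv by (simp add: t_def)
    have "t * norm v \<le> t * (norm v + 1)" using t by simp
    also have "\<dots> = d / 2" using nv by (simp add: t_def field_simps)
    also have "\<dots> < d" using d by simp
    finally have "q + t *\<^sub>R v \<in> ball q d" using t by (simp add: dist_norm)
    then show ?thesis using t d(2) by blast
  qed
  have loc: "\<exists>\<epsilon>>0. \<forall>q'\<in>M \<inter> ball q \<epsilon>. T q' = T q \<and> q' - q \<in> T q" if q: "q \<in> M" for q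
  proof -
    obtain \<epsilon> where e: "\<epsilon> > 0" "\<And>x. x \<in> ball q \<epsilon> \<Longrightarrow> x \<in> M \<longleftrightarrow> x - q \<in> T q" using flat[OF q] by blast
    have "T q' = T q \<and> q' - q \<in> T q" if q': "q' \<in> M" "q' \<in> ball q \<epsilon>" for q'
    proof -
      have d: "q' - q \<in> T q" using e(2)[OF q'(2)] q'(1) by blast
      obtain \<epsilon>' where e': "\<epsilon>' > 0" "\<And>x. x \<in> ball q' \<epsilon>' \<Longrightarrow> x \<in> M \<longleftrightarrow> x - q' \<in> T q'" using flat[OF q'(1)] by blast
      have "v \<in> T q' \<longleftrightarrow> v \<in> T q" for v
      proof -
        obtain t where t: "t > 0" "q' + t *\<^sub>R v \<in> ball q \<epsilon>" "q' + t *\<^sub>R v \<in> ball q' \<epsilon>'"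
          using small[OF q'(2) e'(1)] by blast
        have sc: "t *\<^sub>R v \<in> S \<longleftrightarrow> v \<in> S" if "subspace S" for S
        proof
          assume "t *\<^sub>R v \<in> S"
          then have "inverse t *\<^sub>R (t *\<^sub>R v) \<in> S" by (rule subspace_scale[OF that])
          then show "v \<in> S" using t(1) by simp
        qed (rule subspace_scale[OF that])
        have "v \<in> T q' \<longleftrightarrow> (q' + t *\<^sub>R v) - q' \<in> T q'" using sc[OF T[OF q'(1)]] by simp
        also have "\<dots> \<longleftrightarrow> q' + t *\<^sub>R v \<in> M" using e'(2)[OF t(3)] by simp
        also have "\<dots> \<longleftrightarrow> (q' + t *\<^sub>R v) - q \<in> T q" using e(2)[OF t(2)] .
        also have "\<dots> \<longleftrightarrow> t *\<^sub>R v \<in> T q"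
        proof
          assume "(q' + t *\<^sub>R v) - q \<in> T q"
          then have "((q' + t *\<^sub>R v) - q) - (q' - q) \<in> T q" using d by (rule subspace_diff[OF T[OF q]])
          then show "t *\<^sub>R v \<in> T q" by simp
        next
          assume "t *\<^sub>R v \<in> T q"
          then have "(q' - q) + t *\<^sub>R v \<in> T q" using d by (intro subspace_add[OF T[OF q]])
          then show "(q' + t *\<^sub>R v) - q \<in> T q" by (simp add: algebra_simps)
        qed
        also have "\<dots> \<longleftrightarrow> v \<in> T q" by (rule sc[OF T[OF q]])
        finally show ?thesis .
      qed
      then show ?thesis using d by blast
    qed
    then show ?thesis using e(1) by blast
  qed
  let ?R = "\<lambda>x y. T x = T y \<and> y - x \<in> T x \<and> x \<in> M \<and> y \<in> M"
  have all: "T q = T p0" "q - p0 \<in> T p0" if q: "q \<in> M" for q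
  proof -
    have "?R p0 q"
    proof (rule connected_equivalence_relation[OF M(2) p0 q])
      show "?R y x" if xy: "?R x y" for x y
      proof -
        have "- (y - x) \<in> T x" using xy T by (blast intro: subspace_neg)
        then show ?thesis using xy by simp
      qed
      show "?R x z" if xy: "?R x y" "?R y z" for x y z
      proof -
        have c: "T x = T y" "y - x \<in> T x" "z - y \<in> T y" "x \<in> M" using xy by blast+
        have "(y - x) + (z - y) \<in> T x"
          by (rule subspace_add[OF T[OF c(4)] c(2)]) (use c(1,3) in simp)
        then show ?thesis using xy by simp
      qed
      show "\<exists>V. openin (top_of_set M) V \<and> a \<in> V \<and> (\<forall>x\<in>V. ?R a x)" if a: "a \<in> M" for a
      proof -
        obtain \<epsilon> where e: "\<epsilon> > 0" "\<forall>q'\<in>M \<inter> ball a \<epsilon>. T q' = T a \<and> q' - a \<in> T a" using loc[OF a] by blast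
        have "?R a x" if x: "x \<in> M \<inter> ball a \<epsilon>" for x
        proof -
          have i: "T x = T a" "x - a \<in> T a" using e(2) x by blast+
          then show ?thesis using a x by (intro conjI i(1)[symmetric] i(2)) blast+
        qed
        moreover have "openin (top_of_set M) (M \<inter> ball a \<epsilon>)" by (simp add: openin_open_Int)
        moreover have "a \<in> M \<inter> ball a \<epsilon>" using a e(1) by simp
        ultimately show ?thesis by blast
      qed
    qed
    then show "T q = T p0" "q - p0 \<in> T p0" by auto
  qed
  let ?S = "(\<lambda>x. p0 + x) ` T p0"
  have affS: "affine ?S" using affine_translation subspace_imp_affine[OF T[OF p0]] by blast
  have MS: "M \<subseteq> ?S"
  proof
    fix q assume "q \<in> M"
    then have "q = p0 + (q - p0)" "q - p0 \<in> T p0" using all by auto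
    then show "q \<in> ?S" by (rule image_eqI)
  qed
  have "connected ?S" using affS affine_imp_convex convex_connected by blast
  moreover have "openin (top_of_set ?S) M"
    unfolding openin_contains_ball
  proof (intro conjI ballI)
    show "M \<subseteq> ?S" by (rule MS)
    fix q assume q: "q \<in> M"
    obtain \<epsilon> where e: "\<epsilon> > 0" "\<And>x. x \<in> ball q \<epsilon> \<Longrightarrow> x \<in> M \<longleftrightarrow> x - q \<in> T q" using flat[OF q] by blast
    have "x \<in> M" if x: "x \<in> ball q \<epsilon>" "x \<in> ?S" for x
    proof -
      have "x - p0 \<in> T p0" using x(2) by auto
      then have "(x - p0) - (q - p0) \<in> T p0" using all(2)[OF q] by (rule subspace_diff[OF T[OF p0]])
      then show ?thesis using e(2)[OF x(1)] all(1)[OF q] by simp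
    qed
    then show "\<exists>\<epsilon>>0. ball q \<epsilon> \<inter> ?S \<subseteq> M" using e(1) by blast
  qed
  moreover have "closedin (top_of_set ?S) M" using closed_subset[OF MS M(1)] .
  ultimately have "M = ?S" using False unfolding connected_clopen by blast
  then show ?thesis using affS by simp
qed

theorem theorem4p1:
  fixes M :: "('m::finite, 'n::finite) pseudo set"
  assumes "spacelike_submanifold M"
    and "connected M"
    and "closed M"
    and "parallel_mean_curvature M"
    and "grassmann_bounded (gauss_map M ` M)"
  shows "affine M"
proof -
  obtain K where K: "K > 0" "\<forall>P\<in>gauss_map M ` M. (\<forall>v\<in>P. (norm v)\<^sup>2 \<le> K * pinner v v) \<and> (\<forall>w\<in>pperp P. (norm w)\<^sup>2 \<le> - (K * pinner w w))"
    using grassmann_bounded_uniform[OF assms(5)] by blast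
  have "\<forall>q\<in>M. \<exists>z. case z of (e, \<nu>, r, f, U) \<Rightarrow> gauge_chart M q e \<nu> r f U"
    using gauge_chart_exists[OF assms(1)] by simp
  from bchoice[OF this] obtain z where z: "\<forall>q\<in>M. case z q of (e, \<nu>, r, f, U) \<Rightarrow> gauge_chart M q e \<nu> r f U" by blast
  have chart: "gauge_chart M q (fst (z q)) (fst (snd (z q))) (fst (snd (snd (z q))))
      (fst (snd (snd (snd (z q))))) (snd (snd (snd (snd (z q)))))" if "q \<in> M" for q
    using z that by (simp add: case_prod_unfold)
  interpret gauge_atlas M "\<lambda>q. fst (z q)" "\<lambda>q. fst (snd (z q))" "\<lambda>q. fst (snd (snd (z q)))"
    "\<lambda>q. fst (snd (snd (snd (z q))))" "\<lambda>q. snd (snd (snd (snd (z q))))" K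
  proof (rule gauge_atlas.intro)
    fix q v
    show "gauge_chart M q (fst (z q)) (fst (snd (z q))) (fst (snd (snd (z q))))
      (fst (snd (snd (snd (z q))))) (snd (snd (snd (snd (z q)))))" if "q \<in> M" by (rule chart[OF that])
    show "(norm v)\<^sup>2 \<le> K * pinner v v" if "q \<in> M" "v \<in> tangent_space M q"
      using K(2) that by (simp add: gauss_map_def)
    show "(norm v)\<^sup>2 \<le> - (K * pinner v v)" if "q \<in> M" "v \<in> pperp (tangent_space M q)"
      using K(2) that by (simp add: gauss_map_def)
  qed (fact assms K(1))+
  show ?thesis
  proof (rule locally_flat_imp_affine[OF assms(3,2)])
    show "subspace (tangent_space M p)" if "p \<in> M" for p
      using tangent_space_section(1) assms(1) that unfolding spacelike_submanifold_def by blast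
  qed (rule flat_neighbourhood)
qed

end
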